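(* Let $\Omega,\Sigma$ be measurable subsets of $\mathbb{R}^{d+1}_+$, let $1\leq p\leq 2$, $q=p/(p-1)$, let $\varepsilon_\Omega\ge 0$, $0\le\varepsilon_\Sigma<1$, and let $\varphi\in L^p_\alpha(\mathbb{R}^{d+1}_+)$. If $\varphi$ is $\varepsilon_\Omega$-concentrated to $\Omega$ in $L^p_\alpha(\mathbb{R}^{d+1}_+)$-norm and $\mathcal{F}_{W,\alpha}(\varphi)$ is $\varepsilon_\Sigma$-concentrated to $\Sigma$ in $L^q_\alpha(\mathbb{R}^{d+1}_+)$-norm, then $$\left\|\mathcal{F}_{W,\alpha}(\varphi)\right\|_{\alpha,q}\leq\frac{\left(\mu_\alpha(\Sigma)\right)^{\frac1q}\left(\mu_\alpha(\Omega)\right)^{\frac1q}+\varepsilon_\Omega}{1-\varepsilon_\Sigma}\,\left\|\varphi\right\|_{\alpha,p}.$$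
   Context: Fix an integer $d\geq 1$ and a real number $\alpha>-1/2$. Let $\mathbb{R}^{d+1}_+=\mathbb{R}^d\times(0,\infty)$, write $x=(x',x_{d+1})$ with $x'\in\mathbb{R}^d$. Equip $\mathbb{R}^{d+1}_+$ with the measure $$d\mu_\alpha(x)=\frac{x_{d+1}^{2\alpha+1}}{(2\pi)^{d/2}2^{\alpha}\Gamma(\alpha+1)}\,dx .$$ $L^p_\alpha(\mathbb{R}^{d+1}_+)$ is the $L^p$ space of this measure (complex-valued functions), with norm $\|\cdot\|_{\alpha,p}$, $1\le p\le\infty$. The Weinstein kernel is $\Lambda^d_\alpha(\lambda,x)=e^{-i\langle x',\lambda'\rangle}j_\alpha(x_{d+1}\lambda_{d+1})$, where $j_\alpha(r)=\Gamma(\alpha+1)\sum_{k\ge0}\frac{(-1)^k r^{2k}}{2^{2k}k!\,\Gamma(\alpha+k+1)}$ is the normalized Bessel function. The Weinstein transform of $\varphi\in L^1_\alpha(\mathbb{R}^{d+1}_+)$ is $$\mathcal{F}_{W,\alpha}(\varphi)(\lambda)=\int_{\mathbb{R}^{d+1}_+}\varphi(x)\Lambda^d_\alpha(x,\lambda)\,d\mu_\alpha(x),\quad \lambda\in\mathbb{R}^{d+1}_+.$$ It extends to an isometric isomorphism of $L^2_\alpha(\mathbb{R}^{d+1}_+)$ and, for $1\le p\le 2$, $q=p/(p-1)$ ($q=\infty$ if $p=1$), to a bounded linear map $L^p_\alpha\to L^q_\alpha$ satisfying $\|\mathcal{F}_{W,\alpha}(\varphi)\|_{\alpha,q}\le\|\varphi\|_{\alpha,p}$.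 Time-limiting operator: $P_\Omega\varphi=\varphi\chi_\Omega$. Weinstein integral operator $Q_\Sigma$: defined by $\mathcal{F}_{W,\alpha}(Q_\Sigma\varphi)=\mathcal{F}_{W,\alpha}(\varphi)\chi_\Sigma$ (only $\mathcal{F}_{W,\alpha}(Q_\Sigma\varphi)$, i.e. $\mathcal{F}_{W,\alpha}(\varphi)\chi_\Sigma$, is used below). Here $\chi$ denotes a characteristic function. $\varphi$ is $\varepsilon_\Omega$-concentrated to $\Omega$ in $L^p_\alpha$-norm if $\|\varphi-P_\Omega\varphi\|_{\alpha,p}\le\varepsilon_\Omega\|\varphi\|_{\alpha,p}$. $\mathcal{F}_{W,\alpha}(\varphi)$ is $\varepsilon_\Sigma$-concentrated to $\Sigma$ in $L^q_\alpha$-norm if $\|\mathcal{F}_{W,\alpha}(\varphi)-\mathcal{F}_{W,\alpha}(Q_\Sigma\varphi)\|_{\alpha,q}\le\varepsilon_\Sigma\|\mathcal{F}_{W,\alpha}(\varphi)\|_{\alpha,q}$. Conventions: $1/q=0$ when $q=\infty$ (and then powers with exponent $1/q$ equal $1$); measures may be $+\infty$, with $0\cdot\infty=0$. *)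

theory Defs
  imports "HOL-Analysis.Analysis" "HOL-Probability.Essential_Supremum"
begin

section \<open>Extended powers, \<open>L\<^sup>p\<close> norms and conjugate exponents\<close>

text \<open>
  Powers of extended nonnegative reals with a real exponent \<open>r \<ge> 0\<close>. The case \<open>r = 0\<close> is separated
  because \<open>0 powr 0 = 0\<close> in the library, whereas here \<open>x\<^sup>0 = 1\<close> for every \<open>x\<close> (including
  \<open>0\<close> and \<open>\<infinity>\<close>).
\<close>

definition ennreal_power :: "ennreal \<Rightarrow> real \<Rightarrow> ennreal" where
  "ennreal_power x r =
     (if r = 0 then 1 else if x = \<infinity> then \<infinity> else ennreal (enn2real x powr r))"

definition Lp_norm :: "'a measure \<Rightarrow> ennreal \<Rightarrow> ('a \<Rightarrow> complex) \<Rightarrow> ennreal" where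
  "Lp_norm M p f =
     (if p = \<infinity> then esssup M (\<lambda>x. ennreal (norm (f x)))
      else ennreal_power (\<integral>\<^sup>+ x. ennreal (norm (f x) powr enn2real p) \<partial>M) (1 / enn2real p))"

definition Lp_space :: "'a measure \<Rightarrow> ennreal \<Rightarrow> ('a \<Rightarrow> complex) set" where
  "Lp_space M p = {f \<in> borel_measurable M. Lp_norm M p f < \<infinity>}"

definition conj_exponent :: "real \<Rightarrow> ennreal" where
  "conj_exponent p = (if p = 1 then \<infinity> else ennreal (p / (p - 1)))"


section \<open>The Weinstein measure, kernel and transform\<close>

text \<open>
  A point \<open>x = (x', x\<^bsub>d+1\<^esub>)\<close> is a pair in \<open>(real ^ 'd) \<times> real\<close>, with \<open>d = CARD('d) \<ge> 1\<close>.
\<close>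

definition upper_halfspace :: "((real ^ 'd) \<times> real) set" where
  "upper_halfspace = UNIV \<times> {0<..}"

definition weinstein_measure :: "real \<Rightarrow> ((real ^ 'd) \<times> real) measure" where
  "weinstein_measure \<alpha> =
     density (lebesgue_on upper_halfspace)
       (\<lambda>x. ennreal (snd x powr (2 * \<alpha> + 1) /
          ((2 * pi) powr (real CARD('d) / 2) * 2 powr \<alpha> * Gamma (\<alpha> + 1))))"

definition normalized_bessel :: "real \<Rightarrow> real \<Rightarrow> real" where
  "normalized_bessel \<alpha> r =
     Gamma (\<alpha> + 1) *
       (\<Sum>k. (-1) ^ k * r ^ (2 * k) / (2 ^ (2 * k) * fact k * Gamma (\<alpha> + real k + 1)))"

definition weinstein_kernel ::
    "real \<Rightarrow> (real ^ 'd) \<times> real \<Rightarrow> (real ^ 'd) \<times> real \<Rightarrow> complex" where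
  "weinstein_kernel \<alpha> l x =
     exp (- \<i> * of_real (fst x \<bullet> fst l)) * of_real (normalized_bessel \<alpha> (snd x * snd l))"

definition weinstein_integral ::
    "real \<Rightarrow> ((real ^ 'd) \<times> real \<Rightarrow> complex) \<Rightarrow> (real ^ 'd) \<times> real \<Rightarrow> complex" where
  "weinstein_integral \<alpha> \<phi> l =
     (\<integral>x. \<phi> x * weinstein_kernel \<alpha> x l \<partial>weinstein_measure \<alpha>)"

text \<open>
  Extension by continuity from \<open>L\<^sup>1 \<inter> L\<^sup>p\<close>: \<open>g\<close> is a transform of \<open>\<phi>\<close> if it is the
  \<open>L\<^sup>q\<close>-limit of the integral transforms of some sequence in \<open>L\<^sup>1 \<inter> L\<^sup>p\<close> converging to \<open>\<phi>\<close> in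
  \<open>L\<^sup>p\<close>, where \<open>q\<close> is conjugate to \<open>p\<close>. No boundedness of the transform is built in.
\<close>

definition has_weinstein_transform ::
    "real \<Rightarrow> real \<Rightarrow> ((real ^ 'd) \<times> real \<Rightarrow> complex) \<Rightarrow> ((real ^ 'd) \<times> real \<Rightarrow> complex) \<Rightarrow> bool"
  where
  "has_weinstein_transform \<alpha> p \<phi> g \<longleftrightarrow>
     g \<in> borel_measurable (weinstein_measure \<alpha>) \<and>
     (\<exists>\<Phi> :: nat \<Rightarrow> (real ^ 'd) \<times> real \<Rightarrow> complex.
        (\<forall>n. \<Phi> n \<in> Lp_space (weinstein_measure \<alpha>) 1 \<inter> Lp_space (weinstein_measure \<alpha>) (ennreal p)) \<and>
        (\<lambda>n. Lp_norm (weinstein_measure \<alpha>) (ennreal p) (\<lambda>x. \<Phi> n x - \<phi> x)) \<longlonglongrightarrow> 0 \<and>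
        (\<lambda>n. Lp_norm (weinstein_measure \<alpha>) (conj_exponent p)
               (\<lambda>l. weinstein_integral \<alpha> (\<Phi> n) l - g l)) \<longlonglongrightarrow> 0)"

text \<open>
  The transform on \<open>L\<^sup>p\<close>, \<open>1 \<le> p \<le> 2\<close>. On integrable functions it is the integral itself; otherwise
  a representative of the extension, which is unique almost everywhere, is chosen.
\<close>

definition weinstein_transform ::
    "real \<Rightarrow> real \<Rightarrow> ((real ^ 'd) \<times> real \<Rightarrow> complex) \<Rightarrow> (real ^ 'd) \<times> real \<Rightarrow> complex" where
  "weinstein_transform \<alpha> p \<phi> =
     (if \<phi> \<in> Lp_space (weinstein_measure \<alpha>) 1 then weinstein_integral \<alpha> \<phi>
      else (SOME g. has_weinstein_transform \<alpha> p \<phi> g))"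


section \<open>Time- and band-limiting, concentration\<close>

definition time_limit :: "'a set \<Rightarrow> ('a \<Rightarrow> complex) \<Rightarrow> 'a \<Rightarrow> complex" where
  "time_limit \<Omega> \<phi> = (\<lambda>x. \<phi> x * indicator \<Omega> x)"

text \<open>
  The transform of the band-limited function \<open>Q\<^sub>\<Sigma> \<phi>\<close>. The operator \<open>Q\<^sub>\<Sigma>\<close> is specified only
  through this transform.
\<close>

definition weinstein_transform_band_limited ::
    "real \<Rightarrow> real \<Rightarrow> ((real ^ 'd) \<times> real) set \<Rightarrow> ((real ^ 'd) \<times> real \<Rightarrow> complex) \<Rightarrow>
     (real ^ 'd) \<times> real \<Rightarrow> complex" where
  "weinstein_transform_band_limited \<alpha> p \<Sigma> \<phi> =
     (\<lambda>l. weinstein_transform \<alpha> p \<phi> l * indicator \<Sigma> l)"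

definition time_concentrated ::
    "real \<Rightarrow> real \<Rightarrow> real \<Rightarrow> ((real ^ 'd) \<times> real) set \<Rightarrow> ((real ^ 'd) \<times> real \<Rightarrow> complex) \<Rightarrow> bool"
  where
  "time_concentrated \<alpha> p \<epsilon> \<Omega> \<phi> \<longleftrightarrow>
     Lp_norm (weinstein_measure \<alpha>) (ennreal p) (\<lambda>x. \<phi> x - time_limit \<Omega> \<phi> x)
       \<le> ennreal \<epsilon> * Lp_norm (weinstein_measure \<alpha>) (ennreal p) \<phi>"

definition transform_concentrated ::
    "real \<Rightarrow> real \<Rightarrow> real \<Rightarrow> ((real ^ 'd) \<times> real) set \<Rightarrow> ((real ^ 'd) \<times> real \<Rightarrow> complex) \<Rightarrow> bool"
  where
  "transform_concentrated \<alpha> p \<epsilon> \<Sigma> \<phi> \<longleftrightarrow>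
     Lp_norm (weinstein_measure \<alpha>) (conj_exponent p)
       (\<lambda>l. weinstein_transform \<alpha> p \<phi> l - weinstein_transform_band_limited \<alpha> p \<Sigma> \<phi> l)
       \<le> ennreal \<epsilon> * Lp_norm (weinstein_measure \<alpha>) (conj_exponent p) (weinstein_transform \<alpha> p \<phi>)"

end

theory Submission
  imports Defs "HOL-Probability.Characteristic_Functions" "HOL-Complex_Analysis.Conformal_Mappings"
begin

text \<open>
  Write \<open>F\<close> for the transform and \<open>\<chi>\<close> for characteristic functions. Two bounds carry the theorem:
  the Hausdorff--Young inequality \<open>\<parallel>F \<phi>\<parallel>\<^sub>q \<le> \<parallel>\<phi>\<parallel>\<^sub>p\<close> with constant one, and \<open>\<parallel>F \<psi>\<parallel>\<^sub>\<infinity> \<le> \<parallel>\<psi>\<parallel>\<^sub>1\<close>. Split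
  \<open>F \<phi> = (1 - \<chi>\<^sub>\<Sigma>) F \<phi> + \<chi>\<^sub>\<Sigma> F (\<chi>\<^sub>\<Omega> \<phi>) + \<chi>\<^sub>\<Sigma> F ((1 - \<chi>\<^sub>\<Omega>) \<phi>)\<close>. The first summand has norm at most
  \<open>\<epsilon>\<^sub>\<Sigma> \<parallel>F \<phi>\<parallel>\<^sub>q\<close>, and the third at most \<open>\<epsilon>\<^sub>\<Omega> \<parallel>\<phi>\<parallel>\<^sub>p\<close> by Hausdorff--Young. The second vanishes off
  \<open>\<Sigma>\<close> and is pointwise at most \<open>\<parallel>\<chi>\<^sub>\<Omega> \<phi>\<parallel>\<^sub>1\<close>, hence by Hoelder at most the \<open>1/q\<close>-th power of
  \<open>\<mu>(\<Omega>)\<close> times \<open>\<parallel>\<phi>\<parallel>\<^sub>p\<close>; integrating over \<open>\<Sigma>\<close> adds the \<open>1/q\<close>-th power of \<open>\<mu>(\<Sigma>)\<close>.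
  Because \<open>\<parallel>F \<phi>\<parallel>\<^sub>q\<close> is finite, the first summand can be absorbed on the left.
  The splitting is carried out on integrable functions (\<open>weinstein_integral_concentrated_le\<close>) and
  passes to the limit that defines the transform on \<open>L\<^sup>p\<close>. That this limit exists
  (\<open>has_weinstein_transform_weinstein_transform\<close>) follows from Hausdorff--Young and the completeness
  of \<open>L\<^sup>q\<close>.

  Hausdorff--Young is interpolated between \<open>L\<^sup>1 \<rightarrow> L\<^sup>\<infinity>\<close> and \<open>L\<^sup>2 \<rightarrow> L\<^sup>2\<close>. The three lines lemma gives
  it for a bilinear form on step functions (\<open>bilinear_interpolation\<close>); duality and density of step
  functions give the rest (\<open>hausdorff_young\<close>).

  The \<open>L\<^sup>1\<close> bound says that the kernel is bounded by one, which is Poisson's integral for the Bessel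
  function (\<open>abs_normalized_bessel_le_1\<close>). For the \<open>L\<^sup>2\<close> bound, integrate \<open>|F f|\<^sup>2\<close> against a Gaussian
  with parameter \<open>t\<close>. By Fubini the result is the quadratic form of \<open>f\<close> with respect to a heat
  kernel, the product of a Gaussian on \<open>\<real>\<^sup>d\<close> and the kernel of Weber's second exponential integral.
  This kernel is nonnegative, symmetric and of mass one, so the form is at most \<open>\<parallel>f\<parallel>\<^sub>2\<^sup>2\<close> by Schur's
  test, and \<open>t \<rightarrow> 0\<close> gives the claim (\<open>weinstein_plancherel_le\<close>). Weber's integral is computed by
  multiplying power series; the coefficients match by Vandermonde's identity.
\<close>

section \<open>Interpolation by the three lines lemma\<close>

text \<open>
  The factor \<open>exp (\<epsilon> (z\<^sup>2 - 1))\<close> is bounded by one on the strip and makes the product small for large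
  \<open>\<bar>Im z\<bar>\<close>, so the maximum modulus principle on a tall rectangle applies; then \<open>\<epsilon> \<rightarrow> 0\<close>.
\<close>

lemma three_lines:
  fixes f :: "complex \<Rightarrow> complex"
  assumes hol: "f holomorphic_on UNIV"
    and bdd: "\<And>z. 0 \<le> Re z \<Longrightarrow> Re z \<le> 1 \<Longrightarrow> norm (f z) \<le> D"
    and le0: "\<And>z. Re z = 0 \<Longrightarrow> norm (f z) \<le> 1"
    and le1: "\<And>z. Re z = 1 \<Longrightarrow> norm (f z) \<le> 1"
    and z: "0 \<le> Re z" "Re z \<le> 1"
  shows "norm (f z) \<le> 1"
proof -
  have D0: "0 \<le> D" using order_trans[OF norm_ge_zero bdd[of 0]] by simp
  define g where "g = (\<lambda>\<epsilon>::real. \<lambda>w. f w * exp (of_real \<epsilon> * (w\<^sup>2 - 1)))"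
  have Re_sq: "Re (w\<^sup>2 - 1) = (Re w)\<^sup>2 - (Im w)\<^sup>2 - 1" for w
    by (simp add: power2_eq_square)
  have g_norm: "norm (g \<epsilon> w) = norm (f w) * exp (\<epsilon> * ((Re w)\<^sup>2 - (Im w)\<^sup>2 - 1))" for \<epsilon> w
    unfolding g_def using Re_sq[of w] by (simp add: norm_mult)
  have g_le: "norm (g \<epsilon> z) \<le> 1" if \<epsilon>: "0 < \<epsilon>" for \<epsilon>
  proof -
    \<comment> \<open>At height \<open>R\<close> the factor is at most \<open>exp (- D)\<close>, and \<open>D exp (- D) \<le> 1\<close>.\<close>
    define R where "R = max (\<bar>Im z\<bar>) (sqrt (D / \<epsilon>)) + 1"
    have R: "\<bar>Im z\<bar> < R" "0 < R" "D \<le> \<epsilon> * R\<^sup>2"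
    proof -
      show "\<bar>Im z\<bar> < R" "0 < R" unfolding R_def by auto
      have "sqrt (D / \<epsilon>) \<le> R" unfolding R_def by auto
      hence "(sqrt (D / \<epsilon>))\<^sup>2 \<le> R\<^sup>2" using D0 \<epsilon> by (intro power_mono) auto
      hence "D / \<epsilon> \<le> R\<^sup>2" using D0 \<epsilon> by simp
      thus "D \<le> \<epsilon> * R\<^sup>2" using \<epsilon> by (simp add: field_simps)
    qed
    define S where "S = cbox (Complex 0 (-R)) (Complex 1 R)"
    have S_mem: "w \<in> S \<longleftrightarrow> 0 \<le> Re w \<and> Re w \<le> 1 \<and> -R \<le> Im w \<and> Im w \<le> R" for w
      unfolding S_def by (auto simp: in_cbox_complex_iff)
    have front: "frontier S = S - box (Complex 0 (-R)) (Complex 1 R)"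
      unfolding S_def frontier_def by (simp add: interior_cbox)
    have hol_g: "g \<epsilon> holomorphic_on UNIV"
      unfolding g_def using hol by (intro holomorphic_intros)
    show ?thesis
    proof (rule maximum_modulus_frontier[where S = S and f = "g \<epsilon>"])
      show "g \<epsilon> holomorphic_on interior S" using hol_g by (rule holomorphic_on_subset) auto
      show "continuous_on (closure S) (g \<epsilon>)"
        using holomorphic_on_imp_continuous_on[OF hol_g] by (rule continuous_on_subset) auto
      show "bounded S" unfolding S_def by simp
      show "z \<in> S" using z R by (auto simp: S_mem)
      fix w assume w: "w \<in> frontier S"
      have wS: "0 \<le> Re w" "Re w \<le> 1" "-R \<le> Im w" "Im w \<le> R"
        using w by (auto simp: front S_mem)
      have sq: "(Re w)\<^sup>2 \<le> 1" using wS by (simp add: power_le_one)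
      hence sq': "(Re w)\<^sup>2 - (Im w)\<^sup>2 - 1 \<le> 0" using zero_le_power2[of "Im w"] by linarith
      consider "Re w = 0" | "Re w = 1" | "\<bar>Im w\<bar> = R"
        using w wS unfolding front by (fastforce simp: in_box_complex_iff)
      then show "norm (g \<epsilon> w) \<le> 1"
      proof cases
        case 3
        have "(Im w)\<^sup>2 = R\<^sup>2" using 3 by (metis power2_abs)
        hence "(Re w)\<^sup>2 - (Im w)\<^sup>2 - 1 \<le> - R\<^sup>2" using sq by simp
        hence "\<epsilon> * ((Re w)\<^sup>2 - (Im w)\<^sup>2 - 1) \<le> - D"
          using R(3) \<epsilon> mult_left_mono[of "(Re w)\<^sup>2 - (Im w)\<^sup>2 - 1" "- R\<^sup>2" \<epsilon>] by simp
        hence "norm (g \<epsilon> w) \<le> D * exp (- D)"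
          unfolding g_norm using bdd[OF wS(1,2)] D0 by (intro mult_mono) auto
        also have "\<dots> \<le> 1" using exp_ge_add_one_self[of D] by (simp add: exp_minus field_simps)
        finally show ?thesis .
      next
        case 1
        have "\<epsilon> * ((Re w)\<^sup>2 - (Im w)\<^sup>2 - 1) \<le> 0" using sq' \<epsilon> by (simp add: mult_le_0_iff)
        thus ?thesis unfolding g_norm using le0[OF 1] by (intro mult_le_one) auto
      next
        case 2
        have "\<epsilon> * ((Re w)\<^sup>2 - (Im w)\<^sup>2 - 1) \<le> 0" using sq' \<epsilon> by (simp add: mult_le_0_iff)
        thus ?thesis unfolding g_norm using le1[OF 2] by (intro mult_le_one) auto
      qed
    qed
  qed
  have "((\<lambda>\<epsilon>. norm (g \<epsilon> z)) \<longlongrightarrow> norm (f z) * exp (0 * ((Re z)\<^sup>2 - (Im z)\<^sup>2 - 1))) (at_right 0)"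
    unfolding g_norm by (intro tendsto_intros)
  hence "((\<lambda>\<epsilon>. norm (g \<epsilon> z)) \<longlongrightarrow> norm (f z)) (at_right 0)" by simp
  thus ?thesis
    by (rule tendsto_upperbound) (auto simp: eventually_at_right_less g_le intro!: eventually_mono[OF eventually_at_right_less])
qed

text \<open>
  Riesz--Thorin for one bilinear form on weighted sequence spaces. The entry \<open>c\<close> of a vector is replaced
  by \<open>E c z\<close> of modulus \<open>|c|\<close> to the power \<open>p (1 - Re z / 2)\<close>. A vector in the unit ball of \<open>l\<^sup>p\<close> thereby
  moves to the unit ball of \<open>l\<^sup>1\<close> on \<open>Re z = 0\<close> and of \<open>l\<^sup>2\<close> on \<open>Re z = 1\<close>, and is recovered at
  \<open>\<theta> = 2 - 2 / p\<close>.
\<close>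

lemma bilinear_interpolation:
  fixes C :: "'i \<Rightarrow> 'j \<Rightarrow> complex" and m :: "'i \<Rightarrow> real" and n :: "'j \<Rightarrow> real"
  assumes H1: "\<And>a b. (\<Sum>i\<in>I. m i * norm (a i)) \<le> 1 \<Longrightarrow> (\<Sum>j\<in>J. n j * norm (b j)) \<le> 1 \<Longrightarrow>
        norm (\<Sum>i\<in>I. \<Sum>j\<in>J. C i j * a i * b j) \<le> 1"
    and H2: "\<And>a b. (\<Sum>i\<in>I. m i * (norm (a i))\<^sup>2) \<le> 1 \<Longrightarrow> (\<Sum>j\<in>J. n j * (norm (b j))\<^sup>2) \<le> 1 \<Longrightarrow>
        norm (\<Sum>i\<in>I. \<Sum>j\<in>J. C i j * a i * b j) \<le> 1"
    and p: "1 \<le> p" "p \<le> 2"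
    and a: "(\<Sum>i\<in>I. m i * norm (a i) powr p) \<le> 1"
    and b: "(\<Sum>j\<in>J. n j * norm (b j) powr p) \<le> 1"
  shows "norm (\<Sum>i\<in>I. \<Sum>j\<in>J. C i j * a i * b j) \<le> 1"
proof -
  define E :: "complex \<Rightarrow> complex \<Rightarrow> complex" where
    "E = (\<lambda>c z. if c = 0 then 0 else sgn c * exp (of_real p * (1 - z / 2) * of_real (ln (norm c))))"
  have E_norm: "norm (E c z) = norm c powr (p * (1 - Re z / 2))" for c z
    by (auto simp: E_def norm_mult norm_sgn powr_def)
  have E_norm0: "norm (E c z) = norm c powr p" if "Re z = 0" for c z
    using that by (simp add: E_norm)
  have E_norm1: "(norm (E c z))\<^sup>2 = norm c powr p" if "Re z = 1" for c z
    using that by (simp add: E_norm power2_eq_square flip: powr_add)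
  define \<theta> where "\<theta> = 2 - 2 / p"
  have \<theta>: "0 \<le> \<theta>" "\<theta> \<le> 1" "p * (1 - \<theta> / 2) = 1"
    using p by (auto simp: \<theta>_def field_simps)
  have E_\<theta>: "E c (of_real \<theta>) = c" for c
  proof (cases "c = 0")
    case False
    have "of_real p * (1 - of_real \<theta> / 2) = (of_real (p * (1 - \<theta> / 2)) :: complex)" by simp
    hence "E c (of_real \<theta>) = sgn c * exp (of_real (ln (norm c)))"
      unfolding E_def using False \<theta>(3) by (simp del: of_real_mult)
    also have "\<dots> = sgn c * of_real (norm c)" using False by (simp add: exp_of_real)
    also have "\<dots> = c" using False by (simp add: sgn_div_norm scaleR_conv_of_real field_simps)
    finally show ?thesis .
  qed (simp add: E_def)
  define \<Phi> where "\<Phi> = (\<lambda>z. \<Sum>i\<in>I. \<Sum>j\<in>J. C i j * E (a i) z * E (b j) z)"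
  define K where "K = (\<lambda>c::complex. max 1 (norm c) powr p)"
  have E_bd: "norm (E c z) \<le> K c" if "0 \<le> Re z" "Re z \<le> 1" for c z
  proof -
    have "norm c powr (p * (1 - Re z / 2)) \<le> max 1 (norm c) powr (p * (1 - Re z / 2))"
      using p that by (intro powr_mono2) auto
    also have "\<dots> \<le> max 1 (norm c) powr p"
      using p that by (intro powr_mono) (auto simp: field_simps)
    finally show ?thesis by (simp add: E_norm K_def)
  qed
  have "norm (\<Phi> (of_real \<theta>)) \<le> 1"
  proof (rule three_lines[where f = \<Phi> and D = "\<Sum>i\<in>I. \<Sum>j\<in>J. norm (C i j) * K (a i) * K (b j)"])
    have E_hol: "(\<lambda>z. E c z) holomorphic_on UNIV" for c
      unfolding E_def by (cases "c = 0") (auto intro!: holomorphic_intros)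
    show "\<Phi> holomorphic_on UNIV"
      unfolding \<Phi>_def by (intro holomorphic_intros E_hol)
    show "norm (\<Phi> z) \<le> (\<Sum>i\<in>I. \<Sum>j\<in>J. norm (C i j) * K (a i) * K (b j))"
      if "0 \<le> Re z" "Re z \<le> 1" for z
      unfolding \<Phi>_def
      by (intro sum_norm_le, unfold norm_mult, intro mult_mono E_bd that) (auto simp: K_def)
    show "norm (\<Phi> z) \<le> 1" if "Re z = 0" for z
      unfolding \<Phi>_def by (rule H1) (use a b that in \<open>simp_all add: E_norm0\<close>)
    show "norm (\<Phi> z) \<le> 1" if "Re z = 1" for z
      unfolding \<Phi>_def by (rule H2) (use a b that in \<open>simp_all add: E_norm1\<close>)
  qed (use \<theta> in auto)
  thus ?thesis unfolding \<Phi>_def E_\<theta> .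
qed

section \<open>The Hausdorff--Young inequality for abstract operators\<close>

text \<open>
  Norm estimates for finite exponents are proved on the right-hand side, which has no roots of
  extended reals.
\<close>

lemma Lp_norm_le_iff:
  assumes "0 < r" "0 \<le> c"
  shows "Lp_norm M (ennreal r) f \<le> ennreal c \<longleftrightarrow>
    (\<integral>\<^sup>+ x. ennreal (norm (f x) powr r) \<partial>M) \<le> ennreal (c powr r)"
proof -
  have eq: "Lp_norm M (ennreal r) f =
      ennreal_power (\<integral>\<^sup>+ x. ennreal (norm (f x) powr r) \<partial>M) (1 / r)"
    using assms by (simp add: Lp_norm_def)
  show ?thesis
  proof (cases "\<integral>\<^sup>+ x. ennreal (norm (f x) powr r) \<partial>M")
    case top
    thus ?thesis using assms unfolding eq by (simp add: ennreal_power_def top_unique)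
  next
    case (real x)
    have "x powr (1 / r) \<le> c \<longleftrightarrow> x \<le> c powr r"
    proof
      assume "x powr (1 / r) \<le> c"
      hence "(x powr (1 / r)) powr r \<le> c powr r" using assms by (intro powr_mono2) auto
      thus "x \<le> c powr r" using real assms by (simp add: powr_powr)
    next
      assume "x \<le> c powr r"
      hence "x powr (1 / r) \<le> (c powr r) powr (1 / r)" using real assms by (intro powr_mono2) auto
      thus "x powr (1 / r) \<le> c" using assms by (simp add: powr_powr)
    qed
    thus ?thesis using assms real unfolding eq by (simp add: ennreal_power_def)
  qed
qed

lemma conj_exponent_gt1:
  assumes "1 < p"
  shows "conj_exponent p = ennreal (p / (p - 1))"
  using assms by (simp add: conj_exponent_def)

text \<open>
  Fatou's lemma for convergent sequences.
\<close>

lemma nn_integral_le_of_tendsto: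
  fixes u :: "nat \<Rightarrow> 'a \<Rightarrow> ennreal"
  assumes [measurable]: "\<And>n. u n \<in> borel_measurable M"
    and lim: "AE x in M. (\<lambda>n. u n x) \<longlonglongrightarrow> v x"
    and bd: "eventually (\<lambda>n. (\<integral>\<^sup>+ x. u n x \<partial>M) \<le> c) sequentially"
  shows "(\<integral>\<^sup>+ x. v x \<partial>M) \<le> c"
proof -
  have "(\<integral>\<^sup>+ x. v x \<partial>M) = (\<integral>\<^sup>+ x. liminf (\<lambda>n. u n x) \<partial>M)"
    using lim by (intro nn_integral_cong_AE) (auto elim!: eventually_mono dest!: lim_imp_Liminf[rotated])
  also have "\<dots> \<le> liminf (\<lambda>n. \<integral>\<^sup>+ x. u n x \<partial>M)" by (rule nn_integral_liminf) simp
  also have "\<dots> \<le> limsup (\<lambda>n. \<integral>\<^sup>+ x. u n x \<partial>M)" by (rule Liminf_le_Limsup) simp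
  also have "\<dots> \<le> c" using bd by (rule Limsup_bounded)
  finally show ?thesis .
qed

lemma integrable_complex_indicator:
  assumes "A \<in> sets M" "emeasure M A < \<infinity>"
  shows "integrable M (indicator A :: 'a \<Rightarrow> complex)"
proof -
  have "(indicator A :: 'a \<Rightarrow> complex) = (\<lambda>x. of_real (indicator A x))"
    by (auto simp: indicator_def)
  thus ?thesis using integrable_of_real[OF integrable_real_indicator[OF assms]] by simp
qed

text \<open>
  For a fixed disjoint family \<open>A\<close>, the step functions are parametrized by their coefficients \<open>a\<close>, so that
  \<open>bilinear_interpolation\<close> can vary \<open>a\<close> while the sets stay the same.
\<close>

definition step_function :: "('i \<Rightarrow> 'a set) \<Rightarrow> 'i set \<Rightarrow> ('i \<Rightarrow> complex) \<Rightarrow> 'a \<Rightarrow> complex" where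
  "step_function A I a = (\<lambda>x. \<Sum>i\<in>I. a i * indicator (A i) x)"

lemma step_function_comp:
  fixes h :: "complex \<Rightarrow> 'b::real_vector"
  assumes "finite I" "disjoint_family_on A I" "h 0 = 0"
  shows "h (step_function A I a x) = (\<Sum>i\<in>I. indicator (A i) x *\<^sub>R h (a i))"
proof (cases "\<exists>i\<in>I. x \<in> A i")
  case True
  then obtain i where i: "i \<in> I" "x \<in> A i" by blast
  have other: "x \<notin> A j" if "j \<in> I" "j \<noteq> i" for j
    using assms(2) i that unfolding disjoint_family_on_def by blast
  have "step_function A I a x = (\<Sum>j\<in>I. if j = i then a i else 0)"
    unfolding step_function_def using i other by (intro sum.cong) auto
  moreover have "(\<Sum>j\<in>I. indicator (A j) x *\<^sub>R h (a j)) = (\<Sum>j\<in>I. if j = i then h (a i) else 0)"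
    using i other by (intro sum.cong) auto
  ultimately show ?thesis using i assms(1) by simp
next
  case False
  thus ?thesis using assms(3) unfolding step_function_def by (simp add: indicator_def)
qed

lemma has_integral_step_function:
  fixes h :: "complex \<Rightarrow> 'b::{banach, second_countable_topology}"
  assumes "finite I" "disjoint_family_on A I" "h 0 = 0"
    and "\<And>i. i \<in> I \<Longrightarrow> A i \<in> sets M" "\<And>i. i \<in> I \<Longrightarrow> emeasure M (A i) < \<infinity>"
  shows "has_bochner_integral M (\<lambda>x. h (step_function A I a x)) (\<Sum>i\<in>I. measure M (A i) *\<^sub>R h (a i))"
  unfolding step_function_comp[where h = h, OF assms(1-3)]
  by (intro has_bochner_integral_sum has_bochner_integral_scaleR_left) 
     (use assms in \<open>auto intro!: has_bochner_integral_real_indicator\<close>)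

lemma simple_function_eq_step_function:
  fixes f :: "'a \<Rightarrow> complex"
  assumes s: "simple_function M f" and int: "integrable M f"
  obtains I A where "finite I" "disjoint_family_on A I"
    "\<And>i. i \<in> I \<Longrightarrow> A i \<in> sets M" "\<And>i. i \<in> I \<Longrightarrow> emeasure M (A i) < \<infinity>"
    "\<And>x. x \<in> space M \<Longrightarrow> f x = step_function A I (\<lambda>y. y) x"
proof
  let ?I = "f ` space M - {0}" and ?A = "\<lambda>y. f -` {y} \<inter> space M"
  show fin: "finite ?I" using s by (auto simp: simple_function_def)
  show disj: "disjoint_family_on ?A ?I" by (auto simp: disjoint_family_on_def)
  show meas: "?A i \<in> sets M" for i using s by (rule simple_functionD)
  show "emeasure M (?A i) < \<infinity>" if "i \<in> ?I" for i
  proof -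
    have "norm i * indicator (?A i) x \<le> norm (f x)" for x by (auto simp: indicator_def)
    hence "(\<integral>\<^sup>+ x. ennreal (norm i) * indicator (?A i) x \<partial>M) \<le> (\<integral>\<^sup>+ x. ennreal (norm (f x)) \<partial>M)"
      by (intro nn_integral_mono) (auto simp: indicator_def)
    also have "\<dots> < \<infinity>" using int by (simp add: integrable_iff_bounded)
    finally have "ennreal (norm i) * emeasure M (?A i) < \<infinity>"
      using meas by (simp add: nn_integral_cmult_indicator)
    thus ?thesis using that by (auto simp: ennreal_mult_less_top)
  qed
  show "f x = step_function ?A ?I (\<lambda>y. y) x" if "x \<in> space M" for x
  proof -
    have "step_function ?A ?I (\<lambda>y. y) x = (\<Sum>y\<in>?I. if y = f x then f x else 0)"
      unfolding step_function_def using that by (intro sum.cong) (auto simp: indicator_def)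
    also have "\<dots> = f x" using fin that by (cases "f x = 0") auto
    finally show ?thesis by simp
  qed
qed

text \<open>
  All powers of finitely many nonzero values are comparable; zero values contribute nothing because
  \<open>0 powr s = 0\<close>.
\<close>

lemma integrable_simple_function_powr:
  fixes g :: "'a \<Rightarrow> complex"
  assumes s: "simple_function M g" and int: "integrable M (\<lambda>x. norm (g x) powr r)"
  shows "integrable M (\<lambda>x. norm (g x) powr s)"
proof -
  have [measurable]: "g \<in> borel_measurable M" using s by (rule borel_measurable_simple_function)
  have fin: "finite (g ` space M)" using s by (simp add: simple_function_def)
  define c where "c = (\<Sum>y\<in>g ` space M. norm y powr (s - r))"
  show ?thesis
  proof (rule Bochner_Integration.integrable_bound)
    show "integrable M (\<lambda>x. c * norm (g x) powr r)" using int by simp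
    show "AE x in M. norm (norm (g x) powr s) \<le> norm (c * norm (g x) powr r)"
    proof (rule AE_I2)
      fix x assume "x \<in> space M"
      hence "norm (g x) powr (s - r) \<le> c"
        unfolding c_def using fin by (intro member_le_sum) auto
      hence "norm (g x) powr (s - r) * norm (g x) powr r \<le> c * norm (g x) powr r"
        by (intro mult_right_mono) auto
      moreover have "norm (g x) powr (s - r) * norm (g x) powr r = norm (g x) powr s"
        by (simp flip: powr_add)
      moreover have "0 \<le> c" unfolding c_def by (intro sum_nonneg) auto
      ultimately show "norm (norm (g x) powr s) \<le> norm (c * norm (g x) powr r)" by simp
    qed
  qed simp
qed

text \<open>
  The extremal test function is \<open>k = cnj h |h|\<^sup>q\<^sup>-\<^sup>2\<close>, for which \<open>h k = |h|\<^sup>q = |k|\<^sup>p\<close>. With \<open>S\<close> the integral of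
  \<open>|h|\<^sup>q\<close>, testing with simple approximations of \<open>k\<close> gives \<open>S \<le> c\<close> for every \<open>c\<close> with
  \<open>S < c\<^sup>p\<close>. For \<open>S > 1\<close> some such \<open>c\<close> is smaller than \<open>S\<close>.
\<close>

lemma integral_powr_le_1_by_duality:
  fixes h :: "'a \<Rightarrow> complex"
  assumes [measurable]: "h \<in> borel_measurable M"
    and int: "integrable M (\<lambda>x. norm (h x) powr q)"
    and p: "1 < p" and q: "q = p / (p - 1)"
    and test: "\<And>g. simple_function M g \<Longrightarrow> integrable M g \<Longrightarrow> 
       (\<integral>x. norm (g x) powr p \<partial>M) \<le> 1 \<Longrightarrow> norm (\<integral>x. h x * g x \<partial>M) \<le> 1"
  shows "(\<integral>x. norm (h x) powr q \<partial>M) \<le> 1"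
proof (rule ccontr)
  define S where "S = (\<integral>x. norm (h x) powr q \<partial>M)"
  assume "\<not> ?thesis"
  hence S: "1 < S" by (simp add: S_def)
  have q1: "1 < q" "(q - 1) * p = q" using p by (auto simp: q field_simps)
  define k where "k = (\<lambda>x. cnj (h x) * of_real (norm (h x) powr (q - 2)))"
  have [measurable]: "cnj \<in> borel_measurable borel"
    by (intro borel_measurable_continuous_onI continuous_intros)
  have [measurable]: "k \<in> borel_measurable M" unfolding k_def by measurable
  have k_norm: "norm (k x) = norm (h x) powr (q - 1)" for x
  proof (cases "h x = 0")
    case False
    have "norm (k x) = norm (h x) powr 1 * norm (h x) powr (q - 2)"
      using False by (simp add: k_def norm_mult)
    also have "\<dots> = norm (h x) powr (q - 1)" by (subst powr_add[symmetric]) simp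
    finally show ?thesis .
  qed (simp add: k_def)
  have kp: "norm (k x) powr p = norm (h x) powr q" for x
    by (simp add: k_norm powr_powr q1)
  have hk: "norm (h x) * norm (k x) = norm (h x) powr q" for x
  proof (cases "h x = 0")
    case False
    have "norm (h x) * norm (k x) = norm (h x) powr 1 * norm (h x) powr (q - 1)"
      using False by (simp add: k_norm)
    also have "\<dots> = norm (h x) powr q" by (subst powr_add[symmetric]) simp
    finally show ?thesis .
  qed simp
  have hk': "h x * k x = of_real (norm (h x) powr q)" for x
  proof -
    have "h x * k x = (h x * cnj (h x)) * of_real (norm (h x) powr (q - 2))"
      by (simp add: k_def)
    also have "h x * cnj (h x) = of_real ((norm (h x))\<^sup>2)" by (simp only: complex_norm_square)
    also have "of_real ((norm (h x))\<^sup>2) * of_real (norm (h x) powr (q - 2)) =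
        (of_real (norm (h x) * (norm (h x) * norm (h x) powr (q - 2))) :: complex)"
      by (simp add: power2_eq_square)
    also have "norm (h x) * norm (h x) powr (q - 2) = norm (k x)" by (simp add: k_def norm_mult)
    finally show ?thesis by (simp only: hk)
  qed
  obtain G where G: "\<And>i. simple_function M (G i)" "\<And>x. x \<in> space M \<Longrightarrow> (\<lambda>i. G i x) \<longlonglongrightarrow> k x"
      "\<And>i x. x \<in> space M \<Longrightarrow> norm (G i x) \<le> 2 * norm (k x)"
    using borel_measurable_implies_sequence_metric[of k M 0] by simp blast
  have [measurable]: "G i \<in> borel_measurable M" for i
    using G(1) by (rule borel_measurable_simple_function)
  have G_le: "norm (G i x) powr p \<le> 2 powr p * norm (h x) powr q" if "x \<in> space M" for i x
  proof -
    have "norm (G i x) powr p \<le> (2 * norm (k x)) powr p"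
      using G(3)[OF that] p by (intro powr_mono2) auto
    thus ?thesis by (simp add: powr_mult kp)
  qed
  have Gp_int: "integrable M (\<lambda>x. norm (G i x) powr p)" for i
    by (rule Bochner_Integration.integrable_bound[where f = "\<lambda>x. 2 powr p * norm (h x) powr q"])
       (use int G_le in \<open>auto intro!: AE_I2\<close>)
  have G_int: "integrable M (G i)" for i
    using integrable_simple_function_powr[OF G(1) Gp_int, of i 1] by (simp add: integrable_norm_iff)
  have lim_p: "(\<lambda>i. \<integral>x. norm (G i x) powr p \<partial>M) \<longlonglongrightarrow> (\<integral>x. norm (k x) powr p \<partial>M)"
  proof (rule integral_dominated_convergence[where w = "\<lambda>x. 2 powr p * norm (h x) powr q"])
    show "AE x in M. (\<lambda>i. norm (G i x) powr p) \<longlonglongrightarrow> norm (k x) powr p"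
      using p G(2) by (intro AE_I2 tendsto_powr' tendsto_norm tendsto_const) auto
  qed (use int G_le in \<open>auto intro!: AE_I2\<close>)
  have lim_h: "(\<lambda>i. \<integral>x. h x * G i x \<partial>M) \<longlonglongrightarrow> (\<integral>x. h x * k x \<partial>M)"
  proof (rule integral_dominated_convergence[where w = "\<lambda>x. 2 * norm (h x) powr q"])
    show "AE x in M. (\<lambda>i. h x * G i x) \<longlonglongrightarrow> h x * k x"
      using G(2) by (intro AE_I2 tendsto_intros) auto
    show "AE x in M. norm (h x * G i x) \<le> 2 * norm (h x) powr q" for i
    proof (rule AE_I2)
      fix x assume "x \<in> space M"
      hence "norm (h x) * norm (G i x) \<le> norm (h x) * (2 * norm (k x))"
        by (intro mult_left_mono G) auto
      thus "norm (h x * G i x) \<le> 2 * norm (h x) powr q"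
        using hk[of x] by (simp add: norm_mult algebra_simps)
    qed
  qed (use int in auto)
  \<comment> \<open>The exponent lies strictly between \<open>1 / p\<close> and \<open>1\<close>.\<close>
  define c where "c = S powr ((1 + 1 / p) / 2)"
  have c: "0 < c" using S by (simp add: c_def)
  have "S powr ((1 + 1 / p) / 2) < S powr 1" using S p by (intro powr_less_mono) (auto simp: field_simps)
  hence cS: "c < S" using S by (simp add: c_def)
  have "S powr 1 < S powr ((1 + 1 / p) / 2 * p)" using S p by (intro powr_less_mono) (auto simp: field_simps)
  hence Sc: "S < c powr p" using S by (simp add: c_def powr_powr)
  have "(\<lambda>i. \<integral>x. norm (G i x) powr p \<partial>M) \<longlonglongrightarrow> S" using lim_p by (simp add: kp S_def)
  hence "eventually (\<lambda>i. (\<integral>x. norm (G i x) powr p \<partial>M) < c powr p) sequentially"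
    using Sc by (rule order_tendstoD)
  hence ev: "eventually (\<lambda>i. norm (\<integral>x. h x * G i x \<partial>M) \<le> c) sequentially"
  proof (rule eventually_mono)
    fix i assume i: "(\<integral>x. norm (G i x) powr p \<partial>M) < c powr p"
    have "norm (\<integral>x. h x * (G i x / of_real c) \<partial>M) \<le> 1"
    proof (rule test)
      show "simple_function M (\<lambda>x. G i x / of_real c)"
        using simple_function_compose1[OF G(1)[of i], of "\<lambda>y. y / of_real c"] .
      show "integrable M (\<lambda>x. G i x / of_real c)" using G_int by simp
      have "(\<integral>x. norm (G i x / of_real c) powr p \<partial>M) = (\<integral>x. norm (G i x) powr p / c powr p \<partial>M)"
        using c by (simp add: norm_divide powr_divide)
      also have "\<dots> = (\<integral>x. norm (G i x) powr p \<partial>M) / c powr p" by simp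
      also have "\<dots> \<le> 1" using i c by (simp add: field_simps)
      finally show "(\<integral>x. norm (G i x / of_real c) powr p \<partial>M) \<le> 1" .
    qed
    moreover have "(\<integral>x. h x * (G i x / of_real c) \<partial>M) = (\<integral>x. h x * G i x \<partial>M) / of_real c"
      by (simp flip: integral_divide_zero)
    ultimately show "norm (\<integral>x. h x * G i x \<partial>M) \<le> c" using c by (simp add: norm_divide field_simps)
  qed
  have "norm (\<integral>x. h x * k x \<partial>M) \<le> c"
    using tendsto_norm[OF lim_h] ev by (intro tendsto_upperbound[of _ _ sequentially]) auto
  moreover have "(\<integral>x. h x * k x \<partial>M) = of_real S" unfolding hk' S_def by simp
  ultimately show False using cS S by simp
qed

text \<open>
  Operators on \<open>L\<^sup>1\<close> that satisfy the two endpoint estimates of the Hausdorff--Young inequality.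
\<close>

locale L1_L2_contraction =
  fixes M :: "'a measure" and T :: "('a \<Rightarrow> complex) \<Rightarrow> 'a \<Rightarrow> complex"
  assumes T_measurable [measurable]: "integrable M f \<Longrightarrow> T f \<in> borel_measurable M"
    and T_add: "integrable M f \<Longrightarrow> integrable M g \<Longrightarrow> T (\<lambda>x. f x + g x) l = T f l + T g l"
    and T_scale: "integrable M f \<Longrightarrow> T (\<lambda>x. c * f x) l = c * T f l"
    and T_L1: "integrable M f \<Longrightarrow> norm (T f l) \<le> (\<integral>x. norm (f x) \<partial>M)"
    and T_L2: "integrable M f \<Longrightarrow> integrable M (\<lambda>x. (norm (f x))\<^sup>2) \<Longrightarrow>
        (\<integral>\<^sup>+ l. ennreal ((norm (T f l))\<^sup>2) \<partial>M) \<le> ennreal (\<integral>x. (norm (f x))\<^sup>2 \<partial>M)"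
begin

lemma T_diff: "integrable M f \<Longrightarrow> integrable M g \<Longrightarrow> T (\<lambda>x. f x - g x) l = T f l - T g l"
  using T_add[of f "\<lambda>x. - 1 * g x" l] T_scale[of g "-1" l] by simp

lemma T_zero: "T (\<lambda>x. 0) l = 0"
  using T_L1[of "\<lambda>x. 0" l] by simp

lemma T_sum:
  assumes "finite I" "\<And>i. i \<in> I \<Longrightarrow> integrable M (f i)"
  shows "T (\<lambda>x. \<Sum>i\<in>I. c i * f i x) l = (\<Sum>i\<in>I. c i * T (f i) l)"
  using assms
proof (induction I rule: finite_induct)
  case (insert i I)
  have "T (\<lambda>x. c i * f i x + (\<Sum>i\<in>I. c i * f i x)) l = T (\<lambda>x. c i * f i x) l + T (\<lambda>x. \<Sum>i\<in>I. c i * f i x) l"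
    using insert.prems by (intro T_add) auto
  thus ?case using insert by (simp add: T_scale)
qed (simp add: T_zero)

lemma T_cong:
  assumes "integrable M f" "\<And>x. x \<in> space M \<Longrightarrow> f x = g x"
  shows "T f l = T g l"
proof -
  have g: "integrable M g" using assms by (subst Bochner_Integration.integrable_cong[OF refl, of M g f]) auto
  have "norm (T (\<lambda>x. f x - g x) l) \<le> (\<integral>x. norm (f x - g x) \<partial>M)"
    using assms g by (intro T_L1) auto
  also have "\<dots> = 0" using assms by (subst Bochner_Integration.integral_cong[OF refl, of M _ "\<lambda>_. 0"]) auto
  finally show ?thesis using assms g by (simp add: T_diff)
qed

lemma T_integrable_mult:
  assumes "integrable M f" "integrable M g"
  shows "integrable M (\<lambda>l. T f l * g l)"
proof -
  have [measurable]: "T f \<in> borel_measurable M" "g \<in> borel_measurable M" using assms by auto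
  show ?thesis
  proof (rule Bochner_Integration.integrable_bound)
    show "integrable M (\<lambda>l. (\<integral>x. norm (f x) \<partial>M) * norm (g l))" using assms by simp
    show "AE l in M. norm (T f l * g l) \<le> norm ((\<integral>x. norm (f x) \<partial>M) * norm (g l))"
      using T_L1[OF assms(1)] by (intro AE_I2) (auto simp: norm_mult abs_mult intro!: mult_right_mono)
  qed simp
qed

lemma T_integrable_square:
  assumes "integrable M f" "integrable M (\<lambda>x. (norm (f x))\<^sup>2)"
  shows "integrable M (\<lambda>l. (norm (T f l))\<^sup>2)"
    "(\<integral>l. (norm (T f l))\<^sup>2 \<partial>M) \<le> (\<integral>x. (norm (f x))\<^sup>2 \<partial>M)"
proof -
  have [measurable]: "T f \<in> borel_measurable M" using assms by auto
  have le: "(\<integral>\<^sup>+ l. ennreal ((norm (T f l))\<^sup>2) \<partial>M) \<le> ennreal (\<integral>x. (norm (f x))\<^sup>2 \<partial>M)"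
    using assms by (rule T_L2)
  show int: "integrable M (\<lambda>l. (norm (T f l))\<^sup>2)"
    using le by (intro integrableI_bounded) (auto simp: less_top[symmetric] top_unique)
  have "ennreal (\<integral>l. (norm (T f l))\<^sup>2 \<partial>M) \<le> ennreal (\<integral>x. (norm (f x))\<^sup>2 \<partial>M)"
    using le by (simp add: nn_integral_eq_integral[OF int])
  thus "(\<integral>l. (norm (T f l))\<^sup>2 \<partial>M) \<le> (\<integral>x. (norm (f x))\<^sup>2 \<partial>M)" by (simp add: ennreal_le_iff)
qed

text \<open>
  On step functions the pairing is a finite bilinear form. Its bound on \<open>l\<^sup>1\<close> is the estimate
  \<open>L\<^sup>1 \<rightarrow> L\<^sup>\<infinity>\<close>, and its bound on \<open>l\<^sup>2\<close> is the estimate on \<open>L\<^sup>2\<close> combined with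
  \<open>2 a b \<le> a\<^sup>2 + b\<^sup>2\<close>.
\<close>

lemma T_pairing_simple_le_1:
  assumes f: "simple_function M f" "integrable M f" "(\<integral>x. norm (f x) powr p \<partial>M) \<le> 1"
    and g: "simple_function M g" "integrable M g" "(\<integral>x. norm (g x) powr p \<partial>M) \<le> 1"
    and p: "1 \<le> p" "p \<le> 2"
  shows "norm (\<integral>l. T f l * g l \<partial>M) \<le> 1"
proof -
  obtain I A where I: "finite I" "disjoint_family_on A I" 
    "\<And>i. i \<in> I \<Longrightarrow> A i \<in> sets M" "\<And>i. i \<in> I \<Longrightarrow> emeasure M (A i) < \<infinity>"
    and fI: "\<And>x. x \<in> space M \<Longrightarrow> f x = step_function A I (\<lambda>y. y) x"
    using simple_function_eq_step_function[OF f(1,2)] by metis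
  obtain J B where J: "finite J" "disjoint_family_on B J" 
    "\<And>i. i \<in> J \<Longrightarrow> B i \<in> sets M" "\<And>i. i \<in> J \<Longrightarrow> emeasure M (B i) < \<infinity>"
    and gJ: "\<And>x. x \<in> space M \<Longrightarrow> g x = step_function B J (\<lambda>y. y) x"
    using simple_function_eq_step_function[OF g(1,2)] by metis
  let ?F = "step_function A I" and ?G = "step_function B J"
  let ?m = "\<lambda>i. measure M (A i)" and ?n = "\<lambda>j. measure M (B j)"
  let ?C = "\<lambda>i j. \<integral>l. T (indicator (A i)) l * indicator (B j) l \<partial>M"
  have indA: "integrable M (indicator (A i) :: 'a \<Rightarrow> complex)" if "i \<in> I" for i
    using I that by (intro integrable_complex_indicator) auto
  have indB: "integrable M (indicator (B i) :: 'a \<Rightarrow> complex)" if "i \<in> J" for i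
    using J that by (intro integrable_complex_indicator) auto
  note hbiF = has_integral_step_function[OF I(1,2) _ I(3,4)]
  note hbiG = has_integral_step_function[OF J(1,2) _ J(3,4)]
  have F_int: "integrable M (?F a)" for a
    using hbiF[of "\<lambda>z. z" a] by (simp add: has_bochner_integral_iff)
  have G_int: "integrable M (?G b)" for b
    using hbiG[of "\<lambda>z. z" b] by (simp add: has_bochner_integral_iff)
  have pairing: "(\<integral>l. T (?F a) l * ?G b l \<partial>M) = (\<Sum>i\<in>I. \<Sum>j\<in>J. ?C i j * a i * b j)" for a b
  proof -
    have "T (?F a) l * ?G b l = (\<Sum>i\<in>I. \<Sum>j\<in>J. a i * b j * (T (indicator (A i)) l * indicator (B j) l))" for l
    proof -
      have "T (?F a) l = (\<Sum>i\<in>I. a i * T (indicator (A i)) l)"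
        unfolding step_function_def by (rule T_sum[OF I(1) indA])
      thus ?thesis unfolding step_function_def[of B] by (simp only: sum_product) (simp add: mult_ac)
    qed
    hence "(\<integral>l. T (?F a) l * ?G b l \<partial>M) =
        (\<Sum>i\<in>I. \<Sum>j\<in>J. \<integral>l. a i * b j * (T (indicator (A i)) l * indicator (B j) l) \<partial>M)"
      using T_integrable_mult[OF indA indB] by (simp add: Bochner_Integration.integral_sum)
    thus ?thesis by (simp add: mult_ac)
  qed
  have "norm (\<Sum>i\<in>I. \<Sum>j\<in>J. ?C i j * i * j) \<le> 1"
  proof (rule bilinear_interpolation[OF _ _ p, where m = ?m and n = ?n])
    fix a b :: "complex \<Rightarrow> complex"
    assume a: "(\<Sum>i\<in>I. ?m i * norm (a i)) \<le> 1" and b: "(\<Sum>j\<in>J. ?n j * norm (b j)) \<le> 1"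
    have "(\<integral>x. norm (?F a x) \<partial>M) \<le> 1" using hbiF[of norm a] a by (simp add: has_bochner_integral_iff)
    hence TF: "norm (T (?F a) l) \<le> 1" for l using T_L1[OF F_int[of a], of l] by simp
    have "norm (\<integral>l. T (?F a) l * ?G b l \<partial>M) \<le> (\<integral>l. norm (?G b l) \<partial>M)"
    proof (rule order_trans[OF integral_norm_bound integral_mono])
      show "norm (T (?F a) l * ?G b l) \<le> norm (?G b l)" for l
        using TF[of l] by (simp add: norm_mult mult_left_le_one_le)
    qed (use T_integrable_mult[OF F_int G_int] G_int in auto)
    also have "\<dots> \<le> 1" using hbiG[of norm b] b by (simp add: has_bochner_integral_iff)
    finally show "norm (\<Sum>i\<in>I. \<Sum>j\<in>J. ?C i j * a i * b j) \<le> 1" unfolding pairing .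
  next
    fix a b :: "complex \<Rightarrow> complex"
    assume a: "(\<Sum>i\<in>I. ?m i * (norm (a i))\<^sup>2) \<le> 1" and b: "(\<Sum>j\<in>J. ?n j * (norm (b j))\<^sup>2) \<le> 1"
    have F2: "integrable M (\<lambda>x. (norm (?F a x))\<^sup>2)" "(\<integral>x. (norm (?F a x))\<^sup>2 \<partial>M) \<le> 1"
      using hbiF[of "\<lambda>z. (norm z)\<^sup>2" a] a by (simp_all add: has_bochner_integral_iff)
    have G2: "integrable M (\<lambda>x. (norm (?G b x))\<^sup>2)" "(\<integral>x. (norm (?G b x))\<^sup>2 \<partial>M) \<le> 1"
      using hbiG[of "\<lambda>z. (norm z)\<^sup>2" b] b by (simp_all add: has_bochner_integral_iff)
    note TF2 = T_integrable_square[OF F_int F2(1)]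
    have "norm (\<integral>l. T (?F a) l * ?G b l \<partial>M) \<le>
        (\<integral>l. ((norm (T (?F a) l))\<^sup>2 + (norm (?G b l))\<^sup>2) / 2 \<partial>M)"
    proof (rule order_trans[OF integral_norm_bound integral_mono])
      show "integrable M (\<lambda>l. norm (T (?F a) l * ?G b l))"
        by (intro integrable_norm T_integrable_mult[OF F_int G_int])
      show "integrable M (\<lambda>l. ((norm (T (?F a) l))\<^sup>2 + (norm (?G b l))\<^sup>2) / 2)"
        using TF2 G2 by simp
      show "norm (T (?F a) l * ?G b l) \<le> ((norm (T (?F a) l))\<^sup>2 + (norm (?G b l))\<^sup>2) / 2" for l
        using sum_squares_bound[of "norm (T (?F a) l)" "norm (?G b l)"] by (simp add: norm_mult)
    qed
    also have "\<dots> = ((\<integral>l. (norm (T (?F a) l))\<^sup>2 \<partial>M) + (\<integral>l. (norm (?G b l))\<^sup>2 \<partial>M)) / 2"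
      using TF2 G2 by simp
    also have "\<dots> \<le> 1" using TF2 F2 G2 by simp
    finally show "norm (\<Sum>i\<in>I. \<Sum>j\<in>J. ?C i j * a i * b j) \<le> 1" unfolding pairing .
  next
    have "(\<integral>x. norm (f x) powr p \<partial>M) = (\<integral>x. norm (?F (\<lambda>y. y) x) powr p \<partial>M)"
      using fI by (intro Bochner_Integration.integral_cong) auto
    thus "(\<Sum>i\<in>I. ?m i * norm i powr p) \<le> 1"
      using hbiF[of "\<lambda>z. norm z powr p" "\<lambda>y. y"] f(3) by (simp add: has_bochner_integral_iff)
  next
    have "(\<integral>x. norm (g x) powr p \<partial>M) = (\<integral>x. norm (?G (\<lambda>y. y) x) powr p \<partial>M)"
      using gJ by (intro Bochner_Integration.integral_cong) auto
    thus "(\<Sum>j\<in>J. ?n j * norm j powr p) \<le> 1"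
      using hbiG[of "\<lambda>z. norm z powr p" "\<lambda>y. y"] g(3) by (simp add: has_bochner_integral_iff)
  qed
  hence "norm (\<integral>l. T (?F (\<lambda>y. y)) l * ?G (\<lambda>y. y) l \<partial>M) \<le> 1" unfolding pairing .
  moreover have "(\<integral>l. T f l * g l \<partial>M) = (\<integral>l. T (?F (\<lambda>y. y)) l * ?G (\<lambda>y. y) l \<partial>M)"
    using gJ T_cong[OF f(2) fI] by (intro Bochner_Integration.integral_cong) auto
  ultimately show ?thesis by simp
qed

text \<open>
  The function \<open>T f\<close> is bounded and square integrable, so \<open>|T f|\<^sup>q\<close> is integrable because \<open>q \<ge> 2\<close>, and
  duality applies.
\<close>

lemma T_simple_Lq_le_1:
  assumes f: "simple_function M f" "integrable M f" "(\<integral>x. norm (f x) powr p \<partial>M) \<le> 1"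
    and p: "1 < p" "p \<le> 2" and q: "q = p / (p - 1)"
  shows "(\<integral>\<^sup>+ l. ennreal (norm (T f l) powr q) \<partial>M) \<le> 1"
proof -
  have [measurable]: "T f \<in> borel_measurable M" using f by auto
  have q2: "2 \<le> q" using p by (auto simp: q field_simps)
  have "integrable M (\<lambda>x. norm (f x) powr 2)"
    by (rule integrable_simple_function_powr[OF f(1), where r = 1]) (use f(2) in simp)
  hence f2: "integrable M (\<lambda>x. (norm (f x))\<^sup>2)" by simp
  have int: "integrable M (\<lambda>l. norm (T f l) powr q)"
  proof (rule Bochner_Integration.integrable_bound)
    show "integrable M (\<lambda>l. (\<integral>x. norm (f x) \<partial>M) powr (q - 2) * (norm (T f l))\<^sup>2)"
      using T_integrable_square[OF f(2) f2] by simp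
    show "AE l in M. norm (norm (T f l) powr q) \<le> norm ((\<integral>x. norm (f x) \<partial>M) powr (q - 2) * (norm (T f l))\<^sup>2)"
    proof (rule AE_I2)
      fix l
      have "norm (T f l) powr q = norm (T f l) powr (q - 2) * norm (T f l) powr 2"
        by (subst powr_add[symmetric]) simp
      also have "\<dots> = norm (T f l) powr (q - 2) * (norm (T f l))\<^sup>2" by simp
      also have "\<dots> \<le> (\<integral>x. norm (f x) \<partial>M) powr (q - 2) * (norm (T f l))\<^sup>2"
        using q2 T_L1[OF f(2)] by (intro mult_right_mono powr_mono2) auto
      finally show "norm (norm (T f l) powr q) \<le> norm ((\<integral>x. norm (f x) \<partial>M) powr (q - 2) * (norm (T f l))\<^sup>2)"
        by simp
    qed
  qed simp
  have "(\<integral>l. norm (T f l) powr q \<partial>M) \<le> 1"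
    using p by (intro integral_powr_le_1_by_duality[OF _ int _ q]) (auto intro!: T_pairing_simple_le_1 f)
  thus ?thesis by (simp add: nn_integral_eq_integral[OF int])
qed

text \<open>
  Simple functions converging to \<open>f\<close> in \<open>L\<^sup>1\<close> have transforms converging pointwise, and Fatou's lemma
  applies. The strict inequality for \<open>f\<close> keeps the approximations eventually in the unit ball.
\<close>

lemma T_Lq_le_1:
  assumes f: "integrable M f" "(\<integral>\<^sup>+ x. ennreal (norm (f x) powr p) \<partial>M) < 1"
    and p: "1 < p" "p \<le> 2" and q: "q = p / (p - 1)"
  shows "(\<integral>\<^sup>+ l. ennreal (norm (T f l) powr q) \<partial>M) \<le> 1"
proof -
  have [measurable]: "f \<in> borel_measurable M" using f by auto
  have q0: "0 < q" using p by (auto simp: q field_simps)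
  have intp: "integrable M (\<lambda>x. norm (f x) powr p)"
    using f(2) by (intro integrableI_bounded) (auto simp: less_top[symmetric] top_unique)
  have fp: "(\<integral>x. norm (f x) powr p \<partial>M) < 1"
    using f(2) by (simp add: nn_integral_eq_integral[OF intp] ennreal_less_iff flip: ennreal_1)
  obtain G where G: "\<And>i. simple_function M (G i)" "\<And>x. x \<in> space M \<Longrightarrow> (\<lambda>i. G i x) \<longlonglongrightarrow> f x"
      "\<And>i x. x \<in> space M \<Longrightarrow> norm (G i x) \<le> 2 * norm (f x)"
    using borel_measurable_implies_sequence_metric[of f M 0] by simp blast
  have [measurable]: "G i \<in> borel_measurable M" for i
    using G(1) by (rule borel_measurable_simple_function)
  have G_int: "integrable M (G i)" for i
    by (rule Bochner_Integration.integrable_bound[where f = "\<lambda>x. 2 * norm (f x)"])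
       (use f G in \<open>auto intro!: AE_I2\<close>)
  have G_le: "norm (G i x) powr p \<le> 2 powr p * norm (f x) powr p" if "x \<in> space M" for i x
  proof -
    have "norm (G i x) powr p \<le> (2 * norm (f x)) powr p"
      using G(3)[OF that] p by (intro powr_mono2) auto
    thus ?thesis by (simp add: powr_mult)
  qed
  have "(\<lambda>i. \<integral>x. norm (G i x) powr p \<partial>M) \<longlonglongrightarrow> (\<integral>x. norm (f x) powr p \<partial>M)"
  proof (rule integral_dominated_convergence[where w = "\<lambda>x. 2 powr p * norm (f x) powr p"])
    show "AE x in M. (\<lambda>i. norm (G i x) powr p) \<longlonglongrightarrow> norm (f x) powr p"
      using p G(2) by (intro AE_I2 tendsto_powr' tendsto_norm tendsto_const) auto
  qed (use intp G_le in \<open>auto intro!: AE_I2\<close>)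
  hence ev: "eventually (\<lambda>i. (\<integral>x. norm (G i x) powr p \<partial>M) < 1) sequentially"
    using fp by (rule order_tendstoD)
  have L1: "(\<lambda>i. \<integral>x. norm (G i x - f x) \<partial>M) \<longlonglongrightarrow> (\<integral>x. 0 \<partial>M)"
  proof (rule integral_dominated_convergence[where w = "\<lambda>x. 3 * norm (f x)"])
    show "AE x in M. (\<lambda>i. norm (G i x - f x)) \<longlonglongrightarrow> 0"
      using G(2) by (intro AE_I2 tendsto_norm_zero) (simp add: LIM_zero_iff)
    show "AE x in M. norm (norm (G i x - f x)) \<le> 3 * norm (f x)" for i
    proof (rule AE_I2)
      fix x assume "x \<in> space M"
      thus "norm (norm (G i x - f x)) \<le> 3 * norm (f x)"
        using G(3)[of x i] norm_triangle_ineq4[of "G i x" "f x"] by simp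
    qed
  qed (use f in auto)
  have lim: "(\<lambda>i. T (G i) l) \<longlonglongrightarrow> T f l" for l
  proof -
    have "norm (T (G i) l - T f l) \<le> (\<integral>x. norm (G i x - f x) \<partial>M)" for i
      using T_L1[of "\<lambda>x. G i x - f x" l] G_int f by (simp add: T_diff)
    hence "\<forall>i. norm (T (G i) l - T f l) \<le> (\<integral>x. norm (G i x - f x) \<partial>M)" by blast
    hence "(\<lambda>i. T (G i) l - T f l) \<longlonglongrightarrow> 0"
      by (rule Lim_null_comparison[OF always_eventually]) (use L1 in simp)
    thus ?thesis by (simp add: LIM_zero_iff)
  qed
  show ?thesis
  proof (rule nn_integral_le_of_tendsto)
    have [measurable]: "T (G i) \<in> borel_measurable M" for i using G_int by auto
    show "(\<lambda>l. ennreal (norm (T (G i) l) powr q)) \<in> borel_measurable M" for i by measurable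
    show "AE l in M. (\<lambda>i. ennreal (norm (T (G i) l) powr q)) \<longlonglongrightarrow> ennreal (norm (T f l) powr q)"
      using lim q0 by (intro AE_I2 tendsto_ennrealI tendsto_powr' tendsto_norm tendsto_const) auto
    show "eventually (\<lambda>i. (\<integral>\<^sup>+ l. ennreal (norm (T (G i) l) powr q) \<partial>M) \<le> 1) sequentially"
      using ev by (rule eventually_mono) (auto intro!: T_simple_Lq_le_1[OF G(1) G_int _ p q])
  qed
qed

text \<open>
  For \<open>p = 1\<close> this is the endpoint estimate. Otherwise \<open>f\<close> is divided by an arbitrary \<open>c\<close> above its
  norm, which brings it into the open unit ball.
\<close>

theorem hausdorff_young:
  assumes f: "integrable M f" and p: "1 \<le> p" "p \<le> 2"
  shows "Lp_norm M (conj_exponent p) (T f) \<le> Lp_norm M (ennreal p) f"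
proof (cases "p = 1")
  case True
  have [measurable]: "T f \<in> borel_measurable M" using f by auto
  have "Lp_norm M (ennreal p) f = ennreal_power (\<integral>\<^sup>+ x. ennreal (norm (f x)) \<partial>M) 1"
    using True by (simp add: Lp_norm_def)
  also have "(\<integral>\<^sup>+ x. ennreal (norm (f x)) \<partial>M) = ennreal (\<integral>x. norm (f x) \<partial>M)"
    using f by (intro nn_integral_eq_integral) auto
  also have "ennreal_power \<dots> 1 = ennreal (\<integral>x. norm (f x) \<partial>M)"
    by (simp add: ennreal_power_def)
  finally have eq: "Lp_norm M (ennreal p) f = ennreal (\<integral>x. norm (f x) \<partial>M)" .
  have "esssup M (\<lambda>l. ennreal (norm (T f l))) \<le> ennreal (\<integral>x. norm (f x) \<partial>M)"
    using T_L1[OF f] by (intro esssup_I AE_I2 ennreal_leI) auto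
  thus ?thesis using True eq by (simp add: Lp_norm_def conj_exponent_def)
next
  case False
  hence p1: "1 < p" using p by simp
  define q where "q = p / (p - 1)"
  have q0: "0 < q" using p1 by (simp add: q_def)
  let ?f = "\<integral>\<^sup>+ x. ennreal (norm (f x) powr p) \<partial>M"
  let ?Tf = "\<integral>\<^sup>+ l. ennreal (norm (T f l) powr q) \<partial>M"
  have "Lp_norm M (ennreal q) (T f) \<le> Lp_norm M (ennreal p) f"
  proof (rule dense_ge)
    fix y assume y: "Lp_norm M (ennreal p) f < y"
    show "Lp_norm M (ennreal q) (T f) \<le> y"
    proof (cases y)
      case (real c)
      obtain c' where c': "Lp_norm M (ennreal p) f < c'" "c' < y" using y dense by blast
      then obtain d where d: "c' = ennreal d" "0 \<le> d" using real by (cases c') auto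
      have dc: "d < c" using c' d real by (simp add: ennreal_less_iff)
      hence c: "0 < c" using d by simp
      have "?f \<le> ennreal (d powr p)"
        using c'(1) d p1 Lp_norm_le_iff[of p d M f] by (simp add: less_imp_le)
      also have "\<dots> < ennreal (c powr p)" using d dc p1 by (simp add: ennreal_less_iff powr_less_mono2)
      finally have lt: "?f < ennreal (c powr p)" .
      define g where "g = (\<lambda>x. of_real (1 / c) * f x)"
      have g: "integrable M g" unfolding g_def using f by simp
      have meas [measurable]: "f \<in> borel_measurable M" "T f \<in> borel_measurable M" using f by auto
      have scale: "(\<integral>\<^sup>+ x. ennreal (norm (of_real (1 / c) * h x) powr r) \<partial>M) =
          ennreal (1 / c powr r) * (\<integral>\<^sup>+ x. ennreal (norm (h x) powr r) \<partial>M)"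
        if [measurable]: "h \<in> borel_measurable M" for h :: "'a \<Rightarrow> complex" and r
      proof -
        have "norm (of_real (1 / c) * h x) powr r = 1 / c powr r * norm (h x) powr r" for x
          using c by (simp add: norm_mult norm_divide powr_divide)
        hence "(\<integral>\<^sup>+ x. ennreal (norm (of_real (1 / c) * h x) powr r) \<partial>M) =
            (\<integral>\<^sup>+ x. ennreal (1 / c powr r) * ennreal (norm (h x) powr r) \<partial>M)"
          using c by (simp only: ennreal_mult powr_ge_zero zero_le_divide_1_iff)
        thus ?thesis by (simp add: nn_integral_cmult)
      qed
      have cancel: "ennreal (1 / c powr r) * ennreal (c powr r) = 1" for r
        using c by (simp flip: ennreal_mult)
      have "(\<integral>\<^sup>+ x. ennreal (norm (g x) powr p) \<partial>M) =
          ennreal (1 / c powr p) * ?f"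
        unfolding g_def by (rule scale[OF meas(1)])
      also have "\<dots> < ennreal (1 / c powr p) * ennreal (c powr p)"
        using lt c by (intro ennreal_mult_strict_left_mono) auto
      also have "\<dots> = 1" by (rule cancel)
      finally have "(\<integral>\<^sup>+ l. ennreal (norm (T g l) powr q) \<partial>M) \<le> 1"
        by (rule T_Lq_le_1[OF g _ p1 p(2) q_def])
      hence le: "ennreal (1 / c powr q) * ?Tf \<le> 1"
        unfolding g_def T_scale[OF f] scale[OF meas(2)] .
      have "?Tf =
          (ennreal (1 / c powr q) * ennreal (c powr q)) * ?Tf"
        unfolding cancel by simp
      also have "\<dots> = ennreal (c powr q) * (ennreal (1 / c powr q) * ?Tf)"
        by (simp only: mult_ac)
      also have "\<dots> \<le> ennreal (c powr q) * 1" using le by (intro mult_left_mono) auto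
      finally show ?thesis using real c q0 Lp_norm_le_iff[of q c M "T f"] by simp
    qed simp
  qed
  thus ?thesis using p1 by (simp add: conj_exponent_gt1 q_def)
qed

end

section \<open>Power series and Poisson integral of the Bessel function\<close>

text \<open>
  Absolute values of the power series coefficients of the normalized Bessel function.
\<close>

definition bessel_coeff :: "real \<Rightarrow> nat \<Rightarrow> real" where
  "bessel_coeff \<alpha> k = Gamma (\<alpha> + 1) / (4 ^ k * fact k * Gamma (\<alpha> + real k + 1))"

lemma bessel_coeff_pos: "\<alpha> > -1/2 \<Longrightarrow> 0 < bessel_coeff \<alpha> k"
  unfolding bessel_coeff_def by (intro divide_pos_pos mult_pos_pos Gamma_real_pos) auto

lemma Gamma_half_plus_nat: "Gamma (real k + 1/2) = Gamma (1/2) * fact (2 * k) / (4 ^ k * fact k)"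
proof (induction k)
  case (Suc k)
  have nz: "real k + 1/2 \<notin> \<int>\<^sub>\<le>\<^sub>0" by (auto elim!: nonpos_Ints_cases)
  have "real (Suc k) + 1/2 = (real k + 1/2) + 1" by simp
  hence "Gamma (real (Suc k) + 1/2) = (real k + 1/2) * Gamma (real k + 1/2)"
    using Gamma_plus1[OF nz] by (simp only:)
  also have "\<dots> = (real k + 1/2) * (Gamma (1/2) * fact (2 * k) / (4 ^ k * fact k))"
    by (simp only: Suc)
  also have "\<dots> = Gamma (1/2) * fact (2 * Suc k) / (4 ^ Suc k * fact (Suc k))"
    by (simp add: divide_simps) (simp add: algebra_simps)
  finally show ?case .
qed simp

text \<open>
  Poisson's integral in terms of coefficients: the cosine series with its \<open>k\<close>-th coefficient multiplied by
  the \<open>k\<close>-th normalized moment of a Beta density.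
\<close>

lemma bessel_coeff_eq_Beta:
  assumes "\<alpha> > -1/2"
  shows "bessel_coeff \<alpha> k = Beta (real k + 1/2) (\<alpha> + 1/2) / (Beta (1/2) (\<alpha> + 1/2) * fact (2 * k))"
proof -
  have pos: "Gamma (\<alpha> + 1/2) > 0" "Gamma (\<alpha> + 1) > 0" "Gamma (1/2 :: real) > 0" "Gamma (\<alpha> + real k + 1) > 0"
    using assms by (auto intro!: Gamma_real_pos)
  have B1: "Beta (real k + 1/2) (\<alpha> + 1/2) = Gamma (real k + 1/2) * Gamma (\<alpha> + 1/2) / Gamma (\<alpha> + real k + 1)"
    by (simp add: Beta_def algebra_simps)
  have B2: "Beta (1/2) (\<alpha> + 1/2) = Gamma (1/2) * Gamma (\<alpha> + 1/2) / Gamma (\<alpha> + 1)"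
    by (simp add: Beta_def algebra_simps)
  have cancel: "l / (c * d * m) = (h * e / (c * d) * g / m) / (h * g / l * e)"
    if "g \<noteq> 0" "h \<noteq> 0" "l \<noteq> 0" "m \<noteq> 0" "c \<noteq> 0" "d \<noteq> 0" "e \<noteq> 0" for g h l m c d e :: real
    using that by (simp add: divide_simps)
  show ?thesis
    unfolding bessel_coeff_def B1 B2 Gamma_half_plus_nat by (rule cancel) (use pos less_imp_neq[OF pos(3), symmetric] in auto)
qed

lemma has_bochner_integral_Beta_moment:
  assumes "\<alpha> > -1/2"
  shows "has_bochner_integral lborel
     (\<lambda>u. indicator {0..1} u * (u powr (-1/2) * (1 - u) powr (\<alpha> - 1/2)) * u ^ k)
     (Beta (real k + 1/2) (\<alpha> + 1/2))"
proof -
  have eq: "indicator {0..1} u * (u powr (-1/2) * (1 - u) powr (\<alpha> - 1/2)) * u ^ k =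
      indicator {0..1} u *\<^sub>R (u powr (real k + 1/2 - 1) * (1 - u) powr (\<alpha> + 1/2 - 1))" for u :: real
  proof (cases "0 < u")
    case True
    have "u powr (-1/2) * u ^ k = u powr (-1/2) * u powr real k" using True by (simp add: powr_realpow)
    also have "\<dots> = u powr (real k + 1/2 - 1)" by (subst powr_add[symmetric]) (simp add: algebra_simps)
    finally show ?thesis by (simp add: mult_ac)
  next
    case False
    thus ?thesis by (cases "u = 0") (auto simp: indicator_def)
  qed
  have pos: "0 < real k + 1/2" "0 < \<alpha> + 1/2" using assms by auto
  note int = integrable_Beta[OF pos]
  have "integral {0..1} (\<lambda>t. t powr (real k + 1/2 - 1) * (1 - t) powr (\<alpha> + 1/2 - 1)) = Beta (real k + 1/2) (\<alpha> + 1/2)"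
    using has_integral_Beta_real[OF pos] by (rule integral_unique)
  thus ?thesis
    unfolding eq has_bochner_integral_iff using int set_borel_integral_eq_integral(2)[OF int]
    by (simp add: set_integrable_def set_lebesgue_integral_def)
qed

text \<open>
  The moments of a density on the unit interval decrease.
\<close>

lemma bessel_coeff_le:
  assumes "\<alpha> > -1/2"
  shows "bessel_coeff \<alpha> k \<le> 1 / fact (2 * k)"
proof -
  have B0: "0 < Beta (1/2) (\<alpha> + 1/2)" using assms by (simp add: Beta_def Gamma_real_pos)
  define W where "W u = indicator {0..1} u * (u powr (-1/2) * (1 - u) powr (\<alpha> - 1/2))" for u :: real
  note H = has_bochner_integral_Beta_moment[OF assms, folded W_def]
  have "(\<integral>u. W u * u ^ k \<partial>lborel) \<le> (\<integral>u. W u * u ^ 0 \<partial>lborel)"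
  proof (rule integral_mono)
    show "W u * u ^ k \<le> W u * u ^ 0" for u
    proof (cases "u \<in> {0..1}")
      case True
      have "0 \<le> W u" by (simp add: W_def)
      thus ?thesis using True by (intro mult_left_mono) (simp_all add: power_le_one)
    qed (simp add: W_def)
  qed (use H[of k] H[of 0] in \<open>simp_all add: has_bochner_integral_iff\<close>)
  hence "Beta (real k + 1/2) (\<alpha> + 1/2) \<le> Beta (1/2) (\<alpha> + 1/2)"
    using H[of k] H[of 0] by (simp add: has_bochner_integral_iff)
  hence "Beta (real k + 1/2) (\<alpha> + 1/2) / (Beta (1/2) (\<alpha> + 1/2) * fact (2 * k)) \<le>
      Beta (1/2) (\<alpha> + 1/2) / (Beta (1/2) (\<alpha> + 1/2) * fact (2 * k))"
    using B0 by (intro divide_right_mono) auto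
  thus ?thesis using B0 by (simp add: bessel_coeff_eq_Beta[OF assms])
qed

lemma summable_bessel:
  assumes "\<alpha> > -1/2"
  shows "summable (\<lambda>k. bessel_coeff \<alpha> k * \<bar>r\<bar> ^ (2 * k))"
proof (rule summable_comparison_test'[where N = 0])
  show "summable (\<lambda>k. (r\<^sup>2) ^ k /\<^sub>R fact k)" by (rule summable_exp_generic)
  fix k :: nat
  have "bessel_coeff \<alpha> k \<le> 1 / fact k"
    using bessel_coeff_le[OF assms, of k] fact_mono[of k "2 * k", where 'a = real]
    by (auto elim!: order_trans intro!: divide_left_mono)
  hence "bessel_coeff \<alpha> k * \<bar>r\<bar> ^ (2 * k) \<le> 1 / fact k * \<bar>r\<bar> ^ (2 * k)"
    by (intro mult_right_mono) auto
  thus "norm (bessel_coeff \<alpha> k * \<bar>r\<bar> ^ (2 * k)) \<le> (r\<^sup>2) ^ k /\<^sub>R fact k"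
    using bessel_coeff_pos[OF assms, of k] by (simp add: power_mult abs_mult divide_simps)
qed

lemma normalized_bessel_sums:
  assumes "\<alpha> > -1/2"
  shows "(\<lambda>k. (-1) ^ k * bessel_coeff \<alpha> k * r ^ (2 * k)) sums normalized_bessel \<alpha> r"
    and "summable (\<lambda>k. norm ((-1) ^ k * bessel_coeff \<alpha> k * r ^ (2 * k)))"
proof -
  have "norm ((-1) ^ k * bessel_coeff \<alpha> k * r ^ (2 * k)) = bessel_coeff \<alpha> k * \<bar>r\<bar> ^ (2 * k)" for k
    using bessel_coeff_pos[OF assms, of k] by (simp add: abs_mult power_abs)
  thus S: "summable (\<lambda>k. norm ((-1) ^ k * bessel_coeff \<alpha> k * r ^ (2 * k)))"
    using summable_bessel[OF assms, of r] by simp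
  have pos: "Gamma (\<alpha> + 1) > 0" using assms by (simp add: Gamma_real_pos)
  define t where "t = (\<lambda>k. (-1) ^ k * r ^ (2 * k) / (2 ^ (2 * k) * fact k * Gamma (\<alpha> + real k + 1)))"
  have eq: "(-1) ^ k * bessel_coeff \<alpha> k * r ^ (2 * k) = Gamma (\<alpha> + 1) * t k" for k
    by (simp add: bessel_coeff_def t_def power_mult)
  have "summable (\<lambda>k. Gamma (\<alpha> + 1) * t k)" using summable_norm_cancel[OF S] by (simp add: eq)
  hence "summable t" using pos by (simp add: summable_mult_D)
  hence "(\<lambda>k. Gamma (\<alpha> + 1) * t k) sums (Gamma (\<alpha> + 1) * suminf t)"
    by (intro sums_mult summable_sums)
  thus "(\<lambda>k. (-1) ^ k * bessel_coeff \<alpha> k * r ^ (2 * k)) sums normalized_bessel \<alpha> r"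
    unfolding eq normalized_bessel_def t_def .
qed

lemma measurable_normalized_bessel [measurable]: "normalized_bessel \<alpha> \<in> borel_measurable borel"
  unfolding normalized_bessel_def by measurable

text \<open>
  By Poisson's integral, \<open>normalized_bessel \<alpha> r\<close> is the average of \<open>cos (r sqrt u)\<close> with respect to a
  Beta density in \<open>u\<close>.
\<close>

theorem abs_normalized_bessel_le_1:
  assumes "\<alpha> > -1/2"
  shows "\<bar>normalized_bessel \<alpha> r\<bar> \<le> 1"
proof -
  define w where "w u = indicator {0..1} u * (u powr (-1/2) * (1 - u) powr (\<alpha> - 1/2))" for u :: real
  define B where "B = Beta (1/2) (\<alpha> + 1/2)"
  have B0: "0 < B" using assms by (simp add: B_def Beta_def Gamma_real_pos)
  have w0: "0 \<le> w u" for u by (simp add: w_def indicator_def)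
  note H = has_bochner_integral_Beta_moment[OF assms, folded w_def]
  have w_int: "integrable lborel w" "integral\<^sup>L lborel w = B"
    using H[of 0] by (simp_all add: has_bochner_integral_iff B_def)
  define f where "f = (\<lambda>k u. (-1) ^ k * (r\<^sup>2) ^ k / fact (2 * k) * (w u * u ^ k))"
  have f_int: "integrable lborel (f k)" for k
    unfolding f_def using H[of k] by (simp add: has_bochner_integral_iff)
  have f_integral: "integral\<^sup>L lborel (f k) = B * ((-1) ^ k * bessel_coeff \<alpha> k * r ^ (2 * k))" for k
    unfolding f_def using H[of k] B0
    by (simp add: has_bochner_integral_iff bessel_coeff_eq_Beta[OF assms] B_def power_mult)
  have f_sums: "(\<lambda>k. f k u) sums (w u * cos (r * sqrt u))" for u
  proof (cases "u \<in> {0..1}")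
    case True
    have "(\<lambda>k. w u * ((-1) ^ k / fact (2 * k) * (r * sqrt u) ^ (2 * k))) sums (w u * cos (r * sqrt u))"
      by (intro sums_mult cos_paired)
    moreover have "(r * sqrt u) ^ (2 * k) = (r\<^sup>2) ^ k * u ^ k" for k
      using True unfolding power_mult by (simp add: power_mult_distrib)
    ultimately show ?thesis by (simp add: f_def mult_ac)
  qed (simp add: f_def w_def)
  have f_norm: "norm (f k u) = (r\<^sup>2) ^ k / fact (2 * k) * (w u * u ^ k)" for k u
    using w0[of u] by (auto simp: f_def abs_mult w_def indicator_def)
  have summ: "summable (\<lambda>k. norm (f k u))" for u
  proof (cases "u \<in> {0..1}")
    case True
    show ?thesis
    proof (rule summable_comparison_test'[where N = 0])
      show "summable (\<lambda>k. w u * ((r\<^sup>2) ^ k /\<^sub>R fact k))"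
        by (intro summable_mult summable_exp_generic)
      fix k :: nat
      have "(r\<^sup>2) ^ k / fact (2 * k) * u ^ k \<le> (r\<^sup>2) ^ k / fact k * 1"
        using True by (intro mult_mono divide_left_mono power_le_one fact_mono) auto
      hence "w u * ((r\<^sup>2) ^ k / fact (2 * k) * u ^ k) \<le> w u * ((r\<^sup>2) ^ k / fact k * 1)"
        using w0[of u] by (rule mult_left_mono)
      thus "norm (norm (f k u)) \<le> w u * ((r\<^sup>2) ^ k /\<^sub>R fact k)"
        using f_norm[of k u] by (simp add: divide_inverse mult_ac)
    qed
  qed (simp add: f_def w_def)
  have sums: "(\<lambda>k. integral\<^sup>L lborel (f k)) sums (\<integral>u. (\<Sum>k. f k u) \<partial>lborel)"
  proof (rule sums_integral[OF f_int])
    show "AE u in lborel. summable (\<lambda>k. norm (f k u))" using summ by simp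
    have "(\<integral>u. norm (f k u) \<partial>lborel) = B * (bessel_coeff \<alpha> k * \<bar>r\<bar> ^ (2 * k))" for k
      unfolding f_norm using H[of k] B0
      by (simp add: has_bochner_integral_iff bessel_coeff_eq_Beta[OF assms] B_def power_mult)
    thus "summable (\<lambda>k. \<integral>u. norm (f k u) \<partial>lborel)"
      using summable_bessel[OF assms] by (simp add: summable_mult)
  qed
  have "(\<lambda>k. integral\<^sup>L lborel (f k)) sums (B * normalized_bessel \<alpha> r)"
    unfolding f_integral by (intro sums_mult normalized_bessel_sums assms)
  hence eq: "B * normalized_bessel \<alpha> r = (\<integral>u. w u * cos (r * sqrt u) \<partial>lborel)"
    using sums sums_unique2 f_sums[THEN sums_unique] by simp
  have "\<bar>B * normalized_bessel \<alpha> r\<bar> \<le> (\<integral>u. \<bar>w u * cos (r * sqrt u)\<bar> \<partial>lborel)"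
    unfolding eq using integral_norm_bound[of lborel "\<lambda>u. w u * cos (r * sqrt u)"] by simp
  also have "\<dots> \<le> (\<integral>u. w u \<partial>lborel)"
  proof (rule integral_mono)
    show le: "\<bar>w u * cos (r * sqrt u)\<bar> \<le> w u" for u
      using w0[of u] by (simp add: abs_mult mult_left_le)
    have [measurable]: "w \<in> borel_measurable borel" unfolding w_def by measurable
    show "integrable lborel (\<lambda>u. \<bar>w u * cos (r * sqrt u)\<bar>)"
      by (rule Bochner_Integration.integrable_bound[OF w_int(1)]) (auto intro!: AE_I2 order_trans[OF le])
  qed (rule w_int)
  finally show ?thesis using B0 by (simp add: w_int abs_mult)
qed

section \<open>The double series of Weber\<close>

text \<open>
  The part of degree \<open>n\<close> of the double series that results when two Bessel series are multiplied and
  integrated termwise against a Gaussian.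
\<close>

definition weber_coeff :: "real \<Rightarrow> real \<Rightarrow> real \<Rightarrow> nat \<Rightarrow> real" where
  "weber_coeff \<alpha> A B n = (\<Sum>j\<le>n. A ^ j * B ^ (n - j) * Gamma (\<alpha> + 1 + real n) /
     (fact j * fact (n - j) * Gamma (\<alpha> + real j + 1) * Gamma (\<alpha> + real (n - j) + 1)))"

text \<open>
  In terms of the modified Bessel function this is \<open>I\<^sub>\<alpha>(2 sqrt s)\<close> divided by the power \<open>\<alpha> / 2\<close> of \<open>s\<close>.
\<close>

definition bessel_I_series :: "real \<Rightarrow> real \<Rightarrow> real" where
  "bessel_I_series \<alpha> s = (\<Sum>m. s ^ m / (fact m * Gamma (\<alpha> + real m + 1)))"

lemma bessel_I_summable:
  assumes "\<alpha> > -1/2"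
  shows "summable (\<lambda>m. norm (s ^ m / (fact m * Gamma (\<alpha> + real m + 1))))"
proof -
  have pos: "Gamma (\<alpha> + 1) > 0" "\<And>m. Gamma (\<alpha> + real m + 1) > 0"
    using assms by (auto intro!: Gamma_real_pos)
  have pow: "\<bar>2 * sqrt \<bar>s\<bar>\<bar> ^ (2 * m) = 4 ^ m * \<bar>s\<bar> ^ m" for m
    by (simp add: power_mult power_mult_distrib)
  have "norm (s ^ m / (fact m * Gamma (\<alpha> + real m + 1))) =
      1 / Gamma (\<alpha> + 1) * (bessel_coeff \<alpha> m * \<bar>2 * sqrt \<bar>s\<bar>\<bar> ^ (2 * m))" for m
    using pos(1) pos(2)[of m] 
    unfolding pow by (simp add: bessel_coeff_def power_abs abs_mult field_simps)
  thus ?thesis by (simp only: summable_mult summable_bessel[OF assms])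
qed

text \<open>
  Vandermonde's identity for the binomial coefficient of \<open>\<alpha> + j + k\<close> over \<open>j\<close>, in terms of \<open>Gamma\<close>.
\<close>

lemma gbinomial_Vandermonde_Gamma:
  assumes "\<alpha> > -1/2"
  shows "Gamma (\<alpha> + 1 + real (j + k)) / (fact j * fact k * Gamma (\<alpha> + real j + 1) * Gamma (\<alpha> + real k + 1)) =
    (\<Sum>m\<in>{m. m \<le> j \<and> m \<le> k}. 1 / (fact (j - m) * fact (k - m) * fact m * Gamma (\<alpha> + real m + 1)))"
proof -
  have pos: "Gamma (\<alpha> + real m + 1) > 0" for m
    using assms by (auto intro!: Gamma_real_pos)
  have notin: "x \<notin> \<int>\<^sub>\<le>\<^sub>0" if "x > 0" for x :: real using that by (auto elim!: nonpos_Ints_cases)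
  have "(real k + (\<alpha> + real j)) gchoose j = Gamma (real k + (\<alpha> + real j) + 1) / (fact j * Gamma (real k + (\<alpha> + real j) - real j + 1))"
    using assms by (intro gbinomial_Gamma notin) auto
  hence "Gamma (\<alpha> + 1 + real (j + k)) / (fact j * Gamma (\<alpha> + real k + 1)) = (real k + (\<alpha> + real j)) gchoose j"
    by (simp add: algebra_simps)
  also have "\<dots> = (\<Sum>m=0..j. (real k gchoose m) * ((\<alpha> + real j) gchoose (j - m)))"
    by (rule gbinomial_Vandermonde[symmetric])
  also have "\<dots> = (\<Sum>m=0..j. if m \<le> k then fact k * Gamma (\<alpha> + real j + 1) *
      (1 / (fact (j - m) * fact (k - m) * fact m * Gamma (\<alpha> + real m + 1))) else 0)"
  proof (rule sum.cong[OF refl])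
    fix m assume "m \<in> {0..j}"
    hence m: "m \<le> j" by simp
    have g: "(\<alpha> + real j) gchoose (j - m) = Gamma (\<alpha> + real j + 1) / (fact (j - m) * Gamma (\<alpha> + real m + 1))"
      using gbinomial_Gamma[of "\<alpha> + real j" "j - m"] notin[of "\<alpha> + real j + 1"] assms m
      by (simp add: of_nat_diff algebra_simps)
    show "(real k gchoose m) * ((\<alpha> + real j) gchoose (j - m)) = (if m \<le> k then fact k * Gamma (\<alpha> + real j + 1) *
      (1 / (fact (j - m) * fact (k - m) * fact m * Gamma (\<alpha> + real m + 1))) else 0)"
    proof (cases "m \<le> k")
      case True
      have "real k gchoose m = fact k / (fact m * fact (k - m))"
        using True by (simp add: binomial_gbinomial[symmetric] binomial_fact)
      thus ?thesis using True by (simp add: g)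
    next
      case False
      thus ?thesis by (simp add: binomial_gbinomial[symmetric] binomial_eq_0)
    qed
  qed
  also have "\<dots> = (\<Sum>m\<in>{m. m \<le> j \<and> m \<le> k}. fact k * Gamma (\<alpha> + real j + 1) *
      (1 / (fact (j - m) * fact (k - m) * fact m * Gamma (\<alpha> + real m + 1))))"
    by (rule sum.mono_neutral_cong_right) auto
  also have "\<dots> = fact k * Gamma (\<alpha> + real j + 1) * (\<Sum>m\<in>{m. m \<le> j \<and> m \<le> k}. 
      1 / (fact (j - m) * fact (k - m) * fact m * Gamma (\<alpha> + real m + 1)))"
    by (simp add: sum_distrib_left)
  finally show ?thesis using pos[of j] pos[of k] by (simp add: field_simps)
qed

text \<open>
  The right-hand side is a Cauchy product of an exponential series and a series in even degrees. Its
  part of degree \<open>n\<close> is the left-hand side by Vandermonde's identity. The signs of \<open>A\<close> and \<open>B\<close> are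
  arbitrary: Weber's integral takes its value from negative arguments and its absolute convergence from
  positive ones.
\<close>

lemma weber_coeff_sums:
  assumes "\<alpha> > -1/2"
  shows "weber_coeff \<alpha> A B sums (exp (A + B) * bessel_I_series \<alpha> (A * B))"
proof -
  define G where "G = (\<lambda>m. 1 / (fact m * Gamma (\<alpha> + real m + 1)))"
  define b where "b = (\<lambda>i. if even i then (A * B) ^ (i div 2) * G (i div 2) else 0)"
  define e where "e = (\<lambda>N. (A + B) ^ N /\<^sub>R fact N)"
  have I_sums: "(\<lambda>m. (A * B) ^ m * G m) sums bessel_I_series \<alpha> (A * B)"
    using summable_sums[OF summable_norm_cancel[OF bessel_I_summable[OF assms, of "A * B"]]]
    by (simp add: G_def bessel_I_series_def)
  have b_sums: "b sums bessel_I_series \<alpha> (A * B)"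
    unfolding b_def using sums_if[OF sums_zero I_sums] by simp
  have "(\<lambda>m. norm ((A * B) ^ m * G m)) sums suminf (\<lambda>m. norm ((A * B) ^ m * G m))"
    using bessel_I_summable[OF assms, of "A * B"] by (intro summable_sums) (simp add: G_def)
  moreover have b_norm: "norm (b i) = (if even i then norm ((A * B) ^ (i div 2) * G (i div 2)) else 0)" for i
    by (simp add: b_def)
  ultimately have "(\<lambda>i. norm (b i)) sums suminf (\<lambda>m. norm ((A * B) ^ m * G m))"
    using sums_if[OF sums_zero, of "\<lambda>m. norm ((A * B) ^ m * G m)"] by simp
  hence b_abs: "summable (\<lambda>i. norm (b i))"
    by (simp add: sums_iff)
  have e_abs: "summable (\<lambda>N. norm (e N))" unfolding e_def by (rule summable_norm_exp)
  have e_sum: "suminf e = exp (A + B)" unfolding e_def exp_def by simp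
  have e_binomial: "e N = (\<Sum>a\<le>N. A ^ a * B ^ (N - a) / (fact a * fact (N - a)))" for N
  proof -
    have "(A + B) ^ N = (\<Sum>a\<le>N. real (N choose a) * A ^ a * B ^ (N - a))" by (rule binomial_ring)
    also have "\<dots> = (\<Sum>a\<le>N. fact N * (A ^ a * B ^ (N - a) / (fact a * fact (N - a))))"
      by (intro sum.cong refl) (simp add: binomial_fact)
    also have "\<dots> = fact N * (\<Sum>a\<le>N. A ^ a * B ^ (N - a) / (fact a * fact (N - a)))"
      by (rule sum_distrib_left[symmetric])
    finally show ?thesis by (simp add: e_def)
  qed
  have coeff: "weber_coeff \<alpha> A B n = (\<Sum>i\<le>n. b i * e (n - i))" for n
  proof -
    let ?u = "\<lambda>m a. (A * B) ^ m * G m * (A ^ a * B ^ (n - 2 * m - a) / (fact a * fact (n - 2 * m - a)))"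
    let ?v = "\<lambda>j m. A ^ j * B ^ (n - j) / (fact (j - m) * fact (n - j - m)) * G m"
    let ?w = "\<lambda>j. fact j * fact (n - j) * Gamma (\<alpha> + real j + 1) * Gamma (\<alpha> + real (n - j) + 1)"
    let ?x = "\<lambda>j m. 1 / (fact (j - m) * fact (n - j - m) * fact m * Gamma (\<alpha> + real m + 1))"
    have "weber_coeff \<alpha> A B n = (\<Sum>j\<le>n. \<Sum>m\<in>{m. m \<le> j \<and> m \<le> n - j}.
        ?v j m)"
      unfolding weber_coeff_def
    proof (rule sum.cong[OF refl])
      fix j assume "j \<in> {..n}"
      hence "n = j + (n - j)" by simp
      hence "Gamma (\<alpha> + 1 + real n) / (?w j)
         = (\<Sum>m\<in>{m. m \<le> j \<and> m \<le> n - j}. ?x j m)"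
        using gbinomial_Vandermonde_Gamma[OF assms, of j "n - j"] by simp
      hence "A ^ j * B ^ (n - j) * (Gamma (\<alpha> + 1 + real n) / (?w j))
         = A ^ j * B ^ (n - j) * (\<Sum>m\<in>{m. m \<le> j \<and> m \<le> n - j}. ?x j m)"
        by simp
      thus "A ^ j * B ^ (n - j) * Gamma (\<alpha> + 1 + real n) / (?w j) =
        (\<Sum>m\<in>{m. m \<le> j \<and> m \<le> n - j}. ?v j m)"
        by (simp add: sum_distrib_left G_def mult.assoc)
    qed
    also have "\<dots> = (\<Sum>(j, m)\<in>(SIGMA j:{..n}. {m. m \<le> j \<and> m \<le> n - j}).
        ?v j m)"
      by (rule sum.Sigma) auto
    also have "\<dots> = (\<Sum>(m, a)\<in>(SIGMA m:{m. 2 * m \<le> n}. {..n - 2 * m}).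
        ?u m a)"
    proof (rule sum.reindex_bij_witness[where i = "\<lambda>(m, a). (a + m, m)" and j = "\<lambda>(j, m). (m, j - m)"], goal_cases)
      case (5 x)
      then obtain j m where x: "x = (j, m)" "j \<le> n" "m \<le> j" "m \<le> n - j" by auto
      have 1: "n - (m * 2 + (j - m)) = n - (j + m)" using x by simp
      have "A ^ j = A ^ m * A ^ (j - m)" "B ^ (n - j) = B ^ m * B ^ (n - j - m)"
        using x by (simp_all flip: power_add)
      thus ?case by (simp add: x(1) 1 power_mult_distrib mult_ac)
    qed auto
    also have "\<dots> = (\<Sum>m\<in>{m. 2 * m \<le> n}. \<Sum>a\<le>n - 2 * m. 
        ?u m a)"
    proof (rule sum.Sigma[symmetric])
      show "finite {m. 2 * m \<le> n}" by (rule finite_subset[of _ "{..n}"]) auto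
    qed auto
    also have "\<dots> = (\<Sum>m\<in>{m. 2 * m \<le> n}. b (2 * m) * e (n - 2 * m))"
      by (simp add: b_def e_binomial sum_distrib_left)
    also have "\<dots> = (\<Sum>i\<in>{i. i \<le> n \<and> even i}. b i * e (n - i))"
      by (rule sum.reindex_bij_witness[where i = "\<lambda>i. i div 2" and j = "\<lambda>m. 2 * m"]) auto
    also have "\<dots> = (\<Sum>i\<le>n. b i * e (n - i))"
      by (rule sum.mono_neutral_left) (auto simp: b_def)
    finally show ?thesis .
  qed
  have "(\<lambda>n. \<Sum>i\<le>n. b i * e (n - i)) sums (suminf b * suminf e)"
    by (rule Cauchy_product_sums[OF b_abs e_abs])
  thus ?thesis unfolding coeff[symmetric, abs_def] e_sum b_sums[THEN sums_unique, symmetric]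
    by (simp add: mult.commute)
qed

section \<open>Weber's second exponential integral\<close>

lemma nn_integral_exhaust_atLeast0:
  fixes f :: "real \<Rightarrow> real" and a :: "nat \<Rightarrow> real"
  assumes [measurable]: "f \<in> borel_measurable borel" and nn: "\<And>x. 0 \<le> x \<Longrightarrow> 0 \<le> f x"
    and a: "incseq a" "filterlim a at_top sequentially"
  shows "(\<lambda>n. \<integral>\<^sup>+ x. ennreal (f x * indicator {0..a n} x) \<partial>lborel) \<longlonglongrightarrow>
    (\<integral>\<^sup>+ x. ennreal (f x * indicator {0..} x) \<partial>lborel)"
proof (rule nn_integral_LIMSEQ)
  show "incseq (\<lambda>n x. ennreal (f x * indicator {0..a n} x))"
  proof (intro incseq_SucI le_funI ennreal_leI)
    fix n x show "f x * indicator {0..a n} x \<le> f x * indicator {0..a (Suc n)} x"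
      using nn[of x] incseq_SucD[OF a(1), of n] by (auto simp: indicator_def)
  qed
  fix x
  have "eventually (\<lambda>n. ennreal (f x * indicator {0..a n} x) = ennreal (f x * indicator {0..} x)) sequentially"
    using filterlim_at_top[THEN iffD1, OF a(2), rule_format, of x]
    by (rule eventually_mono) (auto simp: indicator_def)
  thus "(\<lambda>n. ennreal (f x * indicator {0..a n} x)) \<longlonglongrightarrow> ennreal (f x * indicator {0..} x)"
    by (rule tendsto_eventually)
qed measurable

text \<open>
  Substitution of \<open>u = t x\<^sup>2\<close> in the integral of the Gamma function, first on bounded intervals.
\<close>

lemma nn_integral_gaussian_powr:
  assumes t: "0 < t" and s: "0 < s"
  shows "(\<integral>\<^sup>+ x. ennreal (indicator {0<..} x * (x powr (2 * s - 1) * exp (- t * x\<^sup>2))) \<partial>lborel) =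
    ennreal (Gamma s / (2 * t powr s))"
proof -
  let ?g = "\<lambda>x. ennreal (indicator {0<..} x * (x powr (2 * s - 1) * exp (- t * x\<^sup>2)))"
  define F where "F u = u powr (s - 1) / exp u" for u :: real
  have [measurable]: "F \<in> borel_measurable borel" unfolding F_def by measurable
  have F0: "0 \<le> F u" for u by (simp add: F_def)
  define H where "H x = F (t * x\<^sup>2) * (2 * t * x)" for x
  have [measurable]: "H \<in> borel_measurable borel" unfolding H_def by measurable
  have H0: "0 \<le> H x" if "0 \<le> x" for x using that t F0 by (simp add: H_def)
  have H_eq: "H x * indicator {0..} x =
      2 * t powr s * (indicator {0<..} x * (x powr (2 * s - 1) * exp (- t * x\<^sup>2)))" for x
  proof (cases "0 < x")
    case True
    have "(t * x\<^sup>2) powr (s - 1) = t powr (s - 1) * (x powr 2) powr (s - 1)"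
      using True t by (simp add: powr_mult)
    also have "\<dots> = t powr (s - 1) * x powr (2 * s - 2)" by (simp add: powr_powr algebra_simps)
    finally have "H x = 2 * (t powr (s - 1) * t powr 1) * (x powr (2 * s - 2) * x powr 1) * exp (- t * x\<^sup>2)"
      using True t by (simp add: H_def F_def exp_minus field_simps)
    also have "t powr (s - 1) * t powr 1 = t powr s" by (subst powr_add[symmetric]) simp
    also have "x powr (2 * s - 2) * x powr 1 = x powr (2 * s - 1)" by (subst powr_add[symmetric]) simp
    finally show ?thesis using True by simp
  next
    case False
    thus ?thesis by (cases "x = 0") (auto simp: H_def)
  qed
  have lim1: "(\<lambda>n. \<integral>\<^sup>+ x. ennreal (F x * indicator {0..t * (real n)\<^sup>2} x) \<partial>lborel) \<longlonglongrightarrow>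
    (\<integral>\<^sup>+ x. ennreal (F x * indicator {0..} x) \<partial>lborel)"
  proof (rule nn_integral_exhaust_atLeast0)
    show "incseq (\<lambda>n. t * (real n)\<^sup>2)" using t by (auto simp: incseq_def power_mono)
    show "filterlim (\<lambda>n. t * (real n)\<^sup>2) at_top sequentially"
      using t by (intro filterlim_tendsto_pos_mult_at_top[OF tendsto_const] filterlim_pow_at_top filterlim_real_sequentially) auto
  qed (use F0 in auto)
  have lim2: "(\<lambda>n. \<integral>\<^sup>+ x. ennreal (H x * indicator {0..real n} x) \<partial>lborel) \<longlonglongrightarrow>
    (\<integral>\<^sup>+ x. ennreal (H x * indicator {0..} x) \<partial>lborel)"
    by (rule nn_integral_exhaust_atLeast0) (use H0 filterlim_real_sequentially in \<open>auto simp: incseq_def\<close>)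
  have "(\<integral>\<^sup>+ x. ennreal (F x * indicator {0..t * (real n)\<^sup>2} x) \<partial>lborel) =
      (\<integral>\<^sup>+ x. ennreal (H x * indicator {0..real n} x) \<partial>lborel)" for n
  proof -
    have "(\<integral>\<^sup>+ x. ennreal (F x * indicator {t * 0\<^sup>2..t * (real n)\<^sup>2} x) \<partial>lborel) =
        (\<integral>\<^sup>+ x. ennreal (F (t * x\<^sup>2) * (2 * t * x) * indicator {0..real n} x) \<partial>lborel)"
      using t by (intro nn_integral_substitution[where g = "\<lambda>x. t * x\<^sup>2"])
        (auto simp: set_borel_measurable_def intro!: derivative_eq_intros continuous_intros)
    thus ?thesis by (simp add: H_def)
  qed
  hence "(\<integral>\<^sup>+ x. ennreal (H x * indicator {0..} x) \<partial>lborel) = (\<integral>\<^sup>+ x. ennreal (F x * indicator {0..} x) \<partial>lborel)"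
    using lim1 lim2 by (simp add: LIMSEQ_unique)
  also have "\<dots> = ennreal (Gamma s)"
    using Gamma_conv_nn_integral_real[OF s] by (simp add: F_def mult_ac)
  finally have eq: "ennreal (2 * t powr s) * (\<integral>\<^sup>+ x. ?g x \<partial>lborel)
     = ennreal (Gamma s)"
    unfolding H_eq using t by (subst nn_integral_cmult[symmetric]) (auto simp: ennreal_mult')
  have "ennreal (1 / (2 * t powr s)) * (ennreal (2 * t powr s) * (\<integral>\<^sup>+ x. ?g x \<partial>lborel))
     = ennreal (Gamma s / (2 * t powr s))"
    unfolding eq using t s by (simp flip: ennreal_mult'')
  thus ?thesis using t by (simp add: mult.assoc[symmetric] flip: ennreal_mult'')
qed

text \<open>
  The factor of the Weinstein measure in the last variable.
\<close>

definition hankel_measure :: "real \<Rightarrow> real measure" where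
  "hankel_measure \<alpha> = density lborel
     (\<lambda>y. ennreal (indicator {0<..} y * (y powr (2 * \<alpha> + 1) / (2 powr \<alpha> * Gamma (\<alpha> + 1)))))"

lemma sets_hankel_measure [simp, measurable_cong]: "sets (hankel_measure \<alpha>) = sets borel"
  by (simp add: hankel_measure_def)

lemma space_hankel_measure [simp]: "space (hankel_measure \<alpha>) = UNIV"
  by (simp add: hankel_measure_def)

definition gaussian_moment :: "real \<Rightarrow> real \<Rightarrow> nat \<Rightarrow> real" where
  "gaussian_moment \<alpha> t n = Gamma (\<alpha> + 1 + real n) / (2 powr (\<alpha> + 1) * Gamma (\<alpha> + 1) * t powr (\<alpha> + 1 + real n))"

lemma hankel_gaussian_moment:
  assumes \<alpha>: "\<alpha> > -1/2" and t: "0 < t"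
  shows "has_bochner_integral (hankel_measure \<alpha>) (\<lambda>y. y ^ (2 * n) * exp (- t * y\<^sup>2)) (gaussian_moment \<alpha> t n)"
proof -
  let ?g = "\<lambda>y. indicator {0<..} y * (y powr (2 * (\<alpha> + 1 + real n) - 1) * exp (- t * y\<^sup>2))"
  define c where "c = 1 / (2 powr \<alpha> * Gamma (\<alpha> + 1))"
  have G0: "0 < Gamma (\<alpha> + 1)" "0 < Gamma (\<alpha> + 1 + real n)" using \<alpha> by (auto intro!: Gamma_real_pos)
  hence c: "0 < c" by (simp add: c_def)
  have c_eq: "y powr (2 * \<alpha> + 1) / (2 powr \<alpha> * Gamma (\<alpha> + 1)) = c * y powr (2 * \<alpha> + 1)" for y
    by (simp add: c_def)
  have ev: "y ^ (2 * n) = (y\<^sup>2) ^ n" for y :: real by (rule power_mult)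
  have "(\<integral>\<^sup>+ y. ennreal (y ^ (2 * n) * exp (- t * y\<^sup>2)) \<partial>hankel_measure \<alpha>) =
      (\<integral>\<^sup>+ y. ennreal c * ennreal (?g y) \<partial>lborel)"
    unfolding hankel_measure_def c_eq
  proof (subst nn_integral_density, measurable, rule nn_integral_cong)
    fix y :: real
    have "indicator {0<..} y * (c * y powr (2 * \<alpha> + 1)) * (y ^ (2 * n) * exp (- t * y\<^sup>2)) =
        c * (?g y)"
    proof (cases "0 < y")
      case True
      have "y powr (2 * \<alpha> + 1) * y ^ (2 * n) = y powr (2 * \<alpha> + 1) * y powr real (2 * n)"
        using True by (simp only: powr_realpow)
      also have "\<dots> = y powr (2 * (\<alpha> + 1 + real n) - 1)"
        by (subst powr_add[symmetric]) (simp add: algebra_simps)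
      finally show ?thesis using True by (simp add: mult_ac)
    qed simp
    moreover have "0 \<le> indicator {0<..} y * (c * y powr (2 * \<alpha> + 1))" using c by simp
    moreover have "0 \<le> y ^ (2 * n) * exp (- t * y\<^sup>2)" unfolding ev by simp
    ultimately show "ennreal (indicator {0<..} y * (c * y powr (2 * \<alpha> + 1))) * ennreal (y ^ (2 * n) * exp (- t * y\<^sup>2)) =
        ennreal c * ennreal (?g y)"
      using c by (simp flip: ennreal_mult)
  qed
  also have "\<dots> = ennreal c * ennreal (Gamma (\<alpha> + 1 + real n) / (2 * t powr (\<alpha> + 1 + real n)))"
    using \<alpha> t by (subst nn_integral_cmult, measurable, subst nn_integral_gaussian_powr) auto
  also have "\<dots> = ennreal (gaussian_moment \<alpha> t n)"
    using c G0 unfolding gaussian_moment_def by (simp add: c_def powr_add mult_ac flip: ennreal_mult)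
  finally show ?thesis
    using G0 by (intro has_bochner_integral_nn_integral) (auto simp: gaussian_moment_def ev)
qed

definition weber_kernel :: "real \<Rightarrow> real \<Rightarrow> real \<Rightarrow> real \<Rightarrow> real" where
  "weber_kernel \<alpha> t x y = Gamma (\<alpha> + 1) / (2 * t) powr (\<alpha> + 1) *
     (exp (- (x\<^sup>2 / (4 * t)) - y\<^sup>2 / (4 * t)) * bessel_I_series \<alpha> (x\<^sup>2 / (4 * t) * (y\<^sup>2 / (4 * t))))"

lemma weber_coeff_uminus: "weber_coeff \<alpha> (- A) (- B) n = (-1) ^ n * weber_coeff \<alpha> A B n"
proof -
  have "(- A) ^ j * (- B) ^ (n - j) = (-1) ^ n * (A ^ j * B ^ (n - j))" if "j \<le> n" for j
  proof -
    have "(- A) ^ j * (- B) ^ (n - j) = ((-1) ^ j * (-1) ^ (n - j)) * (A ^ j * B ^ (n - j))"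
      by (simp only: power_minus[of A] power_minus[of B] mult_ac)
    also have "(-1) ^ j * (-1) ^ (n - j) = ((-1) ^ n :: real)" using that by (simp flip: power_add)
    finally show ?thesis .
  qed
  thus ?thesis unfolding weber_coeff_def sum_distrib_left by (intro sum.cong) auto
qed

lemma bessel_I_series_nonneg:
  assumes "\<alpha> > -1/2" "0 \<le> s"
  shows "0 \<le> bessel_I_series \<alpha> s"
  unfolding bessel_I_series_def
  by (intro suminf_nonneg summable_norm_cancel[OF bessel_I_summable] assms divide_nonneg_nonneg mult_nonneg_nonneg)
     (use assms in \<open>auto intro!: less_imp_le[OF Gamma_real_pos]\<close>)

lemma weber_kernel_nonneg:
  assumes "\<alpha> > -1/2" "0 < t"
  shows "0 \<le> weber_kernel \<alpha> t x y"
  unfolding weber_kernel_def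
  by (intro mult_nonneg_nonneg divide_nonneg_nonneg bessel_I_series_nonneg less_imp_le[OF Gamma_real_pos])
     (use assms in auto)

text \<open>
  The product of the two Bessel series is integrated termwise. The Gaussian moments turn its coefficients
  into \<open>weber_coeff\<close> at \<open>-A\<close> and \<open>-B\<close>.
\<close>

theorem weber_second_exponential_integral:
  assumes \<alpha>: "\<alpha> > -1/2" and t: "0 < t"
  shows "has_bochner_integral (hankel_measure \<alpha>)
    (\<lambda>l. normalized_bessel \<alpha> (x * l) * normalized_bessel \<alpha> (y * l) * exp (- t * l\<^sup>2))
    (weber_kernel \<alpha> t x y)"
proof -
  define A B where "A = x\<^sup>2 / (4 * t)" and "B = y\<^sup>2 / (4 * t)"
  have AB: "0 \<le> A" "0 \<le> B" using t by (auto simp: A_def B_def)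
  define D where "D n = (\<Sum>i\<le>n. bessel_coeff \<alpha> i * x ^ (2 * i) * (bessel_coeff \<alpha> (n - i) * y ^ (2 * (n - i))))" for n
  have D0: "0 \<le> D n" for n
    unfolding D_def power_mult using bessel_coeff_pos[OF \<alpha>]
    by (intro sum_nonneg mult_nonneg_nonneg) (auto intro: less_imp_le)
  define c where "c = Gamma (\<alpha> + 1) / (2 * t) powr (\<alpha> + 1)"
  have G0: "0 < Gamma (\<alpha> + 1)" using \<alpha> by (intro Gamma_real_pos) auto
  \<comment> \<open>The powers of \<open>4\<close> and \<open>t\<close> combine with those of \<open>x\<close> and \<open>y\<close> to powers of \<open>A\<close> and \<open>B\<close>.\<close>
  have D_moment: "D n * gaussian_moment \<alpha> t n = c * weber_coeff \<alpha> A B n" for n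
    unfolding D_def weber_coeff_def sum_distrib_left sum_distrib_right
  proof (rule sum.cong[OF refl])
    fix i assume "i \<in> {..n}"
    hence i: "i \<le> n" by simp
    have p4: "(4::real) ^ n = 4 ^ i * 4 ^ (n - i)" "t ^ n = t ^ i * t ^ (n - i)" using i by (simp_all flip: power_add)
    have tn: "t powr (\<alpha> + 1 + real n) = t powr (\<alpha> + 1) * (t ^ i * t ^ (n - i))"
      unfolding p4(2)[symmetric] using t by (simp add: powr_add powr_realpow)
    have t2: "(2 * t) powr (\<alpha> + 1) = 2 powr (\<alpha> + 1) * t powr (\<alpha> + 1)" using t by (simp add: powr_mult)
    have xi: "A ^ i = x ^ (2 * i) / (4 ^ i * t ^ i)" "B ^ (n - i) = y ^ (2 * (n - i)) / (4 ^ (n - i) * t ^ (n - i))"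
      by (simp_all add: A_def B_def power_divide power_mult_distrib power_mult)
    have alg: "(g / (p * a * u)) * X * ((g / (q * b * v)) * Y) * (w / (z * g * (r * (k * l)))) =
        g / (z * r) * (X / (p * k) * (Y / (q * l)) * w / (a * b * u * v))"
      if "g \<noteq> 0" "p \<noteq> 0" "q \<noteq> 0" "z \<noteq> 0" "r \<noteq> 0" "k \<noteq> 0" "l \<noteq> 0"
      for g p a u X q b v Y w z r k l :: real
      using that by (simp add: divide_simps)
    show "bessel_coeff \<alpha> i * x ^ (2 * i) * (bessel_coeff \<alpha> (n - i) * y ^ (2 * (n - i))) * gaussian_moment \<alpha> t n =
       c * (A ^ i * B ^ (n - i) * Gamma (\<alpha> + 1 + real n) /
         (fact i * fact (n - i) * Gamma (\<alpha> + real i + 1) * Gamma (\<alpha> + real (n - i) + 1)))"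
      unfolding bessel_coeff_def gaussian_moment_def c_def tn t2 xi
      by (rule alg) (use t G0 in auto)
  qed
  define f where "f n l = (-1) ^ n * D n * (l ^ (2 * n) * exp (- t * l\<^sup>2))" for n l
  note mom = hankel_gaussian_moment[OF \<alpha> t]
  have f_int: "integrable (hankel_measure \<alpha>) (f n)" for n
    unfolding f_def using mom[of n] by (simp add: has_bochner_integral_iff)
  have f_integral: "integral\<^sup>L (hankel_measure \<alpha>) (f n) = c * weber_coeff \<alpha> (- A) (- B) n" for n
  proof -
    have "integral\<^sup>L (hankel_measure \<alpha>) (f n) = (-1) ^ n * (D n * gaussian_moment \<alpha> t n)"
      unfolding f_def using mom[of n] by (simp add: has_bochner_integral_iff)
    thus ?thesis by (simp add: D_moment weber_coeff_uminus)
  qed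
  have f_norm: "norm (f n l) = D n * (l ^ (2 * n) * exp (- t * l\<^sup>2))" for n l
    using D0[of n] by (simp add: f_def abs_mult power_abs power_mult)
  have f_sums: "(\<lambda>n. f n l) sums (normalized_bessel \<alpha> (x * l) * normalized_bessel \<alpha> (y * l) * exp (- t * l\<^sup>2))"
    and f_abs: "summable (\<lambda>n. norm (f n l))" for l
  proof -
    define a b where "a k = (-1) ^ k * bessel_coeff \<alpha> k * (x * l) ^ (2 * k)" 
      and "b k = (-1) ^ k * bessel_coeff \<alpha> k * (y * l) ^ (2 * k)" for k
    note a = normalized_bessel_sums[OF \<alpha>, of "x * l", folded a_def]
    note b = normalized_bessel_sums[OF \<alpha>, of "y * l", folded b_def]
    have prod_term: "a i * b (n - i) = (-1) ^ n * l ^ (2 * n) * 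
        (bessel_coeff \<alpha> i * x ^ (2 * i) * (bessel_coeff \<alpha> (n - i) * y ^ (2 * (n - i))))" if "i \<le> n" for i n
    proof -
      have "n = i + (n - i)" "2 * n = 2 * i + 2 * (n - i)" using that by simp_all
      hence "(-1) ^ n = (-1) ^ i * ((-1) ^ (n - i) :: real)" "l ^ (2 * n) = l ^ (2 * i) * l ^ (2 * (n - i))"
        by (metis power_add)+
      thus ?thesis by (simp only: a_def b_def power_mult_distrib mult_ac)
    qed
    have "(\<Sum>i\<le>n. a i * b (n - i)) = (-1) ^ n * l ^ (2 * n) * D n" for n
      unfolding D_def sum_distrib_left using prod_term by (intro sum.cong) auto
    hence f_eq: "f n l = (\<Sum>i\<le>n. a i * b (n - i)) * exp (- t * l\<^sup>2)" for n
      by (simp add: f_def mult_ac)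
    have "(\<lambda>n. \<Sum>i\<le>n. a i * b (n - i)) sums (suminf a * suminf b)"
      by (rule Cauchy_product_sums[OF a(2) b(2)])
    thus "(\<lambda>n. f n l) sums (normalized_bessel \<alpha> (x * l) * normalized_bessel \<alpha> (y * l) * exp (- t * l\<^sup>2))"
      unfolding f_eq using a(1) b(1) by (intro sums_mult2) (simp add: sums_iff)
    have "norm (f n l) = (\<Sum>i\<le>n. norm (a i) * norm (b (n - i))) * exp (- t * l\<^sup>2)" for n
    proof -
      have "(\<Sum>i\<le>n. norm (a i) * norm (b (n - i))) = (\<Sum>i\<le>n. l ^ (2 * n) * 
        (bessel_coeff \<alpha> i * x ^ (2 * i) * (bessel_coeff \<alpha> (n - i) * y ^ (2 * (n - i)))))"
      proof (rule sum.cong[OF refl])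
        fix i assume i: "i \<in> {..n}"
        have "norm (a i) * norm (b (n - i)) = norm (a i * b (n - i))" by (simp add: abs_mult)
        also have "\<dots> = l ^ (2 * n) * (bessel_coeff \<alpha> i * x ^ (2 * i) * (bessel_coeff \<alpha> (n - i) * y ^ (2 * (n - i))))"
          using prod_term[of i n] i bessel_coeff_pos[OF \<alpha>, of i] bessel_coeff_pos[OF \<alpha>, of "n - i"]
          by (simp add: abs_mult power_mult)
        finally show "norm (a i) * norm (b (n - i)) = l ^ (2 * n) * (bessel_coeff \<alpha> i * x ^ (2 * i) * (bessel_coeff \<alpha> (n - i) * y ^ (2 * (n - i))))" .
      qed
      also have "\<dots> = l ^ (2 * n) * D n" by (simp add: D_def sum_distrib_left)
      finally show ?thesis using f_norm[of n l] by (simp add: mult_ac)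
    qed
    moreover have "summable (\<lambda>n. \<Sum>i\<le>n. norm (a i) * norm (b (n - i)))"
      using summable_Cauchy_product[of "\<lambda>i. norm (a i)" "\<lambda>i. norm (b i)"] a(2) b(2) by simp
    ultimately show "summable (\<lambda>n. norm (f n l))" by (simp add: summable_mult2)
  qed
  have integral_summable: "summable (\<lambda>n. \<integral>l. norm (f n l) \<partial>hankel_measure \<alpha>)"
  proof -
    have "(\<integral>l. norm (f n l) \<partial>hankel_measure \<alpha>) = c * weber_coeff \<alpha> A B n" for n
      unfolding f_norm using mom[of n] D_moment[of n] by (simp add: has_bochner_integral_iff)
    thus ?thesis using weber_coeff_sums[OF \<alpha>, of A B] by (simp add: summable_mult sums_summable)
  qed
  have AEs: "AE l in hankel_measure \<alpha>. summable (\<lambda>n. norm (f n l))" using f_abs by simp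
  have "(\<lambda>n. integral\<^sup>L (hankel_measure \<alpha>) (f n)) sums (\<integral>l. (\<Sum>n. f n l) \<partial>hankel_measure \<alpha>)"
    by (rule sums_integral[OF f_int AEs integral_summable])
  moreover have "(\<lambda>n. integral\<^sup>L (hankel_measure \<alpha>) (f n)) sums (c * (exp (- A + - B) * bessel_I_series \<alpha> (- A * - B)))"
    unfolding f_integral by (intro sums_mult weber_coeff_sums \<alpha>)
  ultimately have "(\<integral>l. (\<Sum>n. f n l) \<partial>hankel_measure \<alpha>) = weber_kernel \<alpha> t x y"
    using sums_unique2 by (fastforce simp: weber_kernel_def c_def A_def B_def)
  moreover have "integrable (hankel_measure \<alpha>) (\<lambda>l. \<Sum>n. f n l)"
    by (rule integrable_suminf[OF f_int AEs integral_summable])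
  ultimately show ?thesis
    using f_sums[THEN sums_unique, symmetric] by (simp add: has_bochner_integral_iff)
qed

lemma measurable_weber_kernel [measurable]:
  assumes [measurable]: "f \<in> borel_measurable M" "g \<in> borel_measurable M"
  shows "(\<lambda>z. weber_kernel \<alpha> t (f z) (g z)) \<in> borel_measurable M"
  unfolding weber_kernel_def bessel_I_series_def by measurable

text \<open>
  Termwise integration: the moment of order \<open>m\<close> cancels the Gamma factor in the \<open>m\<close>-th term, and the
  exponential series of \<open>A\<close> remains.
\<close>

lemma weber_kernel_mass:
  assumes \<alpha>: "\<alpha> > -1/2" and t: "0 < t"
  shows "(\<integral>\<^sup>+ y. ennreal (weber_kernel \<alpha> t x y) \<partial>hankel_measure \<alpha>) = 1"
proof -
  define A c t' where "A = x\<^sup>2 / (4 * t)" and "c = Gamma (\<alpha> + 1) / (2 * t) powr (\<alpha> + 1)" and "t' = 1 / (4 * t)"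
  have t': "0 < t'" using t by (simp add: t'_def)
  have G0: "0 < Gamma (\<alpha> + 1)" "0 < Gamma (\<alpha> + real m + 1)" for m using \<alpha> by (auto intro!: Gamma_real_pos)
  define e where "e m = c * exp (- A) * (A ^ m * t' ^ m / (fact m * Gamma (\<alpha> + real m + 1)))" for m
  have A0: "0 \<le> A" and c0: "0 \<le> c" using t G0 by (auto simp: A_def c_def)
  have e0: "0 \<le> e m" for m using A0 c0 t' G0(2)[of m] by (simp add: e_def)
  have ev: "y ^ (2 * n) = (y\<^sup>2) ^ n" for y :: real and n by (rule power_mult)
  have sums: "(\<lambda>m. e m * (y ^ (2 * m) * exp (- t' * y\<^sup>2))) sums weber_kernel \<alpha> t x y" for y
  proof -
    define s where "s = A * (y\<^sup>2 / (4 * t))"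
    have "(\<lambda>m. s ^ m / (fact m * Gamma (\<alpha> + real m + 1))) sums bessel_I_series \<alpha> s"
      using summable_sums[OF summable_norm_cancel[OF bessel_I_summable[OF \<alpha>]]] by (simp add: bessel_I_series_def)
    hence "(\<lambda>m. c * exp (- A) * exp (- t' * y\<^sup>2) * (s ^ m / (fact m * Gamma (\<alpha> + real m + 1)))) sums
        (c * exp (- A) * exp (- t' * y\<^sup>2) * bessel_I_series \<alpha> s)"
      by (rule sums_mult)
    moreover have "c * exp (- A) * exp (- t' * y\<^sup>2) * bessel_I_series \<alpha> s = weber_kernel \<alpha> t x y"
      by (simp add: weber_kernel_def c_def s_def A_def t'_def exp_diff exp_minus field_simps)
    moreover have "s ^ m = A ^ m * t' ^ m * y ^ (2 * m)" for m
      by (simp add: s_def t'_def power_mult_distrib power_divide power_mult)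
    ultimately show ?thesis by (simp add: e_def mult_ac)
  qed
  have "(\<integral>\<^sup>+ y. ennreal (weber_kernel \<alpha> t x y) \<partial>hankel_measure \<alpha>) =
      (\<integral>\<^sup>+ y. (\<Sum>m. ennreal (e m * (y ^ (2 * m) * exp (- t' * y\<^sup>2)))) \<partial>hankel_measure \<alpha>)"
    using sums e0 by (intro nn_integral_cong) (simp add: suminf_ennreal2 sums_iff ev)
  also have "\<dots> = (\<Sum>m. \<integral>\<^sup>+ y. ennreal (e m * (y ^ (2 * m) * exp (- t' * y\<^sup>2))) \<partial>hankel_measure \<alpha>)"
    by (rule nn_integral_suminf) measurable
  also have "\<dots> = (\<Sum>m. ennreal (exp (- A) * (A ^ m / fact m)))"
  proof (rule suminf_cong)
    fix m
    have "(\<integral>\<^sup>+ y. ennreal (e m * (y ^ (2 * m) * exp (- t' * y\<^sup>2))) \<partial>hankel_measure \<alpha>) = ennreal (e m * gaussian_moment \<alpha> t' m)"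
      using hankel_gaussian_moment[OF \<alpha> t', of m] e0[of m]
      by (subst nn_integral_eq_integral) (auto simp: has_bochner_integral_iff ev)
    also have "e m * gaussian_moment \<alpha> t' m = exp (- A) * (A ^ m / fact m)"
    proof -
      have shift: "\<alpha> + 1 + real m = \<alpha> + real m + 1" by simp
      have t'_powr: "t' powr (\<alpha> + real m + 1) = t' powr (\<alpha> + 1) * t' ^ m"
        using t' by (simp add: powr_realpow[symmetric] powr_add[symmetric] algebra_simps)
      have unit: "(2 * t) powr (\<alpha> + 1) * (2 powr (\<alpha> + 1) * t' powr (\<alpha> + 1)) = 1"
        using t t' by (simp add: t'_def flip: powr_mult)
      have cancel: "g / u * E * (a * k / (d * h)) * (h / (v * g * (w * k))) = E * (a / d)"
        if "u * (v * w) = 1" "g \<noteq> 0" "h \<noteq> 0" "k \<noteq> 0" for g u E a k d h v w :: real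
      proof -
        have "g / u * E * (a * k / (d * h)) * (h / (v * g * (w * k))) = E * (a / d) / (u * (v * w))"
          using that(2-4) by simp
        thus ?thesis using that(1) by simp
      qed
      show ?thesis
        unfolding e_def gaussian_moment_def c_def shift t'_powr
        by (rule cancel[OF unit]) (use G0(1) G0(2)[of m] t' in auto)
    qed
    finally show "(\<integral>\<^sup>+ y. ennreal (e m * (y ^ (2 * m) * exp (- t' * y\<^sup>2))) \<partial>hankel_measure \<alpha>) = ennreal (exp (- A) * (A ^ m / fact m))" .
  qed
  also have "\<dots> = 1"
  proof -
    have "(\<lambda>m. exp (- A) * (A ^ m / fact m)) sums (exp (- A) * exp A)"
      using exp_converges[of A] by (intro sums_mult) (simp add: divide_inverse mult.commute)
    thus ?thesis using A0 by (simp add: suminf_ennreal2 sums_iff exp_minus)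
  qed
  finally show ?thesis .
qed

section \<open>Fourier transform of the Gaussian\<close>

text \<open>
  The characteristic function of the standard normal distribution, rescaled by \<open>c = sqrt (2 t)\<close>.
\<close>

lemma gaussian_fourier_real:
  fixes z t :: real
  assumes t: "0 < t"
  shows "has_bochner_integral lborel (\<lambda>u. exp (- \<i> * of_real (z * u)) * of_real (exp (- t * u\<^sup>2)))
    (of_real (sqrt (pi / t) * exp (- z\<^sup>2 / (4 * t))))"
proof -
  define c s where "c = sqrt (2 * t)" and "s = - z / sqrt (2 * t)"
  have c: "0 < c" using t by (simp add: c_def)
  have "integrable lborel (\<lambda>x. std_normal_density x *\<^sub>R iexp (s * x))"
    by (rule Bochner_Integration.integrable_bound[OF integrable_std_normal_moment_abs[of 0]]) auto
  moreover have "(\<integral>x. std_normal_density x *\<^sub>R iexp (s * x) \<partial>lborel) = of_real (exp (- s\<^sup>2 / 2))"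
    using fun_cong[OF char_std_normal_distribution, of s]
    unfolding char_def by (subst (asm) integral_density) auto
  ultimately have "has_bochner_integral lborel (\<lambda>x. std_normal_density x *\<^sub>R iexp (s * x)) (of_real (exp (- s\<^sup>2 / 2)) :: complex)"
    by (simp add: has_bochner_integral_iff)
  hence "has_bochner_integral lborel (\<lambda>u. std_normal_density (0 + c * u) *\<^sub>R iexp (s * (0 + c * u)))
      (of_real (exp (- s\<^sup>2 / 2)) /\<^sub>R \<bar>c\<bar> :: complex)"
    using c by (subst (asm) lborel_has_bochner_integral_real_affine_iff[of c _ _ 0]) auto
  hence "has_bochner_integral lborel
      (\<lambda>u. of_real (sqrt (2 * pi)) * (std_normal_density (0 + c * u) *\<^sub>R iexp (s * (0 + c * u))))
      (of_real (sqrt (2 * pi)) * (of_real (exp (- s\<^sup>2 / 2)) /\<^sub>R \<bar>c\<bar>) :: complex)"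
    by (rule has_bochner_integral_mult_right)
  moreover have "of_real (sqrt (2 * pi)) * (std_normal_density (0 + c * u) *\<^sub>R iexp (s * (0 + c * u))) =
      exp (- \<i> * of_real (z * u)) * of_real (exp (- t * u\<^sup>2))" for u
  proof -
    have "sqrt (2 * pi) * std_normal_density (0 + c * u) = exp (- t * u\<^sup>2)"
      using t by (simp add: std_normal_density_def c_def power_mult_distrib)
    moreover have "s * (0 + c * u) = - (z * u)" using c by (simp add: s_def flip: c_def)
    moreover have "of_real a * (b *\<^sub>R E) = of_real (a * b) * E" for a b and E :: complex
      by (simp add: scaleR_conv_of_real)
    ultimately have "of_real (sqrt (2 * pi)) * (std_normal_density (0 + c * u) *\<^sub>R iexp (s * (0 + c * u))) =
        of_real (exp (- t * u\<^sup>2)) * iexp (- (z * u))"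
      by (simp only:)
    thus ?thesis by (simp add: mult.commute)
  qed
  moreover have "of_real (sqrt (2 * pi)) * (of_real (exp (- s\<^sup>2 / 2)) /\<^sub>R \<bar>c\<bar>) =
      (of_real (sqrt (pi / t) * exp (- z\<^sup>2 / (4 * t))) :: complex)"
  proof -
    have "sqrt (2 * pi) / c = sqrt (pi / t)" using t by (simp add: c_def flip: real_sqrt_divide)
    moreover have "- s\<^sup>2 / 2 = - z\<^sup>2 / (4 * t)" using t by (simp add: s_def power_divide)
    ultimately have "sqrt (2 * pi) * (exp (- s\<^sup>2 / 2) / c) = sqrt (pi / t) * exp (- z\<^sup>2 / (4 * t))"
      by (metis times_divide_eq_left times_divide_eq_right)
    moreover have "of_real a * (of_real b /\<^sub>R \<bar>c\<bar>) = (of_real (a * (b / c)) :: complex)" for a b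
      using c by (simp add: scaleR_conv_of_real divide_inverse)
    ultimately show ?thesis by (simp only:)
  qed
  ultimately show ?thesis by (simp only:)
qed

lemma gaussian_fourier:
  fixes z :: "'a::euclidean_space" and t :: real
  assumes t: "0 < t"
  shows "has_bochner_integral lborel (\<lambda>l. exp (- \<i> * of_real (z \<bullet> l)) * of_real (exp (- t * (norm l)\<^sup>2)))
    (of_real ((pi / t) powr (real DIM('a) / 2) * exp (- (norm z)\<^sup>2 / (4 * t))))"
proof -
  let ?v = "of_real ((pi / t) powr (real DIM('a) / 2) * exp (- (norm z)\<^sup>2 / (4 * t))) :: complex"
  interpret product_sigma_finite "\<lambda>_::'a. lborel :: real measure" by standard
  define h where "h b u = exp (- \<i> * of_real ((z \<bullet> b) * u)) * of_real (exp (- t * u\<^sup>2))" for b :: 'a and u :: real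
  have h: "has_bochner_integral lborel (h b) (of_real (sqrt (pi / t) * exp (- (z \<bullet> b)\<^sup>2 / (4 * t))))" for b
    unfolding h_def by (rule gaussian_fourier_real[OF t])
  have [measurable]: "h b \<in> borel_measurable borel" for b using h[of b] by auto
  have norm_sq: "(norm v)\<^sup>2 = (\<Sum>b\<in>Basis. (v \<bullet> b)\<^sup>2)" for v :: 'a
    unfolding power2_norm_eq_inner by (subst euclidean_inner) (simp add: power2_eq_square)
  have split: "exp (- \<i> * of_real (z \<bullet> l)) * of_real (exp (- t * (norm l)\<^sup>2)) = (\<Prod>b\<in>Basis. h b (l \<bullet> b))" for l
  proof -
    have "exp (- \<i> * of_real (z \<bullet> l)) = exp (\<Sum>b\<in>Basis. - \<i> * of_real ((z \<bullet> b) * (l \<bullet> b)))"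
      unfolding euclidean_inner[of z l] by (simp add: sum_distrib_left)
    moreover have "exp (- t * (norm l)\<^sup>2) = exp (\<Sum>b\<in>Basis. - t * (l \<bullet> b)\<^sup>2)"
      unfolding norm_sq by (simp add: sum_distrib_left)
    ultimately show ?thesis by (simp add: h_def exp_sum prod.distrib)
  qed
  have int: "integrable (\<Pi>\<^sub>M b\<in>Basis. lborel) (\<lambda>f. \<Prod>b\<in>Basis. h b (f b))"
    using h by (intro product_integrable_prod) (auto simp: has_bochner_integral_iff)
  have "(\<integral>f. (\<Prod>b\<in>Basis. h b (f b)) \<partial>(\<Pi>\<^sub>M b\<in>Basis. lborel)) = (\<Prod>b\<in>Basis. integral\<^sup>L lborel (h b))"
    using h by (intro product_integral_prod) (auto simp: has_bochner_integral_iff)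
  also have "\<dots> = (\<Prod>b\<in>Basis. of_real (sqrt (pi / t) * exp (- (z \<bullet> b)\<^sup>2 / (4 * t))))"
    using h by (simp add: has_bochner_integral_iff)
  also have "\<dots> = of_real (sqrt (pi / t) ^ DIM('a) * (\<Prod>b\<in>Basis. exp (- (z \<bullet> b)\<^sup>2 / (4 * t))))"
    by (simp add: prod.distrib)
  also have "(\<Prod>b\<in>Basis. exp (- (z \<bullet> b)\<^sup>2 / (4 * t))) = exp (- (norm z)\<^sup>2 / (4 * t))"
    unfolding norm_sq by (simp add: exp_sum[symmetric] sum_negf sum_divide_distrib)
  also have "sqrt (pi / t) ^ DIM('a) = (pi / t) powr (real DIM('a) / 2)"
    using t by (simp add: powr_half_sqrt[symmetric] powr_power)
  finally have val: "(\<integral>f. (\<Prod>b\<in>Basis. h b (f b)) \<partial>(\<Pi>\<^sub>M b\<in>Basis. lborel)) =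
      ?v" .
  have coord: "(\<Prod>b\<in>Basis. h b ((\<Sum>b\<in>Basis. f b *\<^sub>R b) \<bullet> b)) = (\<Prod>b\<in>Basis. h b (f b))" for f :: "'a \<Rightarrow> real"
    by (intro prod.cong) auto
  define H where "H l = (\<Prod>b\<in>Basis. h b (l \<bullet> b))" for l
  have [measurable]: "H \<in> borel_measurable borel" unfolding H_def by measurable
  have D: "(\<lambda>f. \<Sum>b\<in>Basis. f b *\<^sub>R b) \<in> (\<Pi>\<^sub>M b\<in>Basis. lborel) \<rightarrow>\<^sub>M (borel :: 'a measure)"
    by measurable
  have "integrable (distr (\<Pi>\<^sub>M b\<in>Basis. lborel) borel (\<lambda>f. \<Sum>b\<in>Basis. f b *\<^sub>R b)) H"
    by (subst integrable_distr_eq[OF D]) (simp, simp only: H_def coord int)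
  moreover have "integral\<^sup>L (distr (\<Pi>\<^sub>M b\<in>Basis. lborel) borel (\<lambda>f. \<Sum>b\<in>Basis. f b *\<^sub>R b)) H =
      ?v"
    by (subst integral_distr[OF D]) (simp, simp only: H_def coord val)
  ultimately have "has_bochner_integral lborel H (?v)"
    unfolding lborel_eq[symmetric] has_bochner_integral_iff by blast
  thus ?thesis unfolding split H_def .
qed

lemma gaussian_mass:
  fixes x :: "'a::euclidean_space" and s :: real
  assumes s: "0 < s"
  shows "(\<integral>\<^sup>+ y. ennreal (exp (- s * (norm (x - y))\<^sup>2)) \<partial>lborel) = ennreal ((pi / s) powr (real DIM('a) / 2))"
proof -
  have "has_bochner_integral lborel (\<lambda>l::'a. complex_of_real (exp (- s * (norm l)\<^sup>2))) (of_real ((pi / s) powr (real DIM('a) / 2)))"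
    using gaussian_fourier[OF s, of "0::'a"] by simp
  hence G: "has_bochner_integral lborel (\<lambda>l::'a. exp (- s * (norm l)\<^sup>2)) ((pi / s) powr (real DIM('a) / 2))"
    unfolding has_bochner_integral_iff complex_of_real_integrable_eq integral_complex_of_real of_real_eq_iff .
  have "(\<integral>\<^sup>+ y. ennreal (exp (- s * (norm (x - y))\<^sup>2)) \<partial>lborel) =
      (\<integral>\<^sup>+ y. ennreal (exp (- s * (norm (- x + y))\<^sup>2)) \<partial>lborel)"
    by (simp add: norm_minus_commute)
  also have "\<dots> = (\<integral>\<^sup>+ y. ennreal (exp (- s * (norm y)\<^sup>2)) \<partial>distr lborel borel ((+) (- x)))"
    by (subst nn_integral_distr) auto
  also have "\<dots> = (\<integral>\<^sup>+ y. ennreal (exp (- s * (norm y)\<^sup>2)) \<partial>(lborel :: 'a measure))"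
    by (simp only: lborel_distr_plus)
  also have "\<dots> = ennreal ((pi / s) powr (real DIM('a) / 2))"
    using G by (subst nn_integral_eq_integral) (auto simp: has_bochner_integral_iff)
  finally show ?thesis .
qed

section \<open>The Weinstein measure as a product\<close>

text \<open>
  The factor of the Weinstein measure in the first \<open>d\<close> variables.
\<close>

definition fourier_measure :: "(real ^ 'd) measure" where
  "fourier_measure = density lborel (\<lambda>_. ennreal (1 / (2 * pi) powr (real CARD('d) / 2)))"

lemma sets_fourier_measure [simp, measurable_cong]: "sets fourier_measure = sets borel"
  by (simp add: fourier_measure_def)

lemma space_fourier_measure [simp]: "space fourier_measure = UNIV"
  by (simp add: fourier_measure_def)

lemma sigma_finite_fourier_measure: "sigma_finite_measure fourier_measure"
  unfolding fourier_measure_def 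
  by (subst sigma_finite_measure.sigma_finite_iff_density_finite[OF sigma_finite_lborel]) auto

lemma sigma_finite_hankel_measure: "sigma_finite_measure (hankel_measure \<alpha>)"
  unfolding hankel_measure_def 
  by (subst sigma_finite_measure.sigma_finite_iff_density_finite[OF sigma_finite_lborel]) auto

lemma upper_halfspace_borel [measurable]: "upper_halfspace \<in> sets borel"
  unfolding upper_halfspace_def by (intro borel_open open_Times) auto

lemma space_weinstein_measure: "space (weinstein_measure \<alpha>) = upper_halfspace"
  by (simp add: weinstein_measure_def space_restrict_space)

lemma borel_measurable_lebesgue_on:
  assumes "f \<in> borel_measurable borel"
  shows "f \<in> borel_measurable (lebesgue_on S)"
  using measurable_comp[OF id_borel_measurable_lebesgue_on assms] by simp

lemma borel_measurable_weinstein: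
  assumes "f \<in> borel_measurable borel"
  shows "f \<in> borel_measurable (weinstein_measure \<alpha>)"
  using borel_measurable_lebesgue_on[OF assms] by (simp add: weinstein_measure_def)

lemma borel_measurable_fst_snd [measurable]:
  "(fst :: 'a::topological_space \<times> 'b::topological_space \<Rightarrow> 'a) \<in> borel_measurable borel"
  "(snd :: 'a \<times> 'b \<Rightarrow> 'b) \<in> borel_measurable borel"
  by (intro borel_measurable_continuous_onI continuous_intros)+

lemma sigma_finite_weinstein_measure:
  "sigma_finite_measure (weinstein_measure \<alpha> :: ((real ^ 'd) \<times> real) measure)"
proof -
  have "sigma_finite_measure (lebesgue :: ((real ^ 'd) \<times> real) measure)"
  proof
    obtain A :: "((real ^ 'd) \<times> real) set set" where A: "countable A" "A \<subseteq> sets lborel" "\<Union> A = space lborel"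
        "\<forall>a\<in>A. emeasure lborel a \<noteq> \<infinity>"
      using lborel.sigma_finite_countable by blast
    thus "\<exists>A::((real ^ 'd) \<times> real) set set. countable A \<and> A \<subseteq> sets lebesgue \<and> \<Union> A = space lebesgue \<and>
        (\<forall>a\<in>A. emeasure lebesgue a \<noteq> \<infinity>)"
      by (intro exI[of _ A]) auto
  qed
  hence "sigma_finite_measure (lebesgue_on upper_halfspace :: ((real ^ 'd) \<times> real) measure)"
    by (rule sigma_finite_measure_restrict_space) simp
  then interpret sigma_finite_measure "lebesgue_on upper_halfspace :: ((real ^ 'd) \<times> real) measure" .
  show ?thesis
    unfolding weinstein_measure_def
    by (subst sigma_finite_iff_density_finite) (auto intro!: borel_measurable_lebesgue_on)
qed

text \<open>
  The Weinstein measure is defined on Lebesgue sets of the half-space. Its image on the Borel sets of the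
  whole space is a product measure, so that integrals of Borel functions can be computed by Fubini.
\<close>

lemma distr_weinstein_measure:
  assumes \<alpha>: "\<alpha> > -1/2"
  shows "distr (weinstein_measure \<alpha>) borel (\<lambda>x. x) =
    (fourier_measure \<Otimes>\<^sub>M hankel_measure \<alpha> :: ((real ^ 'd) \<times> real) measure)"
proof (rule measure_eqI)
  have sets: "sets (fourier_measure \<Otimes>\<^sub>M hankel_measure \<alpha> :: ((real ^ 'd) \<times> real) measure) = sets borel"
    unfolding borel_prod[symmetric] by (intro sets_pair_measure_cong) simp_all
  thus "sets (distr (weinstein_measure \<alpha>) borel (\<lambda>x. x)) = 
      sets (fourier_measure \<Otimes>\<^sub>M hankel_measure \<alpha> :: ((real ^ 'd) \<times> real) measure)" by simp
  define c where "c = 1 / (2 * pi) powr (real CARD('d) / 2)"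
  define w where "w y = y powr (2 * \<alpha> + 1) / (2 powr \<alpha> * Gamma (\<alpha> + 1))" for y
  have c0: "0 \<le> c" by (simp add: c_def)
  have [measurable]: "w \<in> borel_measurable borel" unfolding w_def by measurable
  fix A assume "A \<in> sets (distr (weinstein_measure \<alpha>) borel (\<lambda>x. x) :: ((real ^ 'd) \<times> real) measure)"
  hence A [measurable]: "A \<in> sets borel" by simp
  have A': "A \<in> sets lborel" by simp
  have W: "weinstein_measure \<alpha> = density (lebesgue_on upper_halfspace) (\<lambda>x::(real ^ 'd) \<times> real. ennreal (c * w (snd x)))"
    unfolding weinstein_measure_def by (intro arg_cong2[where f = density] refl ext) (simp add: c_def w_def mult.assoc)
  have "emeasure (distr (weinstein_measure \<alpha>) borel (\<lambda>x. x)) A = emeasure (weinstein_measure \<alpha>) (A \<inter> upper_halfspace)"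
    by (subst emeasure_distr) (auto simp: space_weinstein_measure borel_measurable_weinstein Int_commute intro!: arg_cong2[where f = emeasure])
  also have "\<dots> = (\<integral>\<^sup>+ x. ennreal (c * w (snd x)) * indicator (A \<inter> upper_halfspace) x \<partial>lebesgue_on upper_halfspace)"
    unfolding W by (rule emeasure_density)
      (auto intro!: borel_measurable_lebesgue_on simp: sets_restrict_space_iff)
  also have "\<dots> = (\<integral>\<^sup>+ x. ennreal (c * w (snd x)) * indicator (A \<inter> upper_halfspace) x * indicator upper_halfspace x \<partial>lebesgue)"
    by (subst nn_integral_restrict_space) auto
  also have "\<dots> = (\<integral>\<^sup>+ x. ennreal (c * w (snd x)) * indicator (A \<inter> upper_halfspace) x \<partial>lebesgue)"
    by (intro nn_integral_cong) (auto simp: indicator_def)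
  also have "\<dots> = (\<integral>\<^sup>+ x. ennreal (c * w (snd x)) * indicator (A \<inter> upper_halfspace) x \<partial>lborel)"
    by (rule nn_integral_completion)
  also have "\<dots> = (\<integral>\<^sup>+ x. (\<lambda>(a, b). ennreal c * ennreal (indicator {0<..} b * w b)) x * indicator A x \<partial>lborel)"
    using c0 by (intro nn_integral_cong) (auto simp: indicator_def upper_halfspace_def ennreal_mult')
  also have "\<dots> = emeasure (density lborel (\<lambda>(a, b). ennreal c * ennreal (indicator {0<..} b * w b))) A"
    by (subst emeasure_density) auto
  also have "density lborel (\<lambda>(a, b). ennreal c * ennreal (indicator {0<..} b * w b)) =
      (fourier_measure \<Otimes>\<^sub>M hankel_measure \<alpha> :: ((real ^ 'd) \<times> real) measure)"
    unfolding fourier_measure_def hankel_measure_def lborel_prod[symmetric] c_def[symmetric] w_def[symmetric]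
    using sigma_finite_hankel_measure[of \<alpha>]
    by (intro pair_measure_density[symmetric]) (auto simp: hankel_measure_def w_def intro: sigma_finite_lborel)
  finally show "emeasure (distr (weinstein_measure \<alpha>) borel (\<lambda>x. x)) A =
      emeasure (fourier_measure \<Otimes>\<^sub>M hankel_measure \<alpha>) A" .
qed

lemma (in pair_sigma_finite) has_bochner_integral_prod_mult:
  fixes f :: "'a \<Rightarrow> complex" and g :: "'b \<Rightarrow> complex"
  assumes f: "has_bochner_integral M1 f a" and g: "has_bochner_integral M2 g b"
  shows "has_bochner_integral (M1 \<Otimes>\<^sub>M M2) (\<lambda>p. f (fst p) * g (snd p)) (a * b)"
proof -
  have fi: "integrable M1 f" "integral\<^sup>L M1 f = a" and gi: "integrable M2 g" "integral\<^sup>L M2 g = b"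
    using f g by (auto simp: has_bochner_integral_iff)
  have [measurable]: "f \<in> borel_measurable M1" "g \<in> borel_measurable M2" using fi gi by auto
  have int: "integrable (M1 \<Otimes>\<^sub>M M2) (\<lambda>p. f (fst p) * g (snd p))"
  proof (rule Fubini_integrable)
    have "(\<integral>y. norm (f (fst (x, y)) * g (snd (x, y))) \<partial>M2) = norm (f x) * (\<integral>y. norm (g y) \<partial>M2)" for x
      by (simp add: norm_mult)
    thus "integrable M1 (\<lambda>x. \<integral>y. norm (f (fst (x, y)) * g (snd (x, y))) \<partial>M2)"
      using fi by simp
  qed (use gi in auto)
  hence int': "integrable (M1 \<Otimes>\<^sub>M M2) (\<lambda>(x, y). f x * g y)" by (simp add: case_prod_unfold)
  have "(\<integral>p. (case p of (x, y) \<Rightarrow> f x * g y) \<partial>(M1 \<Otimes>\<^sub>M M2)) = (\<integral>x. (\<integral>y. f x * g y \<partial>M2) \<partial>M1)"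
    using integral_fst[OF int'] by simp
  also have "\<dots> = a * b" using fi gi by simp
  finally show ?thesis using int by (simp add: has_bochner_integral_iff case_prod_unfold)
qed

section \<open>The Weinstein heat kernel\<close>

text \<open>
  The heat kernel of the Weinstein operator at time \<open>t\<close>: a Gaussian in the first \<open>d\<close> variables times the
  heat kernel of the Bessel operator in the last one.
\<close>

definition weinstein_heat_kernel :: "real \<Rightarrow> real \<Rightarrow> (real ^ 'd) \<times> real \<Rightarrow> (real ^ 'd) \<times> real \<Rightarrow> real" where
  "weinstein_heat_kernel \<alpha> t x y =
     (pi / t) powr (real CARD('d) / 2) / (2 * pi) powr (real CARD('d) / 2) *
       exp (- (norm (fst x - fst y))\<^sup>2 / (4 * t)) * weber_kernel \<alpha> t (snd x) (snd y)"

lemma weinstein_heat_kernel_nonneg: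
  assumes "\<alpha> > -1/2" "0 < t"
  shows "0 \<le> weinstein_heat_kernel \<alpha> t x y"
  unfolding weinstein_heat_kernel_def using weber_kernel_nonneg[OF assms] by simp

lemma weber_kernel_commute: "weber_kernel \<alpha> t x y = weber_kernel \<alpha> t y x"
proof -
  have "- (x\<^sup>2 / (4 * t)) - y\<^sup>2 / (4 * t) = - (y\<^sup>2 / (4 * t)) - x\<^sup>2 / (4 * t)" by simp
  thus ?thesis
    unfolding weber_kernel_def by (simp only: mult.commute[of "x\<^sup>2 / (4 * t)" "y\<^sup>2 / (4 * t)"])
qed

lemma weinstein_heat_kernel_commute: "weinstein_heat_kernel \<alpha> t x y = weinstein_heat_kernel \<alpha> t y x"
  unfolding weinstein_heat_kernel_def
  by (simp only: weber_kernel_commute[of \<alpha> t "snd x" "snd y"] norm_minus_commute[of "fst x" "fst y"])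

lemma measurable_weinstein_heat_kernel [measurable]:
  assumes [measurable]: "f \<in> borel_measurable M" "g \<in> borel_measurable M"
  shows "(\<lambda>z. weinstein_heat_kernel \<alpha> t (f z) (g z :: (real ^ 'd) \<times> real)) \<in> borel_measurable M"
proof -
  have [measurable]: "(\<lambda>z. fst (f z)) \<in> borel_measurable M" "(\<lambda>z. snd (f z)) \<in> borel_measurable M"
    "(\<lambda>z. fst (g z)) \<in> borel_measurable M" "(\<lambda>z. snd (g z)) \<in> borel_measurable M"
    by measurable
  show ?thesis unfolding weinstein_heat_kernel_def by measurable
qed

definition gaussian_weight :: "real \<Rightarrow> (real ^ 'd) \<times> real \<Rightarrow> real" where
  "gaussian_weight t l = exp (- t * (norm (fst l))\<^sup>2) * exp (- t * (snd l)\<^sup>2)"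

lemma norm_weinstein_kernel_le:
  assumes "\<alpha> > -1/2"
  shows "norm (weinstein_kernel \<alpha> x l) \<le> 1"
  unfolding weinstein_kernel_def using abs_normalized_bessel_le_1[OF assms] by (simp add: norm_mult)

lemma measurable_weinstein_kernel [measurable]:
  assumes [measurable]: "f \<in> borel_measurable M" "g \<in> borel_measurable M"
  shows "(\<lambda>z. weinstein_kernel \<alpha> (f z) (g z :: (real ^ 'd) \<times> real)) \<in> borel_measurable M"
proof -
  have [measurable]: "(\<lambda>z. fst (f z)) \<in> borel_measurable M" "(\<lambda>z. snd (f z)) \<in> borel_measurable M"
    "(\<lambda>z. fst (g z)) \<in> borel_measurable M" "(\<lambda>z. snd (g z)) \<in> borel_measurable M"
    by measurable
  show ?thesis unfolding weinstein_kernel_def by measurable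
qed

lemma has_bochner_integral_weinstein:
  fixes f :: "(real ^ 'd) \<times> real \<Rightarrow> 'b::{banach, second_countable_topology}"
  assumes "\<alpha> > -1/2" and [measurable]: "f \<in> borel_measurable borel"
    and "has_bochner_integral (fourier_measure \<Otimes>\<^sub>M hankel_measure \<alpha>) f a"
  shows "has_bochner_integral (weinstein_measure \<alpha>) f a"
proof -
  have id: "(\<lambda>x. x) \<in> weinstein_measure \<alpha> \<rightarrow>\<^sub>M borel" by (intro borel_measurable_weinstein) simp
  show ?thesis
    using assms(3) unfolding distr_weinstein_measure[OF assms(1), symmetric] has_bochner_integral_iff
    by (simp add: integrable_distr_eq[OF id] integral_distr[OF id])
qed

lemma nn_integral_weinstein:
  fixes f :: "(real ^ 'd) \<times> real \<Rightarrow> ennreal"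
  assumes "\<alpha> > -1/2" and [measurable]: "f \<in> borel_measurable borel"
  shows "(\<integral>\<^sup>+ x. f x \<partial>weinstein_measure \<alpha>) = (\<integral>\<^sup>+ x. f x \<partial>(fourier_measure \<Otimes>\<^sub>M hankel_measure \<alpha>))"
proof -
  have id: "(\<lambda>x. x) \<in> weinstein_measure \<alpha> \<rightarrow>\<^sub>M borel" by (intro borel_measurable_weinstein) simp
  show ?thesis
    unfolding distr_weinstein_measure[OF assms(1), symmetric] by (simp add: nn_integral_distr[OF id])
qed

text \<open>
  The integrand factors over the two groups of variables; the factors are the Fourier transform of a
  Gaussian and Weber's integral.
\<close>

lemma weinstein_kernel_gaussian_product:
  fixes x y :: "(real ^ 'd) \<times> real"
  assumes \<alpha>: "\<alpha> > -1/2" and t: "0 < t"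
  shows "has_bochner_integral (weinstein_measure \<alpha>)
    (\<lambda>l. weinstein_kernel \<alpha> x l * cnj (weinstein_kernel \<alpha> y l) * of_real (gaussian_weight t l))
    (of_real (weinstein_heat_kernel \<alpha> t x y))"
proof (rule has_bochner_integral_weinstein[OF \<alpha>])
  interpret F: sigma_finite_measure "fourier_measure :: (real ^ 'd) measure" by (rule sigma_finite_fourier_measure)
  interpret H: sigma_finite_measure "hankel_measure \<alpha>" by (rule sigma_finite_hankel_measure)
  interpret pair_sigma_finite "fourier_measure :: (real ^ 'd) measure" "hankel_measure \<alpha>" ..
  define c where "c = 1 / (2 * pi) powr (real CARD('d) / 2)"
  define z where "z = fst x - fst y"
  define f where "f l = exp (- \<i> * of_real (z \<bullet> l)) * of_real (exp (- t * (norm l)\<^sup>2))" for l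
  define g where "g l = normalized_bessel \<alpha> (snd x * l) * normalized_bessel \<alpha> (snd y * l) * exp (- t * l\<^sup>2)" for l
  have f: "has_bochner_integral lborel f (of_real ((pi / t) powr (real CARD('d) / 2) * exp (- (norm z)\<^sup>2 / (4 * t))))"
    using gaussian_fourier[OF t, of z] by (simp add: f_def[abs_def])
  have [measurable]: "f \<in> borel_measurable borel" using f by auto
  have f': "has_bochner_integral fourier_measure f (of_real c * of_real ((pi / t) powr (real CARD('d) / 2) * exp (- (norm z)\<^sup>2 / (4 * t))))"
    unfolding fourier_measure_def c_def[symmetric]
    using f by (simp add: has_bochner_integral_iff integrable_density integral_density c_def scaleR_conv_of_real)
  have g: "has_bochner_integral (hankel_measure \<alpha>) (\<lambda>l. of_real (g l) :: complex) (of_real (weber_kernel \<alpha> t (snd x) (snd y)))"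
    unfolding g_def by (intro has_bochner_integral_of_real weber_second_exponential_integral \<alpha> t)
  have "weinstein_kernel \<alpha> x l * cnj (weinstein_kernel \<alpha> y l) * of_real (gaussian_weight t l) = f (fst l) * of_real (g (snd l))" for l
  proof -
    have "exp (- \<i> * of_real (fst l \<bullet> fst x)) * cnj (exp (- \<i> * of_real (fst l \<bullet> fst y))) = exp (- \<i> * of_real (z \<bullet> fst l))"
      by (simp add: exp_cnj exp_add[symmetric] z_def inner_diff_left inner_commute algebra_simps)
    hence "f (fst l) = exp (- \<i> * of_real (fst l \<bullet> fst x)) * cnj (exp (- \<i> * of_real (fst l \<bullet> fst y))) * of_real (exp (- t * (norm (fst l))\<^sup>2))"
      by (simp add: f_def)
    thus ?thesis
      by (simp add: weinstein_kernel_def gaussian_weight_def g_def mult_ac)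
  qed
  moreover have "of_real c * of_real ((pi / t) powr (real CARD('d) / 2) * exp (- (norm z)\<^sup>2 / (4 * t))) * of_real (weber_kernel \<alpha> t (snd x) (snd y))
      = (of_real (weinstein_heat_kernel \<alpha> t x y) :: complex)"
    by (simp add: weinstein_heat_kernel_def c_def z_def)
  ultimately show "has_bochner_integral (fourier_measure \<Otimes>\<^sub>M hankel_measure \<alpha>)
    (\<lambda>l. weinstein_kernel \<alpha> x l * cnj (weinstein_kernel \<alpha> y l) * of_real (gaussian_weight t l))
    (of_real (weinstein_heat_kernel \<alpha> t x y))"
    using has_bochner_integral_prod_mult[OF f' g] by simp
  have [measurable]: "cnj \<in> borel_measurable borel"
    by (intro borel_measurable_continuous_onI continuous_intros)
  show "(\<lambda>l. weinstein_kernel \<alpha> x l * cnj (weinstein_kernel \<alpha> y l) * of_real (gaussian_weight t l)) \<in> borel_measurable borel"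
    unfolding gaussian_weight_def by measurable
qed

lemma weinstein_heat_kernel_mass:
  fixes x :: "(real ^ 'd) \<times> real"
  assumes \<alpha>: "\<alpha> > -1/2" and t: "0 < t"
  shows "(\<integral>\<^sup>+ y. ennreal (weinstein_heat_kernel \<alpha> t x y) \<partial>weinstein_measure \<alpha>) = 1"
proof -
  interpret H: sigma_finite_measure "hankel_measure \<alpha>" by (rule sigma_finite_hankel_measure)
  define c where "c = (pi / t) powr (real CARD('d) / 2) / (2 * pi) powr (real CARD('d) / 2)"
  have c0: "0 \<le> c" by (simp add: c_def)
  define E where "E y = c * exp (- (norm (fst x - y))\<^sup>2 / (4 * t))" for y
  have [measurable]: "E \<in> borel_measurable borel" unfolding E_def by measurable
  have E0: "0 \<le> E y" for y using c0 by (simp add: E_def)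
  have "(\<integral>\<^sup>+ y. ennreal (weinstein_heat_kernel \<alpha> t x y) \<partial>weinstein_measure \<alpha>) =
      (\<integral>\<^sup>+ y. ennreal (weinstein_heat_kernel \<alpha> t x y) \<partial>(fourier_measure \<Otimes>\<^sub>M hankel_measure \<alpha>))"
    by (rule nn_integral_weinstein[OF \<alpha>]) measurable
  also have "\<dots> = (\<integral>\<^sup>+ y. ennreal (E (fst y)) * ennreal (weber_kernel \<alpha> t (snd x) (snd y)) \<partial>(fourier_measure \<Otimes>\<^sub>M hankel_measure \<alpha>))"
    using E0 weber_kernel_nonneg[OF \<alpha> t]
    by (intro nn_integral_cong) (simp add: weinstein_heat_kernel_def E_def c_def flip: ennreal_mult)
  also have "\<dots> = (\<integral>\<^sup>+ a. (\<integral>\<^sup>+ b. ennreal (E a) * ennreal (weber_kernel \<alpha> t (snd x) b) \<partial>hankel_measure \<alpha>) \<partial>fourier_measure)"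
    by (subst H.nn_integral_fst[symmetric]) auto
  also have "\<dots> = (\<integral>\<^sup>+ a. ennreal (E a) \<partial>fourier_measure)"
    by (simp add: nn_integral_cmult weber_kernel_mass[OF \<alpha> t])
  also have "\<dots> = ennreal (1 / (2 * pi) powr (real CARD('d) / 2)) * (\<integral>\<^sup>+ a. ennreal (E a) \<partial>lborel)"
    unfolding fourier_measure_def by (subst nn_integral_density) (auto simp: nn_integral_cmult)
  also have "(\<integral>\<^sup>+ a. ennreal (E a) \<partial>lborel) = ennreal c * (\<integral>\<^sup>+ a. ennreal (exp (- (1 / (4 * t)) * (norm (fst x - a))\<^sup>2)) \<partial>lborel)"
    using c0 unfolding E_def by (subst nn_integral_cmult[symmetric]) (auto simp: ennreal_mult)
  also have "(\<integral>\<^sup>+ a. ennreal (exp (- (1 / (4 * t)) * (norm (fst x - a))\<^sup>2)) \<partial>lborel) = ennreal ((pi / (1 / (4 * t))) powr (real CARD('d) / 2))"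
    using gaussian_mass[of "1 / (4 * t)" "fst x"] t by simp
  also have "ennreal (1 / (2 * pi) powr (real CARD('d) / 2)) * (ennreal c * ennreal ((pi / (1 / (4 * t))) powr (real CARD('d) / 2))) = 1"
  proof -
    define e where "e = real CARD('d) / 2"
    have "(pi / t) powr e * (pi / (1 / (4 * t))) powr e = ((pi / t) * (pi / (1 / (4 * t)))) powr e"
      using t by (simp only: powr_mult) 
    also have "(pi / t) * (pi / (1 / (4 * t))) = (2 * pi) * (2 * pi)" using t by simp
    also have "((2 * pi) * (2 * pi)) powr e = (2 * pi) powr e * (2 * pi) powr e" by (simp only: powr_mult)
    finally have eq: "(pi / t) powr e * (pi / (1 / (4 * t))) powr e = (2 * pi) powr e * (2 * pi) powr e" .
    have "1 / (2 * pi) powr e * ((pi / t) powr e / (2 * pi) powr e * (pi / (1 / (4 * t))) powr e)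
        = ((pi / t) powr e * (pi / (1 / (4 * t))) powr e) / ((2 * pi) powr e * (2 * pi) powr e)"
      by (simp only: divide_inverse inverse_mult_distrib mult_1_left mult_ac)
    also have "\<dots> = 1" unfolding eq by simp
    finally show ?thesis
      unfolding c_def e_def[symmetric] by (subst ennreal_mult[symmetric], simp, simp, subst ennreal_mult[symmetric]) (simp_all only: ennreal_1, auto)
  qed
  finally show ?thesis .
qed

lemma gaussian_weight_nonneg: "0 \<le> gaussian_weight t l"
  by (simp add: gaussian_weight_def)

lemma measurable_gaussian_weight [measurable]: "gaussian_weight t \<in> borel_measurable borel"
  unfolding gaussian_weight_def by measurable

section \<open>Plancherel's inequality\<close>

lemma integrable_gaussian_weight:
  assumes \<alpha>: "\<alpha> > -1/2" and t: "0 < t"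
  shows "integrable (weinstein_measure \<alpha>) (\<lambda>l. of_real (gaussian_weight t (l :: (real ^ 'd) \<times> real)) :: complex)"
proof -
  interpret F: sigma_finite_measure "fourier_measure :: (real ^ 'd) measure" by (rule sigma_finite_fourier_measure)
  interpret H: sigma_finite_measure "hankel_measure \<alpha>" by (rule sigma_finite_hankel_measure)
  interpret pair_sigma_finite "fourier_measure :: (real ^ 'd) measure" "hankel_measure \<alpha>" ..
  have "integrable lborel (\<lambda>l::real ^ 'd. complex_of_real (exp (- t * (norm l)\<^sup>2)))"
    using gaussian_fourier[OF t, of "0::real ^ 'd"] by (simp add: has_bochner_integral_iff)
  hence "integrable fourier_measure (\<lambda>l::real ^ 'd. complex_of_real (exp (- t * (norm l)\<^sup>2)))"
    unfolding fourier_measure_def by (subst integrable_density) (auto intro!: integrable_scaleR_right)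
  then obtain a where a: "has_bochner_integral fourier_measure (\<lambda>l::real ^ 'd. complex_of_real (exp (- t * (norm l)\<^sup>2))) a"
    by (auto simp: integrable.simps)
  have "has_bochner_integral (hankel_measure \<alpha>) (\<lambda>l. exp (- t * l\<^sup>2)) (gaussian_moment \<alpha> t 0)"
    using hankel_gaussian_moment[OF \<alpha> t, of 0] by simp
  from has_bochner_integral_prod_mult[OF a has_bochner_integral_of_real[OF this]]
  have "has_bochner_integral (fourier_measure \<Otimes>\<^sub>M hankel_measure \<alpha>)
      (\<lambda>l. complex_of_real (gaussian_weight t (l :: (real ^ 'd) \<times> real))) (a * of_real (gaussian_moment \<alpha> t 0))"
    by (simp add: gaussian_weight_def)
  from has_bochner_integral_weinstein[OF \<alpha> _ this] show ?thesis
    by (simp add: has_bochner_integral_iff)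
qed

lemma norm_mult_weinstein_kernel_le:
  assumes "\<alpha> > -1/2"
  shows "norm (c * weinstein_kernel \<alpha> x l) \<le> norm c"
  using mult_left_le[OF norm_weinstein_kernel_le[OF assms, of x l] norm_ge_zero[of c]] by (simp add: norm_mult)

lemma integrable_mult_weinstein_kernel:
  fixes f :: "(real ^ 'd) \<times> real \<Rightarrow> complex"
  assumes \<alpha>: "\<alpha> > -1/2" and f: "integrable (weinstein_measure \<alpha>) f"
  shows "integrable (weinstein_measure \<alpha>) (\<lambda>x. f x * weinstein_kernel \<alpha> x l)"
proof (rule Bochner_Integration.integrable_bound[OF f])
  have [measurable]: "f \<in> borel_measurable (weinstein_measure \<alpha>)" using f by simp
  have [measurable]: "(\<lambda>x. weinstein_kernel \<alpha> x l) \<in> borel_measurable (weinstein_measure \<alpha>)"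
    by (intro borel_measurable_weinstein) measurable
  show "(\<lambda>x. f x * weinstein_kernel \<alpha> x l) \<in> borel_measurable (weinstein_measure \<alpha>)" by measurable
  show "AE x in weinstein_measure \<alpha>. norm (f x * weinstein_kernel \<alpha> x l) \<le> norm (f x)"
    by (intro AE_I2 norm_mult_weinstein_kernel_le \<alpha>)
qed

lemma measurable_weinstein_integral:
  fixes f :: "(real ^ 'd) \<times> real \<Rightarrow> complex"
  assumes [measurable]: "f \<in> borel_measurable (weinstein_measure \<alpha>)"
  shows "weinstein_integral \<alpha> f \<in> borel_measurable (weinstein_measure \<alpha>)"
proof -
  let ?M = "weinstein_measure \<alpha> :: ((real ^ 'd) \<times> real) measure"
  interpret sigma_finite_measure ?M by (rule sigma_finite_weinstein_measure)
  have [measurable]: "(\<lambda>x. x) \<in> ?M \<rightarrow>\<^sub>M borel" by (intro borel_measurable_weinstein) simp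
  have [measurable]: "fst \<in> ?M \<Otimes>\<^sub>M ?M \<rightarrow>\<^sub>M borel" "snd \<in> ?M \<Otimes>\<^sub>M ?M \<rightarrow>\<^sub>M borel"
    using measurable_compose[OF measurable_fst, of "\<lambda>x. x" ?M borel ?M]
      measurable_compose[OF measurable_snd, of "\<lambda>x. x" ?M borel ?M] by simp_all
  have "(\<lambda>p. f (snd p) * weinstein_kernel \<alpha> (snd p) (fst p)) \<in> borel_measurable (?M \<Otimes>\<^sub>M ?M)"
    by measurable
  thus ?thesis
    unfolding weinstein_integral_def by (intro borel_measurable_lebesgue_integral) (simp add: case_prod_unfold)
qed

text \<open>
  Fubini turns the left-hand side into the form \<open>f(x) cnj (f y) K(x, y)\<close> integrated over pairs. As \<open>K\<close> is
  nonnegative and symmetric with marginals one, \<open>2 |f(x) f(y)| \<le> |f(x)|\<^sup>2 + |f(y)|\<^sup>2\<close> gives the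
  bound (Schur's test).
\<close>

lemma weinstein_integral_gaussian_L2_le:
  fixes f :: "(real ^ 'd) \<times> real \<Rightarrow> complex"
  assumes \<alpha>: "\<alpha> > -1/2" and t: "0 < t" and f: "integrable (weinstein_measure \<alpha>) f"
  shows "(\<integral>\<^sup>+ l. ennreal ((norm (weinstein_integral \<alpha> f l))\<^sup>2 * gaussian_weight t l) \<partial>weinstein_measure \<alpha>)
    \<le> (\<integral>\<^sup>+ x. ennreal ((norm (f x))\<^sup>2) \<partial>weinstein_measure \<alpha>)"
proof -
  define M where "M = (weinstein_measure \<alpha> :: ((real ^ 'd) \<times> real) measure)"
  define k where "k = (weinstein_kernel \<alpha> :: (real ^ 'd) \<times> real \<Rightarrow> _)"
  define G where "G = (gaussian_weight t :: (real ^ 'd) \<times> real \<Rightarrow> real)"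
  define K where "K = (weinstein_heat_kernel \<alpha> t :: (real ^ 'd) \<times> real \<Rightarrow> _)"
  define F where "F = weinstein_integral \<alpha> f"
  interpret M: sigma_finite_measure M unfolding M_def by (rule sigma_finite_weinstein_measure)
  interpret MM: pair_sigma_finite M M ..
  interpret P: sigma_finite_measure "M \<Otimes>\<^sub>M M" 
    by (rule sigma_finite_pair_measure) (rule M.sigma_finite_measure_axioms)+
  interpret Q: pair_sigma_finite "M \<Otimes>\<^sub>M M" M ..
  have fM: "integrable M f" using f by (simp add: M_def)
  have [measurable]: "f \<in> borel_measurable M" using fM by simp
  have id [measurable]: "(\<lambda>x. x) \<in> M \<rightarrow>\<^sub>M borel" unfolding M_def by (intro borel_measurable_weinstein) simp
  have MM_fst [measurable]: "fst \<in> M \<Otimes>\<^sub>M M \<rightarrow>\<^sub>M borel" and MM_snd [measurable]: "snd \<in> M \<Otimes>\<^sub>M M \<rightarrow>\<^sub>M borel"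
    using measurable_compose[OF measurable_fst id, of M] measurable_compose[OF measurable_snd id, of M] by simp_all
  have [measurable]: "(\<lambda>q. fst (fst q)) \<in> (M \<Otimes>\<^sub>M M) \<Otimes>\<^sub>M M \<rightarrow>\<^sub>M borel"
      "(\<lambda>q. snd (fst q)) \<in> (M \<Otimes>\<^sub>M M) \<Otimes>\<^sub>M M \<rightarrow>\<^sub>M borel" "snd \<in> (M \<Otimes>\<^sub>M M) \<Otimes>\<^sub>M M \<rightarrow>\<^sub>M borel"
    using measurable_compose[OF measurable_fst MM_fst, of M] measurable_compose[OF measurable_fst MM_snd, of M]
      measurable_compose[OF measurable_snd id, of "M \<Otimes>\<^sub>M M"] by simp_all
  have [measurable]: "cnj \<in> borel_measurable borel"
    by (intro borel_measurable_continuous_onI continuous_intros)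
  have G0: "0 \<le> G l" and [measurable]: "G \<in> borel_measurable borel" for l
    unfolding G_def by (rule gaussian_weight_nonneg) measurable
  have K0: "0 \<le> K x y" for x y unfolding K_def by (rule weinstein_heat_kernel_nonneg[OF \<alpha> t])
  have K_commute: "K x y = K y x" for x y unfolding K_def by (rule weinstein_heat_kernel_commute)
  have k1: "norm (k x l) \<le> 1" for x l unfolding k_def by (rule norm_weinstein_kernel_le[OF \<alpha>])
  have [measurable]: "(\<lambda>z. k (u z) (v z)) \<in> borel_measurable N"
    if [measurable]: "u \<in> borel_measurable N" "v \<in> borel_measurable N" for u v and N :: "'z measure"
    unfolding k_def by measurable
  have [measurable]: "(\<lambda>z. K (u z) (v z)) \<in> borel_measurable N"
    if [measurable]: "u \<in> borel_measurable N" "v \<in> borel_measurable N" for u v and N :: "'z measure"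
    unfolding K_def by measurable
  define H where "H p l = f (fst p) * k (fst p) l * cnj (f (snd p) * k (snd p) l) * of_real (G l)" for p l
  let ?f2 = "\<integral>\<^sup>+ x. ennreal ((norm (f x))\<^sup>2) \<partial>M"
  let ?a = "\<lambda>p. ennreal ((norm (f (fst p)))\<^sup>2 * K (fst p) (snd p))"
  let ?b = "\<lambda>p. ennreal ((norm (f (snd p)))\<^sup>2 * K (fst p) (snd p))"
  let ?d = "\<lambda>q. of_real (norm (f (fst (fst q)))) * of_real (norm (f (snd (fst q)))) * of_real (G (snd q)) :: complex"
  have inner_p: "(\<integral>p. H p l \<partial>(M \<Otimes>\<^sub>M M)) = of_real ((norm (F l))\<^sup>2 * G l)" for l
  proof -
    have fk: "integrable M (\<lambda>x. f x * k x l)"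
      using integrable_mult_weinstein_kernel[OF \<alpha> f] by (simp add: M_def k_def)
    hence hb: "has_bochner_integral M (\<lambda>x. f x * k x l) (F l)"
      by (simp add: has_bochner_integral_iff F_def weinstein_integral_def M_def k_def)
    have "has_bochner_integral (M \<Otimes>\<^sub>M M) (\<lambda>p. f (fst p) * k (fst p) l * cnj (f (snd p) * k (snd p) l)) (F l * cnj (F l))"
      by (rule MM.has_bochner_integral_prod_mult[OF hb has_bochner_integral_cnj[OF hb]])
    hence "(\<integral>p. H p l \<partial>(M \<Otimes>\<^sub>M M)) = F l * cnj (F l) * of_real (G l)"
      unfolding H_def by (simp add: has_bochner_integral_iff)
    thus ?thesis by (simp add: complex_norm_square[symmetric])
  qed
  have inner_l: "(\<integral>l. H p l \<partial>M) = f (fst p) * cnj (f (snd p)) * of_real (K (fst p) (snd p))" for p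
  proof -
    have "H p l = f (fst p) * cnj (f (snd p)) * (k (fst p) l * cnj (k (snd p) l) * of_real (G l))" for l
      by (simp add: H_def mult_ac)
    thus ?thesis
      using weinstein_kernel_gaussian_product[OF \<alpha> t, of "fst p" "snd p"]
      by (simp add: has_bochner_integral_iff M_def k_def G_def K_def)
  qed
  have H_int: "integrable ((M \<Otimes>\<^sub>M M) \<Otimes>\<^sub>M M) (\<lambda>(p, l). H p l)"
  proof -
    have nf: "has_bochner_integral M (\<lambda>x. of_real (norm (f x)) :: complex) (of_real (\<integral>x. norm (f x) \<partial>M))"
      using fM by (simp add: has_bochner_integral_iff)
    obtain c where c: "has_bochner_integral M (\<lambda>l. of_real (G l) :: complex) c"
      using integrable_gaussian_weight[OF \<alpha> t] by (auto simp: integrable.simps M_def G_def)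
    note 1 = Q.has_bochner_integral_prod_mult[OF MM.has_bochner_integral_prod_mult[OF nf nf] c]
    show ?thesis
    proof (rule Bochner_Integration.integrable_bound)
      show "integrable ((M \<Otimes>\<^sub>M M) \<Otimes>\<^sub>M M) (\<lambda>q. ?d q)"
        using 1 by (simp add: has_bochner_integral_iff)
      show "(\<lambda>(p, l). H p l) \<in> borel_measurable ((M \<Otimes>\<^sub>M M) \<Otimes>\<^sub>M M)"
        unfolding H_def case_prod_unfold by measurable
      show "AE q in (M \<Otimes>\<^sub>M M) \<Otimes>\<^sub>M M. norm (case q of (p, l) \<Rightarrow> H p l) \<le>
          norm (?d q)"
      proof (rule AE_I2)
        fix q :: "(((real ^ 'd) \<times> real) \<times> (real ^ 'd) \<times> real) \<times> (real ^ 'd) \<times> real"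
        obtain x y l where q: "q = ((x, y), l)" by (metis prod.collapse)
        have "norm (H (x, y) l) = norm (f x) * norm (f y) * G l * (norm (k x l) * norm (k y l))"
          using G0 by (simp add: H_def norm_mult mult_ac)
        also have "\<dots> \<le> norm (f x) * norm (f y) * G l * 1"
          using G0 k1 by (intro mult_left_mono mult_le_one) auto
        finally show "norm (case q of (p, l) \<Rightarrow> H p l) \<le>
          norm (?d q)"
          using G0 by (simp add: q norm_mult)
      qed
    qed
  qed
  define B where "B p = f (fst p) * cnj (f (snd p)) * of_real (K (fst p) (snd p))" for p
  have B_int: "integrable (M \<Otimes>\<^sub>M M) B"
    using Q.integrable_fst[OF H_int] unfolding inner_l B_def .
  have "integrable M (\<lambda>l. of_real ((norm (F l))\<^sup>2 * G l) :: complex)"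
    using Q.integrable_snd[OF H_int] unfolding inner_p .
  hence F2_int: "integrable M (\<lambda>l. (norm (F l))\<^sup>2 * G l)" unfolding complex_of_real_integrable_eq .
  have "(\<integral>l. (\<integral>p. H p l \<partial>(M \<Otimes>\<^sub>M M)) \<partial>M) = (\<integral>p. (\<integral>l. H p l \<partial>M) \<partial>(M \<Otimes>\<^sub>M M))"
    by (rule Q.Fubini_integral[OF H_int])
  hence eq: "of_real (\<integral>l. (norm (F l))\<^sup>2 * G l \<partial>M) = integral\<^sup>L (M \<Otimes>\<^sub>M M) B"
    unfolding inner_p inner_l B_def integral_complex_of_real .
  have half: "(\<integral>\<^sup>+ p. ?a p \<partial>(M \<Otimes>\<^sub>M M)) = (?f2)"
  proof -
    have "(\<integral>\<^sup>+ p. ?a p \<partial>(M \<Otimes>\<^sub>M M)) =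
        (\<integral>\<^sup>+ x. (\<integral>\<^sup>+ y. ennreal ((norm (f x))\<^sup>2) * ennreal (K x y) \<partial>M) \<partial>M)"
      using K0 by (subst M.nn_integral_fst[symmetric]) (auto simp: ennreal_mult)
    also have "\<dots> = (\<integral>\<^sup>+ x. ennreal ((norm (f x))\<^sup>2) * (\<integral>\<^sup>+ y. ennreal (K x y) \<partial>M) \<partial>M)"
      by (intro nn_integral_cong nn_integral_cmult) measurable
    also have "\<dots> = (?f2)"
      unfolding K_def M_def weinstein_heat_kernel_mass[OF \<alpha> t] by simp
    finally show ?thesis .
  qed
  have half': "(\<integral>\<^sup>+ p. ?b p \<partial>(M \<Otimes>\<^sub>M M)) = (?f2)"
  proof -
    have "(\<integral>\<^sup>+ p. ?b p \<partial>(M \<Otimes>\<^sub>M M)) =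
        (\<integral>\<^sup>+ y. (\<integral>\<^sup>+ x. ennreal ((norm (f y))\<^sup>2) * ennreal (K x y) \<partial>M) \<partial>M)"
      using K0 by (subst MM.nn_integral_snd[symmetric]) (auto simp: ennreal_mult)
    also have "\<dots> = (\<integral>\<^sup>+ y. ennreal ((norm (f y))\<^sup>2) * (\<integral>\<^sup>+ x. ennreal (K y x) \<partial>M) \<partial>M)"
    proof (rule nn_integral_cong)
      fix y
      have "(\<integral>\<^sup>+ x. ennreal ((norm (f y))\<^sup>2) * ennreal (K x y) \<partial>M) =
          (\<integral>\<^sup>+ x. ennreal ((norm (f y))\<^sup>2) * ennreal (K y x) \<partial>M)"
        by (simp only: K_commute[of _ y])
      thus "(\<integral>\<^sup>+ x. ennreal ((norm (f y))\<^sup>2) * ennreal (K x y) \<partial>M) =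
          ennreal ((norm (f y))\<^sup>2) * (\<integral>\<^sup>+ x. ennreal (K y x) \<partial>M)"
        by (simp add: nn_integral_cmult)
    qed
    also have "\<dots> = (?f2)"
      unfolding K_def M_def weinstein_heat_kernel_mass[OF \<alpha> t] by simp
    finally show ?thesis .
  qed
  have "(\<integral>\<^sup>+ l. ennreal ((norm (F l))\<^sup>2 * G l) \<partial>M) = ennreal (\<integral>l. (norm (F l))\<^sup>2 * G l \<partial>M)"
    using F2_int G0 by (intro nn_integral_eq_integral) auto
  also have "(\<integral>l. (norm (F l))\<^sup>2 * G l \<partial>M) = norm (integral\<^sup>L (M \<Otimes>\<^sub>M M) B)"
    unfolding eq[symmetric] using G0 by (simp add: integral_nonneg_AE)
  also have "ennreal \<dots> \<le> (\<integral>\<^sup>+ p. ennreal (norm (B p)) \<partial>(M \<Otimes>\<^sub>M M))"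
    by (rule integral_norm_bound_ennreal[OF B_int])
  also have "\<dots> \<le> (\<integral>\<^sup>+ p. ennreal (1/2) * ?a p +
      ennreal (1/2) * ?b p \<partial>(M \<Otimes>\<^sub>M M))"
  proof (rule nn_integral_mono)
    fix p
    define a b where "a = norm (f (fst p))" and "b = norm (f (snd p))"
    have "a * b \<le> 1/2 * a\<^sup>2 + 1/2 * b\<^sup>2" using sum_squares_bound[of a b] by simp
    hence "a * b * K (fst p) (snd p) \<le> (1/2 * a\<^sup>2 + 1/2 * b\<^sup>2) * K (fst p) (snd p)"
      using K0 by (intro mult_right_mono) auto
    hence "norm (B p) \<le> 1/2 * (a\<^sup>2 * K (fst p) (snd p)) + 1/2 * (b\<^sup>2 * K (fst p) (snd p))"
      using K0[of "fst p" "snd p"] by (simp add: B_def norm_mult a_def b_def algebra_simps)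
    hence "ennreal (norm (B p)) \<le> ennreal (1/2 * (a\<^sup>2 * K (fst p) (snd p)) + 1/2 * (b\<^sup>2 * K (fst p) (snd p)))"
      by (rule ennreal_leI)
    also have "\<dots> = ennreal (1/2 * (a\<^sup>2 * K (fst p) (snd p))) + ennreal (1/2 * (b\<^sup>2 * K (fst p) (snd p)))"
      using K0 by (intro ennreal_plus) auto
    also have "\<dots> = ennreal (1/2) * ennreal (a\<^sup>2 * K (fst p) (snd p)) + ennreal (1/2) * ennreal (b\<^sup>2 * K (fst p) (snd p))"
      by (intro arg_cong2[where f = "(+)"] ennreal_mult') simp_all
    finally show "ennreal (norm (B p)) \<le> ennreal (1/2) * ?a p +
      ennreal (1/2) * ?b p"
      unfolding a_def b_def .
  qed
  also have "\<dots> = ennreal (1/2) * (?f2) + ennreal (1/2) * (?f2)"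
    by (subst nn_integral_add, measurable, (subst nn_integral_cmult, measurable)+) (simp only: half half')
  also have "\<dots> = (?f2)"
  proof -
    have "ennreal (1/2) + ennreal (1/2) = 1" by (subst ennreal_plus[symmetric]) simp_all
    thus ?thesis unfolding distrib_right[symmetric] by simp
  qed
  finally show ?thesis unfolding F_def G_def M_def .
qed

text \<open>
  The Gaussian weights tend to one as \<open>t \<rightarrow> 0\<close>, so Fatou's lemma removes them.
\<close>

theorem weinstein_plancherel_le:
  fixes f :: "(real ^ 'd) \<times> real \<Rightarrow> complex"
  assumes \<alpha>: "\<alpha> > -1/2" and f: "integrable (weinstein_measure \<alpha>) f"
  shows "(\<integral>\<^sup>+ l. ennreal ((norm (weinstein_integral \<alpha> f l))\<^sup>2) \<partial>weinstein_measure \<alpha>)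
    \<le> (\<integral>\<^sup>+ x. ennreal ((norm (f x))\<^sup>2) \<partial>weinstein_measure \<alpha>)"
proof (rule nn_integral_le_of_tendsto)
  let ?t = "\<lambda>n. inverse (real (Suc n))"
  let ?M = "weinstein_measure \<alpha> :: ((real ^ 'd) \<times> real) measure" and ?F = "weinstein_integral \<alpha> f"
  have [measurable]: "?F \<in> borel_measurable (?M)"
    using f by (intro measurable_weinstein_integral) simp
  have [measurable]: "gaussian_weight t \<in> borel_measurable (?M)" for t
    by (intro borel_measurable_weinstein) measurable
  show "(\<lambda>l. ennreal ((norm (?F l))\<^sup>2 * gaussian_weight (?t n) l)) \<in> borel_measurable (?M)" for n
    by measurable
  show "AE l in ?M. (\<lambda>n. ennreal ((norm (?F l))\<^sup>2 * gaussian_weight (?t n) l))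
      \<longlonglongrightarrow> ennreal ((norm (?F l))\<^sup>2)"
  proof (rule AE_I2)
    fix l :: "(real ^ 'd) \<times> real"
    have "(\<lambda>n. (norm (?F l))\<^sup>2 * gaussian_weight (?t n) l) \<longlonglongrightarrow>
        (norm (?F l))\<^sup>2 * (exp (- 0 * (norm (fst l))\<^sup>2) * exp (- 0 * (snd l)\<^sup>2))"
      unfolding gaussian_weight_def by (intro tendsto_intros LIMSEQ_inverse_real_of_nat)
    thus "(\<lambda>n. ennreal ((norm (?F l))\<^sup>2 * gaussian_weight (?t n) l))
      \<longlonglongrightarrow> ennreal ((norm (?F l))\<^sup>2)"
      by (intro tendsto_ennrealI) simp
  qed
  show "eventually (\<lambda>n. (\<integral>\<^sup>+ l. ennreal ((norm (?F l))\<^sup>2 * gaussian_weight (?t n) l) \<partial>?M)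
      \<le> (\<integral>\<^sup>+ x. ennreal ((norm (f x))\<^sup>2) \<partial>?M)) sequentially"
    by (intro always_eventually allI weinstein_integral_gaussian_L2_le[OF \<alpha> _ f]) simp
qed

lemma weinstein_L1_L2_contraction:
  assumes \<alpha>: "\<alpha> > -1/2"
  shows "L1_L2_contraction (weinstein_measure \<alpha> :: ((real ^ 'd) \<times> real) measure) (weinstein_integral \<alpha>)"
proof
  fix f g :: "(real ^ 'd) \<times> real \<Rightarrow> complex" and l c
  let ?M = "weinstein_measure \<alpha> :: ((real ^ 'd) \<times> real) measure"
  assume f: "integrable ?M f"
  note fk = integrable_mult_weinstein_kernel[OF \<alpha> f]
  show "weinstein_integral \<alpha> f \<in> borel_measurable ?M"
    using f by (intro measurable_weinstein_integral) simp
  show "weinstein_integral \<alpha> (\<lambda>x. c * f x) l = c * weinstein_integral \<alpha> f l"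
    unfolding weinstein_integral_def mult.assoc by simp
  have "norm (weinstein_integral \<alpha> f l) \<le> (\<integral>x. norm (f x * weinstein_kernel \<alpha> x l) \<partial>?M)"
    unfolding weinstein_integral_def by (rule integral_norm_bound)
  also have "\<dots> \<le> (\<integral>x. norm (f x) \<partial>?M)"
    using fk f by (intro integral_mono integrable_norm norm_mult_weinstein_kernel_le \<alpha>)
  finally show "norm (weinstein_integral \<alpha> f l) \<le> (\<integral>x. norm (f x) \<partial>?M)" .
  {
    assume g: "integrable ?M g"
    show "weinstein_integral \<alpha> (\<lambda>x. f x + g x) l = weinstein_integral \<alpha> f l + weinstein_integral \<alpha> g l"
      unfolding weinstein_integral_def distrib_right
      by (intro Bochner_Integration.integral_add fk integrable_mult_weinstein_kernel[OF \<alpha> g])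
  next
    assume "integrable ?M (\<lambda>x. (norm (f x))\<^sup>2)"
    thus "(\<integral>\<^sup>+ l. ennreal ((norm (weinstein_integral \<alpha> f l))\<^sup>2) \<partial>?M) \<le> ennreal (\<integral>x. (norm (f x))\<^sup>2 \<partial>?M)"
      using weinstein_plancherel_le[OF \<alpha> f] by (subst (asm) nn_integral_eq_integral[of _ "\<lambda>x. (norm (f x))\<^sup>2"]) auto
  }
qed

section \<open>Inequalities of Minkowski and Hoelder\<close>

lemma Lp_norm_1: "Lp_norm M (ennreal 1) f = (\<integral>\<^sup>+ x. ennreal (norm (f x)) \<partial>M)"
proof -
  have "ennreal_power X 1 = X" for X by (cases X) (auto simp: ennreal_power_def)
  thus ?thesis by (simp add: Lp_norm_def)
qed

lemma ennreal_exponent_cases: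
  assumes "1 \<le> q"
  obtains (infinity) "q = \<infinity>" | (real) r where "q = ennreal r" "1 \<le> r"
proof (cases q)
  case (real r)
  with assms have "1 \<le> r" by (simp flip: ennreal_1)
  thus ?thesis using real that(2) by simp
qed (use that(1) in simp)

lemma Lp_norm_mono:
  assumes q: "1 \<le> q" and [measurable]: "f \<in> borel_measurable M"
    and le: "AE x in M. norm (f x) \<le> norm (g x)"
  shows "Lp_norm M q f \<le> Lp_norm M q g"
  using q
proof (cases q rule: ennreal_exponent_cases)
  case infinity
  thus ?thesis using le by (auto simp: Lp_norm_def intro!: esssup_AE_mono elim!: eventually_mono)
next
  case (real r)
  show ?thesis
  proof (rule dense_ge)
    fix y assume y: "Lp_norm M q g < y"
    show "Lp_norm M q f \<le> y"
    proof (cases y)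
      case (real c)
      have "(\<integral>\<^sup>+ x. ennreal (norm (f x) powr r) \<partial>M) \<le> (\<integral>\<^sup>+ x. ennreal (norm (g x) powr r) \<partial>M)"
        using le \<open>1 \<le> r\<close> by (intro nn_integral_mono_AE) (auto elim!: eventually_mono intro!: ennreal_leI powr_mono2)
      also have "\<dots> \<le> ennreal (c powr r)"
        using less_imp_le[OF y] real \<open>q = ennreal r\<close> \<open>1 \<le> r\<close> Lp_norm_le_iff[of r c M g] by simp
      finally show ?thesis using real \<open>q = ennreal r\<close> \<open>1 \<le> r\<close> Lp_norm_le_iff[of r c M f] by simp
    qed simp
  qed
qed

text \<open>
  Convexity of \<open>\<lambda>x. x powr r\<close> for the mean of \<open>a / c\<close> and \<open>b / d\<close> with weights \<open>c / (c + d)\<close> and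
  \<open>d / (c + d)\<close>.
\<close>

lemma convex_powr_mean:
  fixes a b c d r :: real
  assumes "0 \<le> a" "0 \<le> b" "0 < c" "0 < d" "1 \<le> r"
  shows "((a + b) / (c + d)) powr r \<le> c / (c + d) * (a / c) powr r + d / (c + d) * (b / d) powr r"
proof -
  have w: "c / (c + d) + d / (c + d) = 1" "0 \<le> c / (c + d)" "0 \<le> d / (c + d)" "c / (c + d) \<le> 1" "d / (c + d) \<le> 1"
    using assms by (simp_all flip: add_divide_distrib)
  have eq: "(a + b) / (c + d) = c / (c + d) * (a / c) + d / (c + d) * (b / d)"
    using assms by (simp add: add_divide_distrib)
  \<comment> \<open>Convexity is used at positive points; if \<open>a\<close> or \<open>b\<close> is zero, one term of the mean drops out.\<close>
  have scale: "(s * u) powr r \<le> s * u powr r" if "0 \<le> s" "s \<le> 1" "0 \<le> u" for s u :: real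
  proof (cases "s = 0")
    case False
    have "s powr r \<le> s powr 1" using that False assms by (intro powr_mono') auto
    thus ?thesis using that False by (simp add: powr_mult mult_right_mono)
  qed simp
  show ?thesis
  proof (cases "a = 0 \<or> b = 0")
    case True
    thus ?thesis
      using scale[of "c / (c + d)" "a / c"] scale[of "d / (c + d)" "b / d"] w assms unfolding eq by auto
  next
    case False
    have "c / (c + d) = 1 - d / (c + d)" using w(1) by simp
    moreover have "((1 - d / (c + d)) *\<^sub>R (a / c) + (d / (c + d)) *\<^sub>R (b / d)) powr r \<le>
        (1 - d / (c + d)) * (a / c) powr r + d / (c + d) * (b / d) powr r"
      using False assms w by (intro convex_onD[OF powr_convex[OF assms(5)]]) auto
    ultimately show ?thesis unfolding eq by simp
  qed
qed

text \<open>
  If \<open>c\<close> and \<open>d\<close> bound the two norms, then \<open>convex_powr_mean\<close> integrates to a bound by one for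
  \<open>|f + g| / (c + d)\<close>.
\<close>

theorem Lp_norm_triangle:
  assumes q: "1 \<le> q" and [measurable]: "f \<in> borel_measurable M" "g \<in> borel_measurable M"
  shows "Lp_norm M q (\<lambda>x. f x + g x) \<le> Lp_norm M q f + Lp_norm M q g"
  using q
proof (cases q rule: ennreal_exponent_cases)
  case infinity
  have "AE x in M. ennreal (norm (f x + g x)) \<le> esssup M (\<lambda>x. ennreal (norm (f x))) + esssup M (\<lambda>x. ennreal (norm (g x)))"
    using esssup_AE[of "\<lambda>x. ennreal (norm (f x))" M] esssup_AE[of "\<lambda>x. ennreal (norm (g x))" M]
  proof eventually_elim
    case (elim x)
    have "ennreal (norm (f x + g x)) \<le> ennreal (norm (f x) + norm (g x))"
      by (rule ennreal_leI[OF norm_triangle_ineq])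
    also have "\<dots> = ennreal (norm (f x)) + ennreal (norm (g x))" by (rule ennreal_plus) simp_all
    finally show ?case using add_mono[OF elim] by (rule order_trans)
  qed
  thus ?thesis using infinity by (simp add: Lp_norm_def esssup_I)
next
  case (real r)
  have core: "Lp_norm M q (\<lambda>x. f x + g x) \<le> ennreal (c + d)"
    if c: "Lp_norm M q f \<le> ennreal c" "0 < c" and d: "Lp_norm M q g \<le> ennreal d" "0 < d" for c d
  proof -
    have scaled: "(\<integral>\<^sup>+ x. ennreal ((norm (h x) / e) powr r) \<partial>M) \<le> 1"
      if "Lp_norm M q h \<le> ennreal e" "0 < e" and [measurable]: "h \<in> borel_measurable M" for h :: "'a \<Rightarrow> complex" and e
    proof -
      have "(\<integral>\<^sup>+ x. ennreal ((norm (h x) / e) powr r) \<partial>M) = (\<integral>\<^sup>+ x. ennreal (1 / e powr r) * ennreal (norm (h x) powr r) \<partial>M)"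
        using that(2) by (intro nn_integral_cong) (simp add: powr_divide flip: ennreal_mult)
      also have "\<dots> = ennreal (1 / e powr r) * (\<integral>\<^sup>+ x. ennreal (norm (h x) powr r) \<partial>M)"
        by (rule nn_integral_cmult) measurable
      also have "\<dots> \<le> ennreal (1 / e powr r) * ennreal (e powr r)"
        using that(1,2) real Lp_norm_le_iff[of r e M h] by (intro mult_left_mono) auto
      also have "\<dots> = 1" using that(2) by (simp flip: ennreal_mult)
      finally show ?thesis .
    qed
    have split: "ennreal (k * (u * v + t * w)) = ennreal k * (ennreal u * ennreal v + ennreal t * ennreal w)"
      if "0 \<le> k" "0 \<le> u" "0 \<le> v" "0 \<le> t" "0 \<le> w" for k u v t w :: real
      using that by (simp only: ennreal_mult ennreal_plus mult_nonneg_nonneg add_nonneg_nonneg)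
    define s where "s = c + d"
    have s: "0 < s" using c d by (simp add: s_def)
    let ?e = "\<lambda>x. c / s * (norm (f x) / c) powr r + d / s * (norm (g x) / d) powr r"
    let ?E = "\<lambda>x. ennreal (c / s) * ennreal ((norm (f x) / c) powr r) +
      ennreal (d / s) * ennreal ((norm (g x) / d) powr r)"
    have "(\<integral>\<^sup>+ x. ennreal (norm (f x + g x) powr r) \<partial>M) \<le>
        (\<integral>\<^sup>+ x. ennreal (s powr r) * (?E x) \<partial>M)"
    proof (rule nn_integral_mono)
      fix x
      have "norm (f x + g x) powr r \<le> (s * ((norm (f x) + norm (g x)) / s)) powr r"
        using s real(2) by (auto intro!: powr_mono2 norm_triangle_ineq)
      also have "\<dots> = s powr r * ((norm (f x) + norm (g x)) / s) powr r" using s by (intro powr_mult)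
      also have "\<dots> \<le> s powr r * (?e x)"
        unfolding s_def using c d real(2) by (intro mult_left_mono convex_powr_mean) auto
      finally have "ennreal (norm (f x + g x) powr r) \<le> ennreal (s powr r * (?e x))"
        by (rule ennreal_leI)
      also have "\<dots> = ennreal (s powr r) * (?E x)"
        using c d s by (intro split) auto
      finally show "ennreal (norm (f x + g x) powr r) \<le> ennreal (s powr r) * (?E x)" .
    qed
    also have "\<dots> = ennreal (s powr r) * (ennreal (c / s) * (\<integral>\<^sup>+ x. ennreal ((norm (f x) / c) powr r) \<partial>M) +
        ennreal (d / s) * (\<integral>\<^sup>+ x. ennreal ((norm (g x) / d) powr r) \<partial>M))"
      by (simp add: nn_integral_cmult nn_integral_add)
    also have "\<dots> \<le> ennreal (s powr r) * (ennreal (c / s) * 1 + ennreal (d / s) * 1)"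
      using c d by (intro mult_left_mono add_mono scaled) auto
    also have "ennreal (c / s) * 1 + ennreal (d / s) * 1 = 1"
      using c d s by (simp add: s_def add_divide_distrib[symmetric] flip: ennreal_plus)
    finally show ?thesis using s real c d Lp_norm_le_iff[of r "c + d" M "\<lambda>x. f x + g x"] by (simp add: s_def)
  qed
  show ?thesis
  proof (cases "Lp_norm M q f = \<infinity> \<or> Lp_norm M q g = \<infinity>")
    case False
    then obtain a b where ab: "Lp_norm M q f = ennreal a" "0 \<le> a" "Lp_norm M q g = ennreal b" "0 \<le> b"
      by (cases "Lp_norm M q f"; cases "Lp_norm M q g") auto
    show ?thesis
    proof (rule ennreal_le_epsilon)
      fix e :: real assume e: "0 < e"
      have "Lp_norm M q (\<lambda>x. f x + g x) \<le> ennreal ((a + e / 2) + (b + e / 2))"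
        using ab e by (intro core) (auto intro!: ennreal_leI)
      also have "(a + e / 2) + (b + e / 2) = a + b + e" by simp
      finally show "Lp_norm M q (\<lambda>x. f x + g x) \<le> Lp_norm M q f + Lp_norm M q g + ennreal e"
        using ab e by (simp add: ennreal_plus)
    qed
  qed auto
qed

lemma Lp_norm_minus_commute: "Lp_norm M q (\<lambda>x. f x - g x) = Lp_norm M q (\<lambda>x. g x - f x)"
  by (simp add: Lp_norm_def norm_minus_commute)

lemma Lp_norm_triangle_diff:
  assumes "1 \<le> q" and [measurable]: "f \<in> borel_measurable M" "g \<in> borel_measurable M" "h \<in> borel_measurable M"
  shows "Lp_norm M q (\<lambda>x. f x - h x) \<le> Lp_norm M q (\<lambda>x. f x - g x) + Lp_norm M q (\<lambda>x. g x - h x)"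
  using Lp_norm_triangle[of q "\<lambda>x. f x - g x" M "\<lambda>x. g x - h x"] assms by simp

lemma Lp_norm_le_dist_plus:
  assumes "1 \<le> q" and [measurable]: "f \<in> borel_measurable M" "g \<in> borel_measurable M"
  shows "Lp_norm M q f \<le> Lp_norm M q (\<lambda>x. f x - g x) + Lp_norm M q g"
  using Lp_norm_triangle[of q "\<lambda>x. f x - g x" M g] assms by simp

lemma Lp_norm_eq_0_imp_AE:
  assumes "1 \<le> p" and [measurable]: "f \<in> borel_measurable M" and "Lp_norm M (ennreal p) f = 0"
  shows "AE x in M. f x = 0"
proof -
  have "(\<integral>\<^sup>+ x. ennreal (norm (f x) powr p) \<partial>M) \<le> 0"
    using assms Lp_norm_le_iff[of p 0 M f] by simp
  thus ?thesis by (subst (asm) le_zero_eq, subst (asm) nn_integral_0_iff_AE) (auto elim!: eventually_mono)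
qed

text \<open>
  If \<open>q\<close> is finite and \<open>S\<close> has infinite measure, the right-hand side is infinite unless \<open>c = 0\<close>, when
  \<open>h = 0\<close>.
\<close>

lemma Lp_norm_bounded_on_set:
  assumes q: "1 \<le> q" and [measurable]: "h \<in> borel_measurable M" "S \<in> sets M"
    and c: "0 \<le> c" and bd: "\<And>x. norm (h x) \<le> c"
  shows "Lp_norm M q (\<lambda>x. h x * indicator S x) \<le> ennreal_power (emeasure M S) (enn2real (1 / q)) * ennreal c"
  using q
proof (cases q rule: ennreal_exponent_cases)
  case infinity
  have "norm (h x * indicator S x) \<le> c" for x using bd[of x] c by (auto simp: indicator_def)
  hence "esssup M (\<lambda>x. ennreal (norm (h x * indicator S x))) \<le> ennreal c"
    by (intro esssup_I AE_I2 ennreal_leI) (auto simp: indicator_def)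
  thus ?thesis using infinity by (simp add: Lp_norm_def ennreal_power_def)
next
  case (real r)
  have inv_q: "enn2real (1 / q) = 1 / r" using real by (simp add: divide_ennreal flip: ennreal_1)
  have exp_nz: "1 / r \<noteq> 0" using real by simp
  show ?thesis
  proof (cases "emeasure M S = \<infinity>")
    case True
    show ?thesis
    proof (cases "c = 0")
      case True
      hence "h x = 0" for x using bd[of x] by simp
      hence "Lp_norm M (ennreal r) (\<lambda>x. h x * indicator S x) \<le> ennreal 0"
        using real by (subst Lp_norm_le_iff) auto
      thus ?thesis using real by simp
    next
      case False
      thus ?thesis using \<open>emeasure M S = \<infinity>\<close> exp_nz c unfolding inv_q
        by (simp add: ennreal_power_def ennreal_top_mult)
    qed
  next
    case False
    then obtain m where m: "emeasure M S = ennreal m" "0 \<le> m" by (cases "emeasure M S") auto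
    have "(\<integral>\<^sup>+ x. ennreal (norm (h x * indicator S x) powr r) \<partial>M) \<le> (\<integral>\<^sup>+ x. ennreal (c powr r) * indicator S x \<partial>M)"
      using bd real c by (intro nn_integral_mono) (auto simp: indicator_def intro!: ennreal_leI powr_mono2)
    also have "\<dots> = ennreal (c powr r * m)" using m by (simp add: nn_integral_cmult_indicator ennreal_mult)
    also have "c powr r * m = (m powr (1 / r) * c) powr r" using m c real by (simp add: powr_mult powr_powr)
    finally have "Lp_norm M (ennreal r) (\<lambda>x. h x * indicator S x) \<le> ennreal (m powr (1 / r) * c)"
      using real c m by (subst Lp_norm_le_iff) auto
    thus ?thesis using real m c exp_nz unfolding inv_q by (simp add: ennreal_power_def ennreal_mult)
  qed
qed

lemma one_le_conj_exponent: "1 \<le> p \<Longrightarrow> 1 \<le> conj_exponent p"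
  by (auto simp: conj_exponent_def field_simps simp flip: ennreal_1 intro!: ennreal_leI)

lemma inverse_conj_exponent:
  assumes "1 \<le> p"
  shows "enn2real (1 / conj_exponent p) = 1 - 1 / p"
proof (cases "p = 1")
  case False
  hence p: "1 < p" using assms by simp
  hence "1 / conj_exponent p = ennreal (1 / (p / (p - 1)))"
    by (simp only: conj_exponent_gt1) (simp add: divide_ennreal flip: ennreal_1)
  thus ?thesis using p by (simp add: field_simps)
qed (simp add: conj_exponent_def)

text \<open>
  Hoelder's inequality against an indicator function. Young's inequality is applied after normalizing by the
  norm \<open>N\<close> and the measure \<open>m\<close>, so that the two integrals add up to \<open>1 / p + (1 - 1 / p) = 1\<close>. The cases
  in which \<open>N\<close> or \<open>m\<close> is zero or infinite are settled before.
\<close>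

lemma L1_norm_on_set_le:
  assumes p: "1 \<le> p" and [measurable]: "f \<in> borel_measurable M" "S \<in> sets M"
  shows "(\<integral>\<^sup>+ x. ennreal (norm (f x * indicator S x)) \<partial>M) \<le>
    ennreal_power (emeasure M S) (enn2real (1 / conj_exponent p)) * Lp_norm M (ennreal p) f"
proof (cases "p = 1")
  case True
  have "(\<integral>\<^sup>+ x. ennreal (norm (f x * indicator S x)) \<partial>M) \<le> (\<integral>\<^sup>+ x. ennreal (norm (f x)) \<partial>M)"
    by (intro nn_integral_mono) (auto simp: indicator_def)
  thus ?thesis using True inverse_conj_exponent[OF p] Lp_norm_1[of M f] by (simp add: ennreal_power_def)
next
  case False
  define r where "r = 1 - 1 / p"
  have p1: "1 < p" using p False by simp
  hence r: "0 < r" "1 / p + r = 1" by (auto simp: r_def)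
  have inv: "enn2real (1 / conj_exponent p) = r" using inverse_conj_exponent[OF p] by (simp add: r_def)
  let ?f = "\<lambda>x. ennreal (norm (f x * indicator S x))" and ?I = "\<integral>\<^sup>+ x. ennreal (norm (f x) powr p) \<partial>M"
  consider "Lp_norm M (ennreal p) f = 0" | "emeasure M S = 0" 
    | "Lp_norm M (ennreal p) f \<noteq> 0" "emeasure M S \<noteq> 0" "Lp_norm M (ennreal p) f = \<infinity> \<or> emeasure M S = \<infinity>"
    | (fin) N m where "Lp_norm M (ennreal p) f = ennreal N" "0 < N" "emeasure M S = ennreal m" "0 < m"
    by (cases "Lp_norm M (ennreal p) f"; cases "emeasure M S") (auto simp: ennreal_eq_0_iff not_le less_le)
  then show ?thesis
  proof cases
    case 1
    hence "AE x in M. f x = 0" using p by (intro Lp_norm_eq_0_imp_AE) auto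
    hence "(\<integral>\<^sup>+ x. ?f x \<partial>M) = (\<integral>\<^sup>+ x. 0 \<partial>M)"
      by (intro nn_integral_cong_AE) (auto elim!: eventually_mono)
    thus ?thesis by simp
  next
    case 2
    hence "AE x in M. x \<notin> S" by (intro AE_not_in) auto
    hence "(\<integral>\<^sup>+ x. ?f x \<partial>M) = (\<integral>\<^sup>+ x. 0 \<partial>M)"
      by (intro nn_integral_cong_AE) (auto elim!: eventually_mono)
    thus ?thesis by simp
  next
    case 3
    have "ennreal_power (emeasure M S) r \<noteq> 0"
      using 3(2) r by (cases "emeasure M S") (auto simp: ennreal_power_def)
    moreover have "emeasure M S = \<infinity> \<Longrightarrow> ennreal_power (emeasure M S) r = \<infinity>"
      using r by (simp add: ennreal_power_def)
    ultimately have "ennreal_power (emeasure M S) r * Lp_norm M (ennreal p) f = \<infinity>"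
      using 3 by (auto simp: ennreal_mult_eq_top_iff)
    thus ?thesis unfolding inv by simp
  next
    case fin
    let ?y = "\<lambda>x. 1 / p * (norm (f x) powr p / N powr p) + r * (1 / m) * indicator S x"
    have young: "norm (f x * indicator S x) \<le> N * m powr r * (?y x)" for x
    proof (cases "x \<in> S \<and> f x \<noteq> 0")
      case True
      define a where "a = (norm (f x) / N) powr p"
      have a: "0 < a" using True fin by (simp add: a_def)
      have "a powr (1 / p) * (1 / m) powr r \<le> 1 / p * a + r * (1 / m)"
        using a fin p1 r by (intro Youngs_inequality_0) auto
      moreover have "a powr (1 / p) = norm (f x) / N" using p1 fin by (simp add: a_def powr_powr)
      moreover have "a = norm (f x) powr p / N powr p" using fin by (simp add: a_def powr_divide)
      ultimately have "norm (f x) / N * (1 / m) powr r \<le> 1 / p * (norm (f x) powr p / N powr p) + r * (1 / m)"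
        by simp
      hence "N * m powr r * (norm (f x) / N * (1 / m) powr r) \<le> N * m powr r * (1 / p * (norm (f x) powr p / N powr p) + r * (1 / m))"
        using fin by (intro mult_left_mono) auto
      moreover have "N * m powr r * (norm (f x) / N * (1 / m) powr r) = norm (f x)"
        using fin by (simp add: powr_divide)
      ultimately show ?thesis using True by simp
    next
      case False
      thus ?thesis using fin p1 r by (auto simp: indicator_def)
    qed
    have fp: "(?I) \<le> ennreal (N powr p)"
      using fin p1 Lp_norm_le_iff[of p N M f] by simp
    have split: "ennreal (K * (u * (v / w) + s * i)) = ennreal K * (ennreal (u / w) * ennreal v + ennreal s * ennreal i)"
      if "0 \<le> K" "0 \<le> u" "0 \<le> v" "0 < w" "0 \<le> s" "0 \<le> i" for K u v w s i :: real
    proof -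
      have "u * (v / w) = (u / w) * v" by simp
      thus ?thesis using that by (simp only: ennreal_mult ennreal_plus divide_nonneg_pos mult_nonneg_nonneg add_nonneg_nonneg)
    qed
    have "(\<integral>\<^sup>+ x. ?f x \<partial>M) \<le>
        (\<integral>\<^sup>+ x. ennreal (N * m powr r) * (ennreal (1 / p / N powr p) * ennreal (norm (f x) powr p) + ennreal (r * (1 / m)) * indicator S x) \<partial>M)"
    proof (rule nn_integral_mono)
      fix x
      have "?f x \<le> ennreal (N * m powr r * (?y x))"
        using young by (rule ennreal_leI)
      also have "\<dots> = ennreal (N * m powr r) * (ennreal (1 / p / N powr p) * ennreal (norm (f x) powr p) + ennreal (r * (1 / m)) * ennreal (indicator S x))"
        using fin p1 r by (intro split) auto
      finally show "?f x \<le> ennreal (N * m powr r) * (ennreal (1 / p / N powr p) * ennreal (norm (f x) powr p) + ennreal (r * (1 / m)) * indicator S x)"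
        by (simp add: ennreal_indicator)
    qed
    also have "\<dots> = ennreal (N * m powr r) * (ennreal (1 / p / N powr p) * (?I) + ennreal (r * (1 / m)) * emeasure M S)"
      by (subst nn_integral_cmult, measurable, subst nn_integral_add, measurable, subst nn_integral_cmult, measurable)
         (simp add: nn_integral_cmult_indicator)
    also have "\<dots> \<le> ennreal (N * m powr r) * (ennreal (1 / p / N powr p) * ennreal (N powr p) + ennreal (r * (1 / m)) * ennreal m)"
      using fp fin by (intro mult_left_mono add_mono) auto
    also have "ennreal (1 / p / N powr p) * ennreal (N powr p) + ennreal (r * (1 / m)) * ennreal m = 1"
    proof -
      have "ennreal (1 / p / N powr p) * ennreal (N powr p) = ennreal (1 / p)"
        using fin p1 by (subst ennreal_mult[symmetric]) auto
      moreover have "ennreal (r * (1 / m)) * ennreal m = ennreal r"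
        using fin r by (subst ennreal_mult[symmetric]) auto
      ultimately show ?thesis using r p1 by (simp flip: ennreal_plus)
    qed
    finally show ?thesis unfolding inv using fin r
      by (simp add: ennreal_power_def ennreal_mult mult.commute)
  qed
qed

section \<open>Completeness and truncation\<close>

lemma ennreal_tendsto_0_le:
  fixes u v :: "nat \<Rightarrow> ennreal"
  assumes "\<And>n. u n \<le> v n" "v \<longlonglongrightarrow> 0"
  shows "u \<longlonglongrightarrow> 0"
  by (rule tendsto_sandwich[OF _ _ tendsto_const assms(2)]) (use assms(1) in auto)

text \<open>
  For a sequence that is Cauchy at a geometric rate, the sum of the \<open>r\<close>-th powers of
  \<open>2\<^sup>n |h\<^bsub>n+1\<^esub> - h\<^sub>n|\<close> has finite integral. Almost everywhere the increments are therefore eventually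
  at most \<open>2\<^sup>-\<^sup>n\<close>, and the sequence converges; Fatou's lemma makes the limit one in norm.
\<close>

lemma Lp_complete:
  fixes h :: "nat \<Rightarrow> 'a \<Rightarrow> complex"
  assumes r: "1 \<le> r" and [measurable]: "\<And>n. h n \<in> borel_measurable M"
    and cauchy: "\<And>n m. n \<le> m \<Longrightarrow> Lp_norm M (ennreal r) (\<lambda>x. h m x - h n x) \<le> ennreal (2 / 4 ^ n)"
  obtains g where "g \<in> borel_measurable M" "(\<lambda>n. Lp_norm M (ennreal r) (\<lambda>x. h n x - g x)) \<longlonglongrightarrow> 0"
proof
  define g where "g x = lim (\<lambda>n. h n x)" for x
  show g [measurable]: "g \<in> borel_measurable M" unfolding g_def by measurable
  have cauchy': "(\<integral>\<^sup>+ x. ennreal (norm (h m x - h n x) powr r) \<partial>M) \<le> ennreal ((2 / 4 ^ n) powr r)" if "n \<le> m" for n m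
    using cauchy[OF that] r by (subst (asm) Lp_norm_le_iff) auto
  define d where "d n x = (2 ^ n * norm (h (Suc n) x - h n x)) powr r" for n x
  have [measurable]: "d n \<in> borel_measurable M" for n unfolding d_def by measurable
  let ?s = "\<lambda>x. \<Sum>n. h (Suc n) x - h n x"
  have d_int: "(\<integral>\<^sup>+ x. ennreal (d n x) \<partial>M) \<le> ennreal (2 powr r * (1 / 2) ^ n)" for n
  proof -
    have "(\<integral>\<^sup>+ x. ennreal (d n x) \<partial>M) = ennreal ((2 ^ n) powr r) * (\<integral>\<^sup>+ x. ennreal (norm (h (Suc n) x - h n x) powr r) \<partial>M)"
      unfolding d_def by (subst nn_integral_cmult[symmetric]) (auto simp: powr_mult ennreal_mult)
    also have "\<dots> \<le> ennreal ((2 ^ n) powr r) * ennreal ((2 / 4 ^ n) powr r)"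
      using cauchy'[of n "Suc n"] by (intro mult_left_mono) auto
    also have "\<dots> = ennreal ((2 ^ n) powr r * (2 / 4 ^ n) powr r)" by (rule ennreal_mult[symmetric]) simp_all
    also have "(2 ^ n) powr r * (2 / 4 ^ n) powr r = (2 ^ n * (2 / 4 ^ n) :: real) powr r" by (simp only: powr_mult)
    also have "(2::real) ^ n * (2 / 4 ^ n) = 2 * (1 / 2) ^ n"
    proof -
      have "(4::real) ^ n = 2 ^ n * 2 ^ n" by (simp flip: power_mult_distrib)
      thus ?thesis by (simp add: power_one_over field_simps)
    qed
    also have "(2 * (1 / 2) ^ n) powr r \<le> 2 powr r * (1 / 2) ^ n"
    proof -
      have "((1 / 2::real) ^ n) powr r \<le> ((1 / 2) ^ n) powr 1"
        using r by (intro powr_mono') (auto simp: power_le_one)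
      thus ?thesis by (simp add: powr_mult)
    qed
    finally show ?thesis by (simp add: ennreal_leI)
  qed
  have "(\<integral>\<^sup>+ x. (\<Sum>n. ennreal (d n x)) \<partial>M) = (\<Sum>n. \<integral>\<^sup>+ x. ennreal (d n x) \<partial>M)"
    by (rule nn_integral_suminf) measurable
  also have "\<dots> \<le> (\<Sum>n. ennreal (2 powr r * (1 / 2) ^ n))"
    by (intro suminf_le d_int) auto
  also have "\<dots> < \<infinity>"
  proof -
    have "summable (\<lambda>n. 2 powr r * (1 / 2 :: real) ^ n)" by (intro summable_mult summable_geometric) simp
    hence "(\<Sum>n. ennreal (2 powr r * (1 / 2) ^ n)) = ennreal (\<Sum>n. 2 powr r * (1 / 2) ^ n)"
      by (intro suminf_ennreal2) auto
    thus ?thesis by simp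
  qed
  finally have "(\<integral>\<^sup>+ x. (\<Sum>n. ennreal (d n x)) \<partial>M) \<noteq> \<infinity>" by simp
  hence "AE x in M. (\<Sum>n. ennreal (d n x)) \<noteq> \<infinity>" by (intro nn_integral_noteq_infinite) auto
  hence conv: "AE x in M. (\<lambda>n. h n x) \<longlonglongrightarrow> g x"
  proof eventually_elim
    case (elim x)
    have "summable (\<lambda>n. d n x)" using elim by (intro summable_suminf_not_top) (auto simp: d_def)
    hence "(\<lambda>n. d n x) \<longlonglongrightarrow> 0" by (rule summable_LIMSEQ_zero)
    hence ev: "eventually (\<lambda>n. d n x < 1) sequentially" by (rule order_tendstoD) simp
    have "summable (\<lambda>n. h (Suc n) x - h n x)"
    proof (rule summable_comparison_test_ev)
      show "summable (\<lambda>n. (1 / 2 :: real) ^ n)" by (rule summable_geometric) simp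
      show "eventually (\<lambda>n. norm (h (Suc n) x - h n x) \<le> (1 / 2) ^ n) sequentially"
        using ev
      proof (rule eventually_mono)
        fix n assume "d n x < 1"
        hence "\<not> 1 \<le> 2 ^ n * norm (h (Suc n) x - h n x)"
          unfolding d_def using r ge_one_powr_ge_zero[of "2 ^ n * norm (h (Suc n) x - h n x)" r] by auto
        thus "norm (h (Suc n) x - h n x) \<le> (1 / 2) ^ n" by (simp add: field_simps power_one_over)
      qed
    qed
    hence "(\<lambda>n. \<Sum>i<n. h (Suc i) x - h i x) \<longlonglongrightarrow> ?s x" by (rule summable_LIMSEQ)
    hence "(\<lambda>n. h n x - h 0 x) \<longlonglongrightarrow> ?s x" 
      unfolding sum_lessThan_telescope[of "\<lambda>n. h n x"] .
    hence "(\<lambda>n. h n x - h 0 x + h 0 x) \<longlonglongrightarrow> ?s x + h 0 x" by (intro tendsto_intros)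
    hence "convergent (\<lambda>n. h n x)" by (auto simp: convergent_def)
    thus ?case unfolding g_def by (simp add: convergent_LIMSEQ_iff)
  qed
  have "Lp_norm M (ennreal r) (\<lambda>x. h n x - g x) \<le> ennreal (2 / 4 ^ n)" for n
  proof -
    have "(\<integral>\<^sup>+ x. ennreal (norm (g x - h n x) powr r) \<partial>M) \<le> ennreal ((2 / 4 ^ n) powr r)"
    proof (rule nn_integral_le_of_tendsto)
      show "(\<lambda>x. ennreal (norm (h m x - h n x) powr r)) \<in> borel_measurable M" for m by measurable
      show "AE x in M. (\<lambda>m. ennreal (norm (h m x - h n x) powr r)) \<longlonglongrightarrow> ennreal (norm (g x - h n x) powr r)"
        using conv by (rule eventually_mono)
          (use r in \<open>auto intro!: tendsto_ennrealI tendsto_powr' tendsto_norm tendsto_diff tendsto_const\<close>)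
      show "eventually (\<lambda>m. (\<integral>\<^sup>+ x. ennreal (norm (h m x - h n x) powr r) \<partial>M) \<le> ennreal ((2 / 4 ^ n) powr r)) sequentially"
        using cauchy' by (auto simp: eventually_sequentially)
    qed
    hence "Lp_norm M (ennreal r) (\<lambda>x. g x - h n x) \<le> ennreal (2 / 4 ^ n)"
      using r by (subst Lp_norm_le_iff) auto
    thus ?thesis by (subst Lp_norm_minus_commute)
  qed
  moreover have "(\<lambda>n. ennreal (2 / 4 ^ n)) \<longlonglongrightarrow> 0"
  proof -
    have "(\<lambda>n. 2 * (1 / 4 :: real) ^ n) \<longlonglongrightarrow> 2 * 0" by (intro tendsto_intros LIMSEQ_realpow_zero) auto
    moreover have "2 * (1 / 4 :: real) ^ n = 2 / 4 ^ n" for n by (simp add: power_one_over)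
    ultimately have "(\<lambda>n. 2 / 4 ^ n :: real) \<longlonglongrightarrow> 0" by (simp only: mult_zero_right)
    thus ?thesis using tendsto_ennrealI[of "\<lambda>n. 2 / 4 ^ n" 0 sequentially] by (simp only: ennreal_0)
  qed
  ultimately show "(\<lambda>n. Lp_norm M (ennreal r) (\<lambda>x. h n x - g x)) \<longlonglongrightarrow> 0"
    by (rule ennreal_tendsto_0_le)
qed

lemma Lp_space_1_iff: "f \<in> Lp_space M 1 \<longleftrightarrow> integrable M f"
  using Lp_norm_1[of M f] by (simp add: Lp_space_def integrable_iff_bounded)

text \<open>
  Truncation to the set where \<open>|f| > 1 / n\<close>: there \<open>|f|\<close> is at most \<open>|f|\<^sup>p\<close> times the \<open>(p - 1)\<close>-th power
  of \<open>n\<close>.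
\<close>

lemma Lp_approx_by_L1:
  assumes p: "1 < p" and f: "f \<in> Lp_space M (ennreal p)" and e: "0 < e"
  obtains g where "g \<in> Lp_space M 1" "g \<in> Lp_space M (ennreal p)"
    "Lp_norm M (ennreal p) (\<lambda>x. g x - f x) \<le> ennreal e"
proof -
  have [measurable]: "f \<in> borel_measurable M" and fin: "Lp_norm M (ennreal p) f < \<infinity>"
    using f by (auto simp: Lp_space_def)
  obtain N where N: "Lp_norm M (ennreal p) f = ennreal N" "0 \<le> N"
    using fin by (cases "Lp_norm M (ennreal p) f") auto
  hence "(\<integral>\<^sup>+ x. ennreal (norm (f x) powr p) \<partial>M) \<le> ennreal (N powr p)"
    using p Lp_norm_le_iff[of p N M f] by simp
  hence fp: "integrable M (\<lambda>x. norm (f x) powr p)"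
    by (intro integrableI_bounded) (auto simp: less_top[symmetric] top_unique)
  define g where "g n x = (if 1 / real (Suc n) < norm (f x) then f x else 0)" for n x
  have [measurable]: "g n \<in> borel_measurable M" for n unfolding g_def by measurable
  have g_le: "norm (g n x) \<le> norm (f x)" "norm (g n x - f x) \<le> norm (f x)" for n x by (auto simp: g_def)
  have g_L1: "g n \<in> Lp_space M 1" for n
    unfolding Lp_space_1_iff
  proof (rule Bochner_Integration.integrable_bound)
    show "integrable M (\<lambda>x. real (Suc n) powr (p - 1) * norm (f x) powr p)" using fp by simp
    show "AE x in M. norm (g n x) \<le> norm (real (Suc n) powr (p - 1) * norm (f x) powr p)"
    proof (rule AE_I2)
      fix x
      show "norm (g n x) \<le> norm (real (Suc n) powr (p - 1) * norm (f x) powr p)"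
      proof (cases "1 / real (Suc n) < norm (f x)")
        case True
        hence pos: "0 < norm (f x)" by (meson less_trans of_nat_0_less_iff zero_less_Suc zero_less_divide_1_iff)
        have "1 \<le> (real (Suc n) * norm (f x)) powr (p - 1)"
          using True p by (intro ge_one_powr_ge_zero) (auto simp: field_simps)
        hence "norm (f x) * 1 \<le> norm (f x) * (real (Suc n) * norm (f x)) powr (p - 1)"
          by (intro mult_left_mono) auto
        also have "\<dots> = real (Suc n) powr (p - 1) * (norm (f x) powr 1 * norm (f x) powr (p - 1))"
          using pos by (simp add: powr_mult)
        also have "norm (f x) powr 1 * norm (f x) powr (p - 1) = norm (f x) powr p"
          by (subst powr_add[symmetric]) simp
        finally show ?thesis using True by (simp add: g_def)
      qed (simp add: g_def)
    qed
  qed measurable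
  have g_Lp: "g n \<in> Lp_space M (ennreal p)" for n
    using Lp_norm_mono[of "ennreal p" "g n" M f] g_le p fin by (auto simp: Lp_space_def)
  have "(\<lambda>n. \<integral>x. norm (g n x - f x) powr p \<partial>M) \<longlonglongrightarrow> (\<integral>x. 0 \<partial>M)"
  proof (rule integral_dominated_convergence[where w = "\<lambda>x. norm (f x) powr p"])
    show "AE x in M. (\<lambda>n. norm (g n x - f x) powr p) \<longlonglongrightarrow> 0"
    proof (rule AE_I2)
      fix x
      have "eventually (\<lambda>n. norm (g n x - f x) powr p = 0) sequentially"
      proof (cases "f x = 0")
        case False
        have "eventually (\<lambda>n. inverse (real (Suc n)) < norm (f x)) sequentially"
          using False by (intro order_tendstoD(2)[OF LIMSEQ_inverse_real_of_nat]) simp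
        thus ?thesis by (rule eventually_mono) (simp add: g_def inverse_eq_divide)
      qed (simp add: g_def)
      thus "(\<lambda>n. norm (g n x - f x) powr p) \<longlonglongrightarrow> 0" by (rule tendsto_eventually)
    qed
    show "AE x in M. norm (norm (g n x - f x) powr p) \<le> norm (f x) powr p" for n
      using g_le p by (intro AE_I2) (auto intro!: powr_mono2)
  qed (use fp in auto)
  hence "eventually (\<lambda>n. (\<integral>x. norm (g n x - f x) powr p \<partial>M) < e powr p) sequentially"
    using e by (intro order_tendstoD(2)) auto
  then obtain n where n: "(\<integral>x. norm (g n x - f x) powr p \<partial>M) < e powr p"
    by (auto simp: eventually_sequentially)
  have "integrable M (\<lambda>x. norm (g n x - f x) powr p)"
    using g_le p by (intro Bochner_Integration.integrable_bound[OF fp]) (auto intro!: AE_I2 powr_mono2)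
  hence "(\<integral>\<^sup>+ x. ennreal (norm (g n x - f x) powr p) \<partial>M) = ennreal (\<integral>x. norm (g n x - f x) powr p \<partial>M)"
    by (intro nn_integral_eq_integral) auto
  also have "\<dots> \<le> ennreal (e powr p)" using n by (intro ennreal_leI) simp
  finally have "Lp_norm M (ennreal p) (\<lambda>x. g n x - f x) \<le> ennreal e"
    using p e by (subst Lp_norm_le_iff) auto
  thus ?thesis using that g_L1 g_Lp by blast
qed

section \<open>The transform on \<open>L\<^sup>p\<close> and concentration\<close>

text \<open>
  For integrable \<open>\<phi>\<close> the constant sequence is a witness. Otherwise \<open>\<phi>\<close> is approximated by integrable
  functions at a geometric rate; by Hausdorff--Young their transforms form a Cauchy sequence of the
  same rate, whose limit exists by completeness.
\<close>

theorem has_weinstein_transform_weinstein_transform: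
  fixes \<phi> :: "(real ^ 'd) \<times> real \<Rightarrow> complex"
  assumes \<alpha>: "\<alpha> > -1/2" and p: "1 \<le> p" "p \<le> 2"
    and \<phi>: "\<phi> \<in> Lp_space (weinstein_measure \<alpha>) (ennreal p)"
  shows "has_weinstein_transform \<alpha> p \<phi> (weinstein_transform \<alpha> p \<phi>)"
proof (cases "\<phi> \<in> Lp_space (weinstein_measure \<alpha>) 1")
  case True
  interpret L1_L2_contraction "weinstein_measure \<alpha> :: ((real ^ 'd) \<times> real) measure" "weinstein_integral \<alpha>"
    by (rule weinstein_L1_L2_contraction[OF \<alpha>])
  have zero: "Lp_norm (weinstein_measure \<alpha>) q (\<lambda>x::(real ^ 'd) \<times> real. 0) = 0" if "1 \<le> q" for q
    using that
  proof (cases q rule: ennreal_exponent_cases)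
    case infinity
    have "esssup (weinstein_measure \<alpha>) (\<lambda>x::(real ^ 'd) \<times> real. 0 :: ennreal) \<le> 0" by (intro esssup_I) auto
    thus ?thesis using infinity by (simp add: Lp_norm_def)
  next
    case (real r)
    thus ?thesis using Lp_norm_le_iff[of r 0 "weinstein_measure \<alpha>" "\<lambda>x::(real ^ 'd) \<times> real. 0"] by simp
  qed
  have "1 \<le> ennreal p" using p by (simp flip: ennreal_1)
  hence "has_weinstein_transform \<alpha> p \<phi> (weinstein_integral \<alpha> \<phi>)"
    unfolding has_weinstein_transform_def using True \<phi> p zero one_le_conj_exponent
    by (intro conjI exI[of _ "\<lambda>_. \<phi>"]) (auto simp: Lp_space_1_iff)
  thus ?thesis using True by (simp add: weinstein_transform_def)
next
  case False
  let ?M = "weinstein_measure \<alpha> :: ((real ^ 'd) \<times> real) measure"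
  let ?F = "weinstein_integral \<alpha>" and ?P = "Lp_norm ?M (ennreal p)"
  interpret L1_L2_contraction ?M "?F"
    by (rule weinstein_L1_L2_contraction[OF \<alpha>])
  have p1: "1 < p" using p False \<phi> by (cases "p = 1") auto
  have [measurable]: "\<phi> \<in> borel_measurable ?M" using \<phi> by (simp add: Lp_space_def)
  have "\<forall>n. \<exists>g. g \<in> Lp_space ?M 1 \<and> g \<in> Lp_space ?M (ennreal p) \<and>
      ?P (\<lambda>x. g x - \<phi> x) \<le> ennreal (1 / 4 ^ n)"
    using Lp_approx_by_L1[OF p1 \<phi>, of "1 / 4 ^ n" for n] by (metis zero_less_divide_1_iff zero_less_numeral zero_less_power)
  then obtain \<Phi> where \<Phi>: "\<And>n. \<Phi> n \<in> Lp_space ?M 1" "\<And>n. \<Phi> n \<in> Lp_space ?M (ennreal p)"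
      "\<And>n. ?P (\<lambda>x. \<Phi> n x - \<phi> x) \<le> ennreal (1 / 4 ^ n)"
    by metis
  have \<Phi>_int: "integrable ?M (\<Phi> n)" for n using \<Phi>(1) by (simp add: Lp_space_1_iff)
  hence [measurable]: "\<Phi> n \<in> borel_measurable ?M" "?F (\<Phi> n) \<in> borel_measurable ?M" for n by auto
  define r where "r = p / (p - 1)"
  let ?R = "Lp_norm ?M (ennreal r)"
  have r: "1 \<le> r" "conj_exponent p = ennreal r" using p1 by (auto simp: r_def conj_exponent_gt1)
  have "?R (\<lambda>l. ?F (\<Phi> m) l - ?F (\<Phi> n) l) \<le> ennreal (2 / 4 ^ n)"
    if "n \<le> m" for n m
  proof -
    have "?R (\<lambda>l. ?F (\<Phi> m) l - ?F (\<Phi> n) l) =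
        ?R (?F (\<lambda>x. \<Phi> m x - \<Phi> n x))"
      by (intro arg_cong[where f = "?R"] ext) (simp add: T_diff \<Phi>_int)
    also have "\<dots> \<le> ?P (\<lambda>x. \<Phi> m x - \<Phi> n x)"
      using hausdorff_young[of "\<lambda>x. \<Phi> m x - \<Phi> n x" p] p \<Phi>_int r by simp
    also have "\<dots> \<le> ?P (\<lambda>x. \<Phi> m x - \<phi> x) + ?P (\<lambda>x. \<phi> x - \<Phi> n x)"
      using p by (intro Lp_norm_triangle_diff) (auto simp flip: ennreal_1)
    also have "\<dots> \<le> ennreal (1 / 4 ^ m) + ennreal (1 / 4 ^ n)"
      using \<Phi>(3)[of m] \<Phi>(3)[of n] by (subst (2) Lp_norm_minus_commute) (rule add_mono)
    also have "\<dots> = ennreal (1 / 4 ^ m + 1 / 4 ^ n)" by (intro ennreal_plus[symmetric]) auto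
    also have "\<dots> \<le> ennreal (2 / 4 ^ n)"
    proof (rule ennreal_leI)
      have "1 / 4 ^ m \<le> (1 / 4 ^ n :: real)" using that by (intro divide_left_mono power_increasing) auto
      thus "1 / 4 ^ m + 1 / 4 ^ n \<le> (2 / 4 ^ n :: real)" by simp
    qed
    finally show ?thesis .
  qed
  then obtain g where g: "g \<in> borel_measurable ?M"
      "(\<lambda>n. ?R (\<lambda>x. ?F (\<Phi> n) x - g x)) \<longlonglongrightarrow> 0"
    using Lp_complete[OF r(1), of "\<lambda>n. ?F (\<Phi> n)" ?M] by auto
  have "(\<lambda>n. ennreal (1 / 4 ^ n)) \<longlonglongrightarrow> 0"
  proof -
    have "(\<lambda>n. (1 / 4 :: real) ^ n) \<longlonglongrightarrow> 0" by (intro LIMSEQ_realpow_zero) auto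
    hence "(\<lambda>n. 1 / 4 ^ n :: real) \<longlonglongrightarrow> 0" by (simp only: power_one_over)
    thus ?thesis using tendsto_ennrealI[of "\<lambda>n. 1 / 4 ^ n" 0 sequentially] by (simp only: ennreal_0)
  qed
  hence "(\<lambda>n. ?P (\<lambda>x. \<Phi> n x - \<phi> x)) \<longlonglongrightarrow> 0"
    by (rule ennreal_tendsto_0_le[OF \<Phi>(3)])
  hence "has_weinstein_transform \<alpha> p \<phi> g"
    unfolding has_weinstein_transform_def using g \<Phi>(1,2) r(2) by (intro conjI exI[of _ \<Phi>]) auto
  hence "has_weinstein_transform \<alpha> p \<phi> (SOME g. has_weinstein_transform \<alpha> p \<phi> g)"
    by (rule someI[where P = "has_weinstein_transform \<alpha> p \<phi>"])
  thus ?thesis using False by (simp add: weinstein_transform_def)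
qed

text \<open>
  The part of \<open>\<psi>\<close> in \<open>\<Omega>\<close> is estimated from \<open>L\<^sup>1\<close> to \<open>L\<^sup>\<infinity>\<close>, and the part outside \<open>\<Omega>\<close> by Hausdorff--Young.
\<close>

lemma weinstein_integral_concentrated_le:
  fixes \<psi> :: "(real ^ 'd) \<times> real \<Rightarrow> complex"
  assumes \<alpha>: "\<alpha> > -1/2" and p: "1 \<le> p" "p \<le> 2"
    and [measurable]: "\<Omega> \<in> sets (weinstein_measure \<alpha>)" "\<Sigma> \<in> sets (weinstein_measure \<alpha>)"
    and \<psi>: "integrable (weinstein_measure \<alpha>) \<psi>"
  shows "Lp_norm (weinstein_measure \<alpha>) (conj_exponent p) (\<lambda>l. weinstein_integral \<alpha> \<psi> l * indicator \<Sigma> l) \<le>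
      ennreal_power (emeasure (weinstein_measure \<alpha>) \<Sigma>) (enn2real (1 / conj_exponent p)) *
      ennreal_power (emeasure (weinstein_measure \<alpha>) \<Omega>) (enn2real (1 / conj_exponent p)) *
        Lp_norm (weinstein_measure \<alpha>) (ennreal p) \<psi> +
      Lp_norm (weinstein_measure \<alpha>) (ennreal p) (\<lambda>x. \<psi> x - time_limit \<Omega> \<psi> x)"
proof -
  let ?M = "weinstein_measure \<alpha> :: ((real ^ 'd) \<times> real) measure"
  let ?q = "conj_exponent p" and ?F = "weinstein_integral \<alpha>"
  let ?s = "ennreal_power (emeasure ?M \<Sigma>) (enn2real (1 / ?q))"
  let ?o = "ennreal_power (emeasure ?M \<Omega>) (enn2real (1 / ?q))"
  let ?\<psi>1 = "\<lambda>x. \<psi> x * indicator \<Omega> x" and ?\<psi>2 = "\<lambda>x. \<psi> x - \<psi> x * indicator \<Omega> x"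
  interpret L1_L2_contraction ?M ?F
    by (rule weinstein_L1_L2_contraction[OF \<alpha>])
  have q: "1 \<le> ?q" using p by (intro one_le_conj_exponent)
  have [measurable]: "\<psi> \<in> borel_measurable ?M" using \<psi> by simp
  have i1: "integrable ?M ?\<psi>1"
    by (rule Bochner_Integration.integrable_bound[OF \<psi>]) (auto intro!: AE_I2 simp: indicator_def)
  hence i2: "integrable ?M ?\<psi>2" using \<psi> by simp
  have [measurable]: "?F ?\<psi>1 \<in> borel_measurable ?M" "?F ?\<psi>2 \<in> borel_measurable ?M" using i1 i2 by auto
  have F_split: "?F \<psi> l = ?F ?\<psi>1 l + ?F ?\<psi>2 l" for l using T_diff[OF \<psi> i1, of l] by simp
  have "Lp_norm ?M ?q (\<lambda>l. ?F \<psi> l * indicator \<Sigma> l) \<le>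
      Lp_norm ?M ?q (\<lambda>l. ?F ?\<psi>1 l * indicator \<Sigma> l) + Lp_norm ?M ?q (\<lambda>l. ?F ?\<psi>2 l * indicator \<Sigma> l)"
    unfolding F_split distrib_right by (rule Lp_norm_triangle[OF q]) measurable
  also have "\<dots> \<le> ?s * ennreal (\<integral>x. norm (?\<psi>1 x) \<partial>?M) +
      Lp_norm ?M (ennreal p) ?\<psi>2"
  proof (rule add_mono)
    show "Lp_norm ?M ?q (\<lambda>l. ?F ?\<psi>1 l * indicator \<Sigma> l) \<le>
        ?s * ennreal (\<integral>x. norm (?\<psi>1 x) \<partial>?M)"
      by (rule Lp_norm_bounded_on_set[OF q]) (auto intro!: T_L1[OF i1])
    have "Lp_norm ?M ?q (\<lambda>l. ?F ?\<psi>2 l * indicator \<Sigma> l) \<le> Lp_norm ?M ?q (?F ?\<psi>2)"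
    proof (rule Lp_norm_mono[OF q])
      show "AE l in ?M. norm (?F ?\<psi>2 l * indicator \<Sigma> l) \<le> norm (?F ?\<psi>2 l)"
        by (intro AE_I2) (simp split: split_indicator)
    qed measurable
    also have "\<dots> \<le> Lp_norm ?M (ennreal p) ?\<psi>2" using i2 p by (rule hausdorff_young)
    finally show "Lp_norm ?M ?q (\<lambda>l. ?F ?\<psi>2 l * indicator \<Sigma> l) \<le> Lp_norm ?M (ennreal p) ?\<psi>2" .
  qed
  also have "ennreal (\<integral>x. norm (?\<psi>1 x) \<partial>?M) = (\<integral>\<^sup>+ x. ennreal (norm (?\<psi>1 x)) \<partial>?M)"
    using i1 by (intro nn_integral_eq_integral[symmetric]) auto
  also have "?s * (\<integral>\<^sup>+ x. ennreal (norm (?\<psi>1 x)) \<partial>?M) + Lp_norm ?M (ennreal p) ?\<psi>2 \<le>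
      ?s * (?o * Lp_norm ?M (ennreal p) \<psi>) +
      Lp_norm ?M (ennreal p) ?\<psi>2"
    using p by (intro add_mono mult_left_mono L1_norm_on_set_le) auto
  finally show ?thesis by (simp add: time_limit_def mult.assoc)
qed

theorem theoremB:
  fixes \<alpha> p \<epsilon>\<^sub>\<Omega> \<epsilon>\<^sub>\<Sigma> :: real
    and \<Omega> \<Sigma> :: "((real ^ 'd) \<times> real) set"
    and \<phi> :: "(real ^ 'd) \<times> real \<Rightarrow> complex"
    and q :: ennreal
  assumes "\<alpha> > - 1 / 2"
    and "\<Omega> \<in> sets (weinstein_measure \<alpha>)"
    and "\<Sigma> \<in> sets (weinstein_measure \<alpha>)"
    and "1 \<le> p" and "p \<le> 2"
    and "q = conj_exponent p"
    and "0 \<le> \<epsilon>\<^sub>\<Omega>"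
    and "0 \<le> \<epsilon>\<^sub>\<Sigma>" and "\<epsilon>\<^sub>\<Sigma> < 1"
    and "\<phi> \<in> Lp_space (weinstein_measure \<alpha>) (ennreal p)"
    and "time_concentrated \<alpha> p \<epsilon>\<^sub>\<Omega> \<Omega> \<phi>"
    and "transform_concentrated \<alpha> p \<epsilon>\<^sub>\<Sigma> \<Sigma> \<phi>"
  shows "Lp_norm (weinstein_measure \<alpha>) q (weinstein_transform \<alpha> p \<phi>)
    \<le> (ennreal_power (emeasure (weinstein_measure \<alpha>) \<Sigma>) (enn2real (1 / q)) *
          ennreal_power (emeasure (weinstein_measure \<alpha>) \<Omega>) (enn2real (1 / q)) + ennreal \<epsilon>\<^sub>\<Omega>)
        / ennreal (1 - \<epsilon>\<^sub>\<Sigma>)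
      * Lp_norm (weinstein_measure \<alpha>) (ennreal p) \<phi>"
proof -
  let ?M = "weinstein_measure \<alpha> :: ((real ^ 'd) \<times> real) measure"
  let ?F = "weinstein_integral \<alpha>" and ?P = "Lp_norm ?M (ennreal p)" and ?Q = "Lp_norm ?M (conj_exponent p)"
  define g where "g = weinstein_transform \<alpha> p \<phi>"
  define C where "C = ennreal_power (emeasure ?M \<Sigma>) (enn2real (1 / conj_exponent p)) *
    ennreal_power (emeasure ?M \<Omega>) (enn2real (1 / conj_exponent p))"
  have \<alpha>: "\<alpha> > -1/2" using assms(1) by simp
  note p = \<open>1 \<le> p\<close> \<open>p \<le> 2\<close>
  have [measurable]: "\<Omega> \<in> sets ?M" "\<Sigma> \<in> sets ?M" by fact+
  interpret L1_L2_contraction ?M ?F by (rule weinstein_L1_L2_contraction[OF \<alpha>])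
  have p1: "1 \<le> ennreal p" using p by (simp flip: ennreal_1)
  have q1: "1 \<le> conj_exponent p" using p by (intro one_le_conj_exponent)
  have [measurable]: "\<phi> \<in> borel_measurable ?M" and \<phi>_fin: "?P \<phi> < \<infinity>"
    using \<open>\<phi> \<in> Lp_space ?M (ennreal p)\<close> by (auto simp: Lp_space_def)
  have "has_weinstein_transform \<alpha> p \<phi> g"
    unfolding g_def by (intro has_weinstein_transform_weinstein_transform \<alpha> p assms)
  then obtain \<Phi> where g [measurable]: "g \<in> borel_measurable ?M"
      and \<Phi>: "\<And>n. \<Phi> n \<in> Lp_space ?M 1"
      and a_lim: "(\<lambda>n. ?P (\<lambda>x. \<Phi> n x - \<phi> x)) \<longlonglongrightarrow> 0"
      and b_lim: "(\<lambda>n. ?Q (\<lambda>l. ?F (\<Phi> n) l - g l)) \<longlonglongrightarrow> 0"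
    unfolding has_weinstein_transform_def by blast
  have \<Phi>_int: "integrable ?M (\<Phi> n)" for n using \<Phi> by (simp add: Lp_space_1_iff)
  hence [measurable]: "\<Phi> n \<in> borel_measurable ?M" "?F (\<Phi> n) \<in> borel_measurable ?M" for n by auto
  define a b where "a n = ?P (\<lambda>x. \<Phi> n x - \<phi> x)" and "b n = ?Q (\<lambda>l. ?F (\<Phi> n) l - g l)" for n
  have a: "a \<longlonglongrightarrow> 0" and b: "b \<longlonglongrightarrow> 0" using a_lim b_lim by (simp_all add: a_def[abs_def] b_def[abs_def])
  have \<Phi>_le: "?P (\<Phi> n) \<le> a n + ?P \<phi>" for n
    unfolding a_def by (rule Lp_norm_le_dist_plus[OF p1]) measurable
  have g_HY: "?Q g \<le> ?P \<phi>"
  proof (rule tendsto_lowerbound)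
    show "(\<lambda>n. b n + (a n + ?P \<phi>)) \<longlonglongrightarrow> ?P \<phi>"
      using tendsto_add[OF b tendsto_add[OF a tendsto_const[of "?P \<phi>"]]] by simp
    have "?Q g \<le> b n + (a n + ?P \<phi>)" for n
    proof -
      have "?Q g \<le> ?Q (\<lambda>l. g l - ?F (\<Phi> n) l) + ?Q (?F (\<Phi> n))"
        by (rule Lp_norm_le_dist_plus[OF q1]) measurable
      also have "\<dots> \<le> b n + ?P (\<Phi> n)"
        unfolding b_def Lp_norm_minus_commute[of _ _ g] by (intro add_left_mono hausdorff_young \<Phi>_int p)
      also have "\<dots> \<le> b n + (a n + ?P \<phi>)" by (intro add_left_mono \<Phi>_le)
      finally show ?thesis .
    qed
    thus "eventually (\<lambda>n. ?Q g \<le> b n + (a n + ?P \<phi>)) sequentially" by simp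
  qed simp
  \<comment> \<open>The limit below multiplies a null sequence by \<open>C\<close>, so \<open>C = \<infinity>\<close> is treated apart. The right-hand
    side is then infinite, or \<open>\<phi>\<close> has norm zero and Hausdorff--Young suffices.\<close>
  have main: "?Q g \<le> (C + ennreal \<epsilon>\<^sub>\<Omega>) / ennreal (1 - \<epsilon>\<^sub>\<Sigma>) * ?P \<phi>"
  proof (cases "?P \<phi> = 0 \<or> C = \<infinity>")
    case True
    thus ?thesis
    proof
      assume "?P \<phi> = 0"
      thus ?thesis using g_HY by simp
    next
      assume C: "C = \<infinity>"
      show ?thesis
      proof (cases "?P \<phi> = 0")
        case False
        thus ?thesis using C by (simp add: ennreal_top_divide ennreal_top_mult)
      qed (use g_HY in simp)
    qed
  next
    case False
    have \<Sigma>_part: "?Q (\<lambda>l. g l * indicator \<Sigma> l) \<le> (C + ennreal \<epsilon>\<^sub>\<Omega>) * ?P \<phi>"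
    proof (rule tendsto_lowerbound)
      have "(\<lambda>n. b n + (C * (a n + ?P \<phi>) + (a n + ennreal \<epsilon>\<^sub>\<Omega> * ?P \<phi>))) \<longlonglongrightarrow> 0 + (C * (0 + ?P \<phi>) + (0 + ennreal \<epsilon>\<^sub>\<Omega> * ?P \<phi>))"
        using False by (intro tendsto_add a b tendsto_const ennreal_tendsto_cmult) (auto simp: less_top)
      thus "(\<lambda>n. b n + (C * (a n + ?P \<phi>) + (a n + ennreal \<epsilon>\<^sub>\<Omega> * ?P \<phi>))) \<longlonglongrightarrow> (C + ennreal \<epsilon>\<^sub>\<Omega>) * ?P \<phi>"
        by (simp add: distrib_right)
      have "?Q (\<lambda>l. g l * indicator \<Sigma> l) \<le> b n + (C * (a n + ?P \<phi>) + (a n + ennreal \<epsilon>\<^sub>\<Omega> * ?P \<phi>))" for n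
      proof -
        have "?Q (\<lambda>l. g l * indicator \<Sigma> l) \<le>
            ?Q (\<lambda>l. g l * indicator \<Sigma> l - ?F (\<Phi> n) l * indicator \<Sigma> l) + ?Q (\<lambda>l. ?F (\<Phi> n) l * indicator \<Sigma> l)"
          by (rule Lp_norm_le_dist_plus[OF q1]) measurable
        also have "?Q (\<lambda>l. g l * indicator \<Sigma> l - ?F (\<Phi> n) l * indicator \<Sigma> l) \<le> ?Q (\<lambda>l. g l - ?F (\<Phi> n) l)"
        proof (rule Lp_norm_mono[OF q1])
          show "AE l in ?M. norm (g l * indicator \<Sigma> l - ?F (\<Phi> n) l * indicator \<Sigma> l) \<le> norm (g l - ?F (\<Phi> n) l)"
            by (intro AE_I2) (simp split: split_indicator)
        qed measurable
        also have "?Q (\<lambda>l. g l - ?F (\<Phi> n) l) = b n" unfolding b_def by (rule Lp_norm_minus_commute)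
        also have "?Q (\<lambda>l. ?F (\<Phi> n) l * indicator \<Sigma> l) \<le> C * ?P (\<Phi> n) + ?P (\<lambda>x. \<Phi> n x - time_limit \<Omega> (\<Phi> n) x)"
          unfolding C_def by (intro weinstein_integral_concentrated_le \<alpha> p \<Phi>_int) fact+
        also have "?P (\<lambda>x. \<Phi> n x - time_limit \<Omega> (\<Phi> n) x) \<le> a n + ennreal \<epsilon>\<^sub>\<Omega> * ?P \<phi>"
        proof -
          have "?P (\<lambda>x. \<Phi> n x - time_limit \<Omega> (\<Phi> n) x) \<le>
              ?P (\<lambda>x. (\<Phi> n x - time_limit \<Omega> (\<Phi> n) x) - (\<phi> x - time_limit \<Omega> \<phi> x)) + ?P (\<lambda>x. \<phi> x - time_limit \<Omega> \<phi> x)"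
            unfolding time_limit_def by (rule Lp_norm_le_dist_plus[OF p1]) measurable
          also have "?P (\<lambda>x. (\<Phi> n x - time_limit \<Omega> (\<Phi> n) x) - (\<phi> x - time_limit \<Omega> \<phi> x)) \<le> a n"
            unfolding a_def time_limit_def
          proof (rule Lp_norm_mono[OF p1])
            show "AE x in ?M. norm (\<Phi> n x - \<Phi> n x * indicator \<Omega> x - (\<phi> x - \<phi> x * indicator \<Omega> x)) \<le> norm (\<Phi> n x - \<phi> x)"
              by (intro AE_I2) (simp split: split_indicator)
          qed measurable
          also have "?P (\<lambda>x. \<phi> x - time_limit \<Omega> \<phi> x) \<le> ennreal \<epsilon>\<^sub>\<Omega> * ?P \<phi>"
            using assms(11) by (simp add: time_concentrated_def)
          finally show ?thesis by (simp add: add_mono)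
        qed
        also have "C * ?P (\<Phi> n) \<le> C * (a n + ?P \<phi>)" by (intro mult_left_mono \<Phi>_le) simp
        finally show ?thesis by (simp add: add_mono)
      qed
      thus "eventually (\<lambda>n. ?Q (\<lambda>l. g l * indicator \<Sigma> l) \<le> b n + (C * (a n + ?P \<phi>) + (a n + ennreal \<epsilon>\<^sub>\<Omega> * ?P \<phi>))) sequentially"
        by simp
    qed simp
    have "?Q g \<le> ?Q (\<lambda>l. g l - g l * indicator \<Sigma> l) + ?Q (\<lambda>l. g l * indicator \<Sigma> l)"
      by (rule Lp_norm_le_dist_plus[OF q1]) measurable
    also have "\<dots> \<le> ennreal \<epsilon>\<^sub>\<Sigma> * ?Q g + (C + ennreal \<epsilon>\<^sub>\<Omega>) * ?P \<phi>"
      using assms(12) \<Sigma>_part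
      by (intro add_mono) (simp_all add: transform_concentrated_def weinstein_transform_band_limited_def g_def)
    finally have ineq: "?Q g \<le> ennreal \<epsilon>\<^sub>\<Sigma> * ?Q g + (C + ennreal \<epsilon>\<^sub>\<Omega>) * ?P \<phi>" .
    have "?Q g < \<infinity>" using g_HY \<phi>_fin by (rule le_less_trans)
    then obtain G where G: "?Q g = ennreal G" "0 \<le> G" by (cases "?Q g") auto
    obtain N where N: "?P \<phi> = ennreal N" "0 \<le> N" using \<phi>_fin by (cases "?P \<phi>") auto
    obtain c where c: "C = ennreal c" "0 \<le> c" using False by (cases C) auto
    have "ennreal G \<le> ennreal (\<epsilon>\<^sub>\<Sigma> * G + (c + \<epsilon>\<^sub>\<Omega>) * N)"
      using ineq unfolding G(1) N(1) c(1) using G(2) N(2) c(2) assms(7,8)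
      by (simp only: ennreal_mult ennreal_plus mult_nonneg_nonneg add_nonneg_nonneg)
    hence "G \<le> \<epsilon>\<^sub>\<Sigma> * G + (c + \<epsilon>\<^sub>\<Omega>) * N"
      using G(2) N(2) c(2) assms(7,8) by (subst (asm) ennreal_le_iff) auto
    hence "G * (1 - \<epsilon>\<^sub>\<Sigma>) \<le> (c + \<epsilon>\<^sub>\<Omega>) * N" by (simp add: algebra_simps)
    hence "G \<le> (c + \<epsilon>\<^sub>\<Omega>) / (1 - \<epsilon>\<^sub>\<Sigma>) * N" using assms(9) by (simp add: field_simps)
    hence "ennreal G \<le> ennreal ((c + \<epsilon>\<^sub>\<Omega>) / (1 - \<epsilon>\<^sub>\<Sigma>) * N)" by (rule ennreal_leI)
    also have "\<dots> = ennreal ((c + \<epsilon>\<^sub>\<Omega>) / (1 - \<epsilon>\<^sub>\<Sigma>)) * ennreal N"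
      using N c assms(7-9) by (intro ennreal_mult) auto
    also have "ennreal ((c + \<epsilon>\<^sub>\<Omega>) / (1 - \<epsilon>\<^sub>\<Sigma>)) = ennreal (c + \<epsilon>\<^sub>\<Omega>) / ennreal (1 - \<epsilon>\<^sub>\<Sigma>)"
      using c assms(7-9) by (intro divide_ennreal[symmetric]) auto
    also have "ennreal (c + \<epsilon>\<^sub>\<Omega>) = C + ennreal \<epsilon>\<^sub>\<Omega>"
      using c assms(7) by simp
    finally show ?thesis unfolding G N .
  qed
  thus ?thesis unfolding g_def C_def \<open>q = conj_exponent p\<close> .
qed

end
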